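(* Let $A=KQ_n/I$ be a Nakayama algebra with $I$ an admissible ideal of $KQ_n$. Then $$q(A)\le \frac{2}{3}\,n!.$$ The equality holds if and only if $I$ is a principal ideal generated by a path of length $3$. In particular, the $q$-ordering conjecture is true for all Nakayama algebras.
   Context: $K$ is an algebraically closed field and $n\ge 2$. $Q_n$ denotes either the linear quiver $A_n$ with vertices $1,\dots,n$ and arrows $\alpha_j:j\to j+1$ ($1\le j\le n-1$), or the cyclic quiver $\widetilde{A}_n$ with vertices $1,\dots,n$ and arrows $\alpha_j:j\to j+1$ ($1\le j\le n-1$) and $\alpha_n:n\to 1$. A Nakayama algebra here means a finite-dimensional algebra $A=KQ_n/I$ with $I$ an admissible two-sided ideal of the path algebra $KQ_n$. Length of a path means number of arrows plus $1$ (so a path of length $3$ has two arrows). Paths compose from right to left, and modules are such that the indecomposable projective $P(j)$ with top $j$ is uniserial with composition factors $j,j+1,j+2,\dots$ from top to socle (vertices read modulo $n$ in the cyclic case). The simple module at vertex $x$ is denoted by $x$, and $\mathcal{S}$ is the set of all (isomorphism classes of) simple $A$-modules, identified with the set of vertices, so $|\mathcal{S}|=n$. Given a total ordering $\preceq$ on $\mathcal{S}$, the Weyl module $\Delta(x)$ is the maximal factor module of $P(x)$ all of whose composition factors $y$ satisfy $y\preceq x$. A module is good if it has a finite filtration whose successive quotients are Weyl modules. The ordering $\preceq$ is a quasi-hereditary ordering ($q$-ordering) of $A$ if for every $x\in\mathcal{S}$: (1) $\mathrm{End}_A(\Delta(x))\simeq K$, and (2) $P(x)$ is good. $q(A)$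 denotes the number of total orderings on $\mathcal{S}$ that are $q$-orderings of $A$. The $q$-ordering conjecture ($q$-conjecture) states that $q(A)\le\frac{2}{3}n!$ for all non-hereditary algebras $A$ with $n$ simple modules; namely, that $q(A)>\frac{2}{3}n!$ if and only if $q(A)=n!$, which is equivalent to $A$ being hereditary.
   Formalization: The bound is claimed only for non-hereditary A (it fails for I = 0 on the linear quiver, where q(A) = n!), and the equality criterion also requires n ≥ 3 (for n = 2, 2/3·n! is not an integer, yet the cyclic quiver has an admissible I generated by a path of length 3). *)

theory Defs
  imports
    "HOL-Algebra.Algebra"
    "HOL-Algebra.Algebraic_Closure_Type"
    "Graph_Theory.Arc_Walk"
    Complex_Main
begin

section \<open>Left modules over a possibly non-commutative ring\<close>

text \<open>
  The locale \<^locale>\<open>module\<close> demands a commutative ring, but the record type of modules and the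
  predicate \<^const>\<open>submodule\<close> do not, and both are used here for left modules.  The fields
  \<^const>\<open>monoid.mult\<close> and \<^const>\<open>monoid.one\<close> that modules inherit from the ring record are irrelevant.
\<close>

definition regular_module :: "('a, 'c) ring_scheme \<Rightarrow> ('a, 'a) module" where
  "regular_module R =
    \<lparr>carrier = carrier R, monoid.mult = undefined, monoid.one = undefined,
     ring.zero = \<zero>\<^bsub>R\<^esub>, ring.add = (\<lambda>x y. x \<oplus>\<^bsub>R\<^esub> y), module.smult = (\<lambda>a x. a \<otimes>\<^bsub>R\<^esub> x)\<rparr>"

definition restrict_module :: "('a, 'b) module \<Rightarrow> 'b set \<Rightarrow> ('a, 'b) module" where
  "restrict_module M N = M\<lparr>carrier := N\<rparr>"

definition quot_module :: "('a, 'b) module \<Rightarrow> 'b set \<Rightarrow> ('a, 'b set) module" where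
  "quot_module M N =
    \<lparr>carrier = a_rcosets\<^bsub>M\<^esub> N, monoid.mult = undefined, monoid.one = undefined,
     ring.zero = N, ring.add = set_add M, module.smult = (\<lambda>a B. \<Union>x\<in>B. N +>\<^bsub>M\<^esub> (a \<odot>\<^bsub>M\<^esub> x))\<rparr>"

definition mod_hom ::
  "('a, 'r) ring_scheme \<Rightarrow> ('a, 'b) module \<Rightarrow> ('a, 'c) module \<Rightarrow> ('b \<Rightarrow> 'c) set" where
  "mod_hom R M N =
    {f \<in> carrier M \<rightarrow> carrier N.
      (\<forall>x\<in>carrier M. \<forall>y\<in>carrier M. f (x \<oplus>\<^bsub>M\<^esub> y) = f x \<oplus>\<^bsub>N\<^esub> f y) \<and>
      (\<forall>a\<in>carrier R. \<forall>x\<in>carrier M. f (a \<odot>\<^bsub>M\<^esub> x) = a \<odot>\<^bsub>N\<^esub> f x)}"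

definition mod_iso ::
  "('a, 'r) ring_scheme \<Rightarrow> ('a, 'b) module \<Rightarrow> ('a, 'c) module \<Rightarrow> bool" where
  "mod_iso R M N \<longleftrightarrow> (\<exists>f\<in>mod_hom R M N. bij_betw f (carrier M) (carrier N))"

text \<open>Endomorphisms are taken extensional, so that each is represented by exactly one function.\<close>

definition End_ring :: "('a, 'r) ring_scheme \<Rightarrow> ('a, 'b) module \<Rightarrow> ('b \<Rightarrow> 'b) ring" where
  "End_ring R M =
    \<lparr>carrier = mod_hom R M M \<inter> extensional (carrier M),
     monoid.mult = compose (carrier M), monoid.one = (\<lambda>x\<in>carrier M. x),
     ring.zero = (\<lambda>x\<in>carrier M. \<zero>\<^bsub>M\<^esub>), ring.add = (\<lambda>f g. \<lambda>x\<in>carrier M. f x \<oplus>\<^bsub>M\<^esub> g x)\<rparr>"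

definition simple_module :: "('a, 'r) ring_scheme \<Rightarrow> ('a, 'b) module \<Rightarrow> bool" where
  "simple_module R M \<longleftrightarrow>
    carrier M \<noteq> {\<zero>\<^bsub>M\<^esub>} \<and> (\<forall>N. submodule N R M \<longrightarrow> N = {\<zero>\<^bsub>M\<^esub>} \<or> N = carrier M)"

definition maximal_submodule :: "'b set \<Rightarrow> ('a, 'r) ring_scheme \<Rightarrow> ('a, 'b) module \<Rightarrow> bool" where
  "maximal_submodule N R M \<longleftrightarrow>
    submodule N R M \<and> N \<noteq> carrier M \<and>
    (\<forall>L. submodule L R M \<and> N \<subseteq> L \<longrightarrow> L = N \<or> L = carrier M)"

definition module_radical :: "('a, 'r) ring_scheme \<Rightarrow> ('a, 'b) module \<Rightarrow> 'b set" where
  "module_radical R M = carrier M \<inter> \<Inter>{N. maximal_submodule N R M}"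

text \<open>A finite filtration \<open>{0} = Ns ! 0 \<subseteq> Ns ! 1 \<subseteq> \<dots> \<subseteq> last Ns = M\<close> and its successive quotients.\<close>

definition filtration :: "('a, 'r) ring_scheme \<Rightarrow> ('a, 'b) module \<Rightarrow> 'b set list \<Rightarrow> bool" where
  "filtration R M Ns \<longleftrightarrow>
    Ns \<noteq> [] \<and> hd Ns = {\<zero>\<^bsub>M\<^esub>} \<and> last Ns = carrier M \<and>
    (\<forall>N\<in>set Ns. submodule N R M) \<and>
    (\<forall>i. Suc i < length Ns \<longrightarrow> Ns ! i \<subseteq> Ns ! Suc i)"

definition filtration_quot ::
  "('a, 'b) module \<Rightarrow> 'b set list \<Rightarrow> nat \<Rightarrow> ('a, 'b set) module" where
  "filtration_quot M Ns i = quot_module (restrict_module M (Ns ! Suc i)) (Ns ! i)"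

definition composition_series :: "('a, 'r) ring_scheme \<Rightarrow> ('a, 'b) module \<Rightarrow> 'b set list \<Rightarrow> bool" where
  "composition_series R M Ns \<longleftrightarrow>
    filtration R M Ns \<and>
    (\<forall>i. Suc i < length Ns \<longrightarrow> simple_module R (filtration_quot M Ns i))"

definition composition_factor ::
  "('a, 'r) ring_scheme \<Rightarrow> ('a, 'b) module \<Rightarrow> ('a, 'c) module \<Rightarrow> bool" where
  "composition_factor R M S \<longleftrightarrow>
    (\<exists>Ns i. composition_series R M Ns \<and> Suc i < length Ns \<and> mod_iso R (filtration_quot M Ns i) S)"

text \<open>
  A module is projective iff it is a direct summand of a free module.  Since every module \<open>M\<close> is a
  quotient of the free module on the set \<^term>\<open>carrier M\<close>, it suffices to consider index sets
  consisting of elements of the type underlying \<open>M\<close>.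
\<close>

definition free_module :: "('a, 'r) ring_scheme \<Rightarrow> 'i set \<Rightarrow> ('a, 'i \<Rightarrow> 'a) module" where
  "free_module R B =
    \<lparr>carrier = {f \<in> B \<rightarrow>\<^sub>E carrier R. finite {x \<in> B. f x \<noteq> \<zero>\<^bsub>R\<^esub>}},
     monoid.mult = undefined, monoid.one = undefined, ring.zero = (\<lambda>x\<in>B. \<zero>\<^bsub>R\<^esub>),
     ring.add = (\<lambda>f g. \<lambda>x\<in>B. f x \<oplus>\<^bsub>R\<^esub> g x), module.smult = (\<lambda>a f. \<lambda>x\<in>B. a \<otimes>\<^bsub>R\<^esub> f x)\<rparr>"

definition projective_module :: "('a, 'r) ring_scheme \<Rightarrow> ('a, 'b) module \<Rightarrow> bool" where
  "projective_module R M \<longleftrightarrow>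
    (\<exists>(B :: 'b set) s p. s \<in> mod_hom R M (free_module R B) \<and> p \<in> mod_hom R (free_module R B) M \<and>
      (\<forall>m\<in>carrier M. p (s m) = m))"

definition hereditary :: "('a, 'r) ring_scheme \<Rightarrow> bool" where
  "hereditary R \<longleftrightarrow>
    (\<forall>L. submodule L R (regular_module R) \<longrightarrow>
      projective_module R (restrict_module (regular_module R) L))"


section \<open>Path algebras of quivers\<close>

text \<open>
  A quiver is a directed multigraph.  A path is a pair \<open>(u, as)\<close> of its starting vertex and the list
  of its arrows in the order in which they are traversed.
\<close>

type_synonym ('v, 'e) path = "'v \<times> 'e list"

definition paths :: "('v, 'e) pre_digraph \<Rightarrow> ('v, 'e) path set" where
  "paths Q = {(u, as). \<exists>v. pre_digraph.awalk Q u as v}"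

definition path_end :: "('v, 'e) pre_digraph \<Rightarrow> ('v, 'e) path \<Rightarrow> 'v" where
  "path_end Q p = last (pre_digraph.awalk_verts Q (fst p) (snd p))"

text \<open>The length of a path counts its vertices, not its arrows.\<close>

definition path_length :: "('v, 'e) path \<Rightarrow> nat" where
  "path_length p = length (snd p) + 1"

definition path_elem :: "('v, 'e) path \<Rightarrow> ('v, 'e) path \<Rightarrow> 'k::field" where
  "path_elem p = (\<lambda>q. if q = p then 1 else 0)"

text \<open>
  Elements are finitely supported families of coefficients.  Paths compose from right to left: in
  \<open>f \<otimes> g\<close> the coefficient of a path sums over all ways of cutting it into an initial part, read off in
  the right factor \<open>g\<close>, and a final part, read off in the left factor \<open>f\<close>.
\<close>

definition path_algebra :: "('v, 'e) pre_digraph \<Rightarrow> (('v, 'e) path \<Rightarrow> 'k::field) ring" where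
  "path_algebra Q =
    \<lparr>carrier = {f. finite {p. f p \<noteq> 0} \<and> {p. f p \<noteq> 0} \<subseteq> paths Q},
     monoid.mult = (\<lambda>f g (u, as). \<Sum>k\<le>length as.
       f (path_end Q (u, take k as), drop k as) * g (u, take k as)),
     monoid.one = (\<lambda>(u, as). if u \<in> verts Q \<and> as = [] then 1 else 0),
     ring.zero = (\<lambda>_. 0),
     ring.add = (\<lambda>f g p. f p + g p)\<rparr>"

definition arrow_ideal :: "('v, 'e) pre_digraph \<Rightarrow> (('v, 'e) path \<Rightarrow> 'k::field) set" where
  "arrow_ideal Q = Idl\<^bsub>path_algebra Q\<^esub> {path_elem (tail Q a, [a]) | a. a \<in> arcs Q}"

definition ideal_power :: "('a, 'r) ring_scheme \<Rightarrow> 'a set \<Rightarrow> nat \<Rightarrow> 'a set" where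
  "ideal_power R J m = (ideal_prod R J ^^ m) (carrier R)"

definition admissible_ideal ::
  "('v, 'e) pre_digraph \<Rightarrow> (('v, 'e) path \<Rightarrow> 'k::field) set \<Rightarrow> bool" where
  "admissible_ideal Q I \<longleftrightarrow>
    ideal I (path_algebra Q) \<and>
    I \<subseteq> ideal_power (path_algebra Q) (arrow_ideal Q) 2 \<and>
    (\<exists>m\<ge>2. ideal_power (path_algebra Q) (arrow_ideal Q) m \<subseteq> I)"

text \<open>The algebra \<open>A = KQ/I\<close>, with the image in \<open>A\<close> of a scalar and of the trivial path at a vertex.\<close>

definition quiver_algebra ::
  "('v, 'e) pre_digraph \<Rightarrow> (('v, 'e) path \<Rightarrow> 'k::field) set \<Rightarrow> (('v, 'e) path \<Rightarrow> 'k) set ring" where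
  "quiver_algebra Q I = path_algebra Q Quot I"

definition scalar_elem ::
  "('v, 'e) pre_digraph \<Rightarrow> (('v, 'e) path \<Rightarrow> 'k::field) set \<Rightarrow> 'k \<Rightarrow> (('v, 'e) path \<Rightarrow> 'k) set" where
  "scalar_elem Q I c = I +>\<^bsub>path_algebra Q\<^esub> (\<lambda>p. c * \<one>\<^bsub>path_algebra Q\<^esub> p)"

definition vertex_idem ::
  "('v, 'e) pre_digraph \<Rightarrow> (('v, 'e) path \<Rightarrow> 'k::field) set \<Rightarrow> 'v \<Rightarrow> (('v, 'e) path \<Rightarrow> 'k) set" where
  "vertex_idem Q I x = I +>\<^bsub>path_algebra Q\<^esub> path_elem (x, [])"

text \<open>
  With left modules, \<open>P(x) = A e\<^sub>x\<close> is spanned by the paths starting at \<open>x\<close>; in particular, its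
  composition factors are read off along the arrows leaving \<open>x\<close>.  The simple module at \<open>x\<close> is its top.
\<close>

definition proj_at ::
  "('v, 'e) pre_digraph \<Rightarrow> (('v, 'e) path \<Rightarrow> 'k::field) set \<Rightarrow> 'v \<Rightarrow>
    ((('v, 'e) path \<Rightarrow> 'k) set, (('v, 'e) path \<Rightarrow> 'k) set) module" where
  "proj_at Q I x = restrict_module (regular_module (quiver_algebra Q I))
    {a \<otimes>\<^bsub>quiver_algebra Q I\<^esub> vertex_idem Q I x | a. a \<in> carrier (quiver_algebra Q I)}"

definition simple_at ::
  "('v, 'e) pre_digraph \<Rightarrow> (('v, 'e) path \<Rightarrow> 'k::field) set \<Rightarrow> 'v \<Rightarrow>
    ((('v, 'e) path \<Rightarrow> 'k) set, (('v, 'e) path \<Rightarrow> 'k) set set) module" where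
  "simple_at Q I x = quot_module (proj_at Q I x) (module_radical (quiver_algebra Q I) (proj_at Q I x))"


section \<open>Weyl modules and quasi-hereditary orderings\<close>

text \<open>
  Orderings are relations on the vertices, \<^term>\<open>(y, x) \<in> r\<close> meaning \<open>y \<preceq> x\<close>.  The submodules \<open>U\<close> of
  \<open>P(x)\<close> such that all composition factors \<open>y\<close> of \<open>P(x)/U\<close> satisfy \<open>y \<preceq> x\<close> are closed under
  intersection (for finite-dimensional \<open>A\<close>), so that the intersection of all of them yields the
  maximal factor module with this property.
\<close>

definition weyl_module ::
  "('v, 'e) pre_digraph \<Rightarrow> (('v, 'e) path \<Rightarrow> 'k::field) set \<Rightarrow> 'v rel \<Rightarrow> 'v \<Rightarrow>
    ((('v, 'e) path \<Rightarrow> 'k) set, (('v, 'e) path \<Rightarrow> 'k) set set) module" where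
  "weyl_module Q I r x = quot_module (proj_at Q I x)
    (\<Inter>{U. submodule U (quiver_algebra Q I) (proj_at Q I x) \<and>
        (\<forall>y\<in>verts Q.
          composition_factor (quiver_algebra Q I) (quot_module (proj_at Q I x) U) (simple_at Q I y)
            \<longrightarrow> (y, x) \<in> r)})"

definition good_module ::
  "('v, 'e) pre_digraph \<Rightarrow> (('v, 'e) path \<Rightarrow> 'k::field) set \<Rightarrow> 'v rel \<Rightarrow>
    ((('v, 'e) path \<Rightarrow> 'k) set, 'b) module \<Rightarrow> bool" where
  "good_module Q I r M \<longleftrightarrow>
    (\<exists>Ns. filtration (quiver_algebra Q I) M Ns \<and>
      (\<forall>i. Suc i < length Ns \<longrightarrow>
        (\<exists>y\<in>verts Q. mod_iso (quiver_algebra Q I) (filtration_quot M Ns i) (weyl_module Q I r y))))"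

text \<open>\<open>End\<^sub>A(M) \<simeq> K\<close> as \<open>K\<close>-algebras\<close>

definition End_iso_field ::
  "('v, 'e) pre_digraph \<Rightarrow> (('v, 'e) path \<Rightarrow> 'k::field) set \<Rightarrow>
    ((('v, 'e) path \<Rightarrow> 'k) set, 'b) module \<Rightarrow> bool" where
  "End_iso_field Q I M \<longleftrightarrow>
    (\<exists>\<phi> \<in> ring_iso (End_ring (quiver_algebra Q I) M) (ring_of_type_algebra :: 'k ring).
      \<forall>c. \<forall>f\<in>carrier (End_ring (quiver_algebra Q I) M).
        \<phi> (\<lambda>m\<in>carrier M. scalar_elem Q I c \<odot>\<^bsub>M\<^esub> f m) = c * \<phi> f)"

definition q_ordering ::
  "('v, 'e) pre_digraph \<Rightarrow> (('v, 'e) path \<Rightarrow> 'k::field) set \<Rightarrow> 'v rel \<Rightarrow> bool" where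
  "q_ordering Q I r \<longleftrightarrow>
    linear_order_on (verts Q) r \<and>
    (\<forall>x\<in>verts Q. End_iso_field Q I (weyl_module Q I r x) \<and> good_module Q I r (proj_at Q I x))"

definition num_q_orderings ::
  "('v, 'e) pre_digraph \<Rightarrow> (('v, 'e) path \<Rightarrow> 'k::field) set \<Rightarrow> nat" where
  "num_q_orderings Q I = card {r. q_ordering Q I r}"


section \<open>The linear and the cyclic quiver\<close>

definition linear_quiver :: "nat \<Rightarrow> (nat, nat) pre_digraph" where
  "linear_quiver n = \<lparr>verts = {1..n}, arcs = {1..<n}, tail = (\<lambda>j. j), head = (\<lambda>j. j + 1)\<rparr>"

definition cyclic_quiver :: "nat \<Rightarrow> (nat, nat) pre_digraph" where
  "cyclic_quiver n =
    \<lparr>verts = {1..n}, arcs = {1..n}, tail = (\<lambda>j. j), head = (\<lambda>j. if j = n then 1 else j + 1)\<rparr>"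

end

theory Submission
  imports Defs
begin

text \<open>
  The ideal \<open>I\<close> is spanned by paths, so every \<open>P(x)\<close> is uniserial, its submodules are the powers of its
  radical, and \<open>A\<close> is described by the composition lengths \<open>L x\<close> of the \<open>P(x)\<close>.  The Weyl module at \<open>x\<close> is the
  longest quotient of \<open>P(x)\<close> all of whose factors are at most \<open>x\<close>, and \<open>P(x)\<close> is good iff cutting off one
  Weyl module after the other from the top exhausts it exactly; the cuts are then at records of the sequence
  \<open>x, x + 1, \<dots>\<close> of its factors.

  If \<open>x\<close> is the start of a minimal relation, that is \<open>L (x + 1) \<ge> L x \<ge> 2\<close>, then \<open>P(x)\<close> being good forces
  the maximum of \<open>x, x + 1, \<dots>, x + L x\<close> to be attained at an end.  In particular, in the ordering \<open>x + 1\<close> is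
  not the maximum of a suitable triple \<open>{x, x + 1, c}\<close>, which is true of exactly two thirds of all orderings.
  Equality leaves only one minimal relation, with \<open>L x = 2\<close>, and in that case the condition is also sufficient.
  Without minimal relations no filtration can fail, and this happens iff all left ideals are projective.
\<close>

section \<open>Counting linear orders\<close>

text \<open>As each vertex has at most one outgoing arrow, a path is determined by its start and its
  number of arrows; so the counting sees only the vertices, the successor map and \<open>L\<close>,
  and both quivers are treated alike. The maximum has to sit at an end because of the bottom Weyl
  factor of P(x). If it starts at x + p with p > 0, then P(x + p) reaches beyond the end of P(x), so
  this factor can stop there only because x + L x exceeds x + p. And x + p dominates all factors of
  P(x): those before it because it is a record, those after it because they lie in its Weyl module.
  For the triple, c = x + L x is the natural choice. On a cycle this vertex can coincide with x or x
  + 1; then x has to be the maximum of the factors of P(x), so x + 1 lies below x in every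
  q-ordering and c = x + 2 serves. For two vertices there is no c at all: one of the two orderings
  is excluded, and equality cannot occur as 4/3 is not an integer.\<close>

lemma linear_order_on_iff:
  "linear_order_on V r \<longleftrightarrow> r \<subseteq> V \<times> V \<and> (\<forall>x\<in>V. (x, x) \<in> r) \<and>
    (\<forall>x y z. (x, y) \<in> r \<longrightarrow> (y, z) \<in> r \<longrightarrow> (x, z) \<in> r) \<and>
    (\<forall>x y. (x, y) \<in> r \<longrightarrow> (y, x) \<in> r \<longrightarrow> x = y) \<and>
    (\<forall>x\<in>V. \<forall>y\<in>V. (x, y) \<in> r \<or> (y, x) \<in> r)"
proof -
  have "total_on V r \<longleftrightarrow> (\<forall>x\<in>V. \<forall>y\<in>V. (x, y) \<in> r \<or> (y, x) \<in> r)"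
    if "\<forall>x\<in>V. (x, x) \<in> r"
    using that unfolding total_on_def by metis
  then show ?thesis
    unfolding order_on_defs refl_on_def by (auto simp: trans_def antisym_def)
qed

lemma linear_orderD:
  assumes "linear_order_on V r"
  shows linear_order_refl: "x \<in> V \<Longrightarrow> (x, x) \<in> r"
    and linear_order_trans: "(x, y) \<in> r \<Longrightarrow> (y, z) \<in> r \<Longrightarrow> (x, z) \<in> r"
    and linear_order_antisym: "(x, y) \<in> r \<Longrightarrow> (y, x) \<in> r \<Longrightarrow> x = y"
    and linear_order_total: "x \<in> V \<Longrightarrow> y \<in> V \<Longrightarrow> (x, y) \<in> r \<or> (y, x) \<in> r"
    and linear_order_subset: "r \<subseteq> V \<times> V"
  using assms unfolding linear_order_on_iff by (blast, meson, blast, blast, blast)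

lemma finite_linear_orders: "finite V \<Longrightarrow> finite {r. linear_order_on V r}"
  by (rule finite_subset[of _ "Pow (V \<times> V)"]) (auto simp: linear_order_on_iff)

lemma linear_order_on_add_top:
  assumes "linear_order_on (V - {m}) s" "m \<in> V"
  shows "linear_order_on V (s \<union> V \<times> {m})"
proof -
  have s: "s \<subseteq> (V - {m}) \<times> (V - {m})" using assms by (simp add: linear_order_on_iff)
  show ?thesis
    unfolding linear_order_on_iff
  proof (intro conjI ballI allI impI)
    fix x y z assume "(x, y) \<in> s \<union> V \<times> {m}" "(y, z) \<in> s \<union> V \<times> {m}"
    then show "(x, z) \<in> s \<union> V \<times> {m}" using s linear_order_trans[OF assms(1)] by blast
  next
    fix x y assume "(x, y) \<in> s \<union> V \<times> {m}" "(y, x) \<in> s \<union> V \<times> {m}"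
    then show "x = y" using s linear_order_antisym[OF assms(1)] by blast
  next
    fix x y assume "x \<in> V" "y \<in> V"
    then show "(x, y) \<in> s \<union> V \<times> {m} \<or> (y, x) \<in> s \<union> V \<times> {m}"
      using linear_order_total[OF assms(1)] by blast
  qed (use s assms linear_order_refl[OF assms(1)] in blast)+
qed

lemma linear_order_top:
  assumes "finite V" "V \<noteq> {}" "linear_order_on V r"
  obtains m where "m \<in> V" "\<And>y. y \<in> V \<Longrightarrow> (y, m) \<in> r"
proof -
  have "\<exists>m\<in>W. \<forall>y\<in>W. (y, m) \<in> r" if "finite W" "W \<noteq> {}" "W \<subseteq> V" for W
    using that
  proof (induction W rule: finite_ne_induct)
    case (singleton x)
    then show ?case using assms(3) by (auto simp: linear_order_on_iff)
  next
    case (insert x F)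
    then obtain m where m: "m \<in> F" "\<forall>y\<in>F. (y, m) \<in> r" by auto
    show ?case
    proof (cases "(x, m) \<in> r")
      case True
      then show ?thesis using m by auto
    next
      case False
      then have "(m, x) \<in> r" "(x, x) \<in> r"
        
        using m insert.prems linear_order_refl[OF assms(3)] linear_order_total[OF assms(3), of x m]
        by auto
      then have "\<forall>y\<in>insert x F. (y, x) \<in> r"
        using m linear_order_trans[OF assms(3)] by blast
      then show ?thesis by blast
    qed
  qed
  from this[of V] assms that show ?thesis by blast
qed

lemma linear_order_on_remove_top:
  assumes "linear_order_on V r" "m \<in> V" "\<And>y. y \<in> V \<Longrightarrow> (y, m) \<in> r"
  shows "linear_order_on (V - {m}) (r \<inter> (V - {m}) \<times> (V - {m}))"
    and "r = r \<inter> (V - {m}) \<times> (V - {m}) \<union> V \<times> {m}"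
proof -
  note r = linear_orderD[OF assms(1)]
  show "linear_order_on (V - {m}) (r \<inter> (V - {m}) \<times> (V - {m}))"
    unfolding linear_order_on_iff
  proof (intro conjI ballI allI impI)
    fix x y z assume "(x, y) \<in> r \<inter> (V - {m}) \<times> (V - {m})" "(y, z) \<in> r \<inter> (V - {m}) \<times> (V - {m})"
    then show "(x, z) \<in> r \<inter> (V - {m}) \<times> (V - {m})" using r(2) by blast
  qed (use r in blast)+
  show "r = r \<inter> (V - {m}) \<times> (V - {m}) \<union> V \<times> {m}"
  proof (intro equalityI subrelI)
    fix x y assume xy: "(x, y) \<in> r"
    then have "x \<in> V" "y \<in> V" using r(5) by auto
    then show "(x, y) \<in> r \<inter> (V - {m}) \<times> (V - {m}) \<union> V \<times> {m}"
      using xy r(3)[of x y] assms(3)[of y] by auto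
  qed (use assms in auto)
qed

text \<open>An order is its maximum together with an order on the remaining elements, which gives
  the recursion of the factorial; antisymmetry makes the classes \<open>F m\<close> of different
  maxima disjoint.\<close>

lemma card_linear_orders:
  assumes "finite V"
  shows "card {r. linear_order_on V r} = fact (card V)"
  using assms
proof (induction "card V" arbitrary: V)
  case 0
  then have "{r. linear_order_on V r} = {{}}" by (auto simp: linear_order_on_iff)
  then show ?case using 0 by simp
next
  case (Suc k)
  define F where "F m = (\<lambda>s. s \<union> V \<times> {m}) ` {s. linear_order_on (V - {m}) s}" for m
  have ne: "V \<noteq> {}" using Suc.hyps(2) by auto
  have eq: "{r. linear_order_on V r} = (\<Union>m\<in>V. F m)"
  proof (intro equalityI subsetI)
    fix r assume "r \<in> {r. linear_order_on V r}"
    then have r: "linear_order_on V r" by simp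
    obtain m where m: "m \<in> V" "\<And>y. y \<in> V \<Longrightarrow> (y, m) \<in> r"
      using linear_order_top[OF Suc.prems ne r] by blast
    have "r \<in> F m"
      unfolding F_def using linear_order_on_remove_top[OF r m]
      by (intro image_eqI[where x = "r \<inter> (V - {m}) \<times> (V - {m})"]) auto
    then show "r \<in> (\<Union>m\<in>V. F m)" using m(1) by blast
  next
    fix r assume "r \<in> (\<Union>m\<in>V. F m)"
    then obtain m s where "m \<in> V" "linear_order_on (V - {m}) s" "r = s \<union> V \<times> {m}"
      unfolding F_def by auto
    then show "r \<in> {r. linear_order_on V r}"
      using linear_order_on_add_top by simp
  qed
  have card_F: "card (F m) = fact k" if m: "m \<in> V" for m
  proof -
    have "inj_on (\<lambda>s. s \<union> V \<times> {m}) {s. linear_order_on (V - {m}) s}"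
    proof (rule inj_onI)
      fix s t assume st: "s \<in> {s. linear_order_on (V - {m}) s}"
        "t \<in> {s. linear_order_on (V - {m}) s}" "s \<union> V \<times> {m} = t \<union> V \<times> {m}"
      then have "s \<inter> V \<times> {m} = {}" "t \<inter> V \<times> {m} = {}"
        using linear_order_subset[of "V - {m}" s] linear_order_subset[of "V - {m}" t] by auto
      then show "s = t" using st(3) by blast
    qed
    then have "card (F m) = card {s. linear_order_on (V - {m}) s}"
      unfolding F_def by (rule card_image)
    also have "\<dots> = fact (card (V - {m}))"
      using Suc.hyps(1)[of "V - {m}"] Suc.hyps(2) Suc.prems m by auto
    finally show ?thesis using m Suc.prems by (simp flip: Suc.hyps(2))
  qed
  have "card (\<Union>m\<in>V. F m) = (\<Sum>m\<in>V. card (F m))"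
  proof (rule card_UN_disjoint)
    show "\<forall>m\<in>V. finite (F m)" unfolding F_def using Suc.prems by (simp add: finite_linear_orders)
    show "\<forall>i\<in>V. \<forall>j\<in>V. i \<noteq> j \<longrightarrow> F i \<inter> F j = {}"
    proof (intro ballI impI equals0I)
      fix i j r assume ij: "i \<in> V" "j \<in> V" "i \<noteq> j" and r: "r \<in> F i \<inter> F j"
      then have "linear_order_on V r" "(i, j) \<in> r" "(j, i) \<in> r"
        unfolding F_def using linear_order_on_add_top[of V i] by auto
      then show False using ij linear_order_antisym by metis
    qed
  qed (use Suc.prems in auto)
  then show ?case using card_F eq Suc.hyps(2)[symmetric] by simp
qed

text \<open>Source of all counterexample orders below: fixing the largest and the second largest
  vertex decides every comparison that they rely on. The other elements can be ordered somehow,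
  because the number of orders is a factorial and hence not zero.\<close>

lemma linear_order_two_tops:
  assumes "finite V" "a \<in> V" "b \<in> V" "a \<noteq> b"
  obtains r where "linear_order_on V r" "\<And>y. y \<in> V \<Longrightarrow> (y, b) \<in> r"
    "\<And>y. y \<in> V \<Longrightarrow> y \<noteq> b \<Longrightarrow> (y, a) \<in> r"
proof -
  have "card {r. linear_order_on (V - {b} - {a}) r} \<noteq> 0"
    using assms by (subst card_linear_orders) auto
  then obtain s where s: "linear_order_on (V - {b} - {a}) s"
    by (metis (mono_tags, lifting) card.empty empty_Collect_eq)
  let ?r = "(s \<union> (V - {b}) \<times> {a}) \<union> V \<times> {b}"
  have "linear_order_on V ?r"
    using assms s by (intro linear_order_on_add_top) auto
  then show ?thesis by (rule that) auto
qed

definition orders_not_max :: "'a set \<Rightarrow> 'a \<Rightarrow> 'a \<Rightarrow> 'a \<Rightarrow> 'a rel set" where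
  "orders_not_max V a b c = {r. linear_order_on V r \<and> \<not> ((a, b) \<in> r \<and> (c, b) \<in> r)}"

text \<open>Transpositions show that each of \<open>a\<close>, \<open>b\<close>, \<open>c\<close> is the maximum of \<open>{a, b, c}\<close> equally often.\<close>

lemma card_orders_not_max:
  assumes fin: "finite V" and V: "a \<in> V" "b \<in> V" "c \<in> V" and d: "a \<noteq> b" "b \<noteq> c" "a \<noteq> c"
  shows "3 * card (orders_not_max V a b c) = 2 * fact (card V)"
proof -
  define M where "M m = {r. linear_order_on V r \<and> (\<forall>y\<in>{a, b, c}. (y, m) \<in> r)}" for m
  have finM: "finite (M m)" for m
    by (rule finite_subset[OF _ finite_linear_orders[OF fin]]) (auto simp: M_def)
  have swap: "card (M m) = card (M m')" if m: "m \<in> {a, b, c}" "m' \<in> {a, b, c}" for m m'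
  proof -
    define f where "f = transpose m m'"
    have ff [simp]: "f (f x) = x" for x by (simp add: f_def)
    have fV: "f x \<in> V" if "x \<in> V" for x using that m V by (auto simp: f_def transpose_def)
    have fV': "f x \<in> V \<longleftrightarrow> x \<in> V" for x using fV[of x] fV[of "f x"] by auto
    have fS: "f x \<in> {a, b, c} \<longleftrightarrow> x \<in> {a, b, c}" for x
      using m by (auto simp: f_def transpose_def)
    have fm: "f m = m'" "f m' = m" by (simp_all add: f_def)
    have finj: "f x = f y \<longleftrightarrow> x = y" for x y by (metis ff)
    have lin: "linear_order_on V {(x, y). (f x, f y) \<in> r}" if "linear_order_on V r" for r
      unfolding linear_order_on_iff
    proof (intro conjI)
      show "{(x, y). (f x, f y) \<in> r} \<subseteq> V \<times> V"
        using linear_order_subset[OF that] fV' by blast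
      show "\<forall>x y. (x, y) \<in> {(x, y). (f x, f y) \<in> r} \<longrightarrow> (y, x) \<in> {(x, y). (f x, f y) \<in> r} \<longrightarrow> x = y"
        using linear_order_antisym[OF that] finj by blast
      show "\<forall>x y z. (x, y) \<in> {(x, y). (f x, f y) \<in> r} \<longrightarrow> (y, z) \<in> {(x, y). (f x, f y) \<in> r} \<longrightarrow>
          (x, z) \<in> {(x, y). (f x, f y) \<in> r}"
        using linear_order_trans[OF that] by blast
    qed (use linear_order_refl[OF that] linear_order_total[OF that] fV in auto)
    have im: "{(x, y). (f x, f y) \<in> r} \<in> M (f k)" if "r \<in> M k" for r k
    proof -
      have "(f y, k) \<in> r" if "y \<in> {a, b, c}" for y using \<open>r \<in> M k\<close> that fS[of y] unfolding M_def by blast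
      then show ?thesis using lin[of r] \<open>r \<in> M k\<close> unfolding M_def by simp
    qed
    have "bij_betw (\<lambda>r. {(x, y). (f x, f y) \<in> r}) (M m) (M m')"
    proof (rule bij_betw_byWitness[where f' = "\<lambda>r. {(x, y). (f x, f y) \<in> r}"])
      show "(\<lambda>r. {(x, y). (f x, f y) \<in> r}) ` M m \<subseteq> M m'"
        using im[of _ m] unfolding fm by (rule image_subsetI)
      show "(\<lambda>r. {(x, y). (f x, f y) \<in> r}) ` M m' \<subseteq> M m"
        using im[of _ m'] unfolding fm by (rule image_subsetI)
    qed simp_all
    then show ?thesis by (rule bij_betw_same_card)
  qed
  have split: "{r. linear_order_on V r} = M b \<union> orders_not_max V a b c"
    and disj: "M b \<inter> orders_not_max V a b c = {}"
    using linear_order_refl[of V _ b] V(2) by (auto simp: M_def orders_not_max_def)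
  have "finite (orders_not_max V a b c)"
    by (rule finite_subset[OF _ finite_linear_orders[OF fin]]) (auto simp: orders_not_max_def)
  then have "fact (card V) = card (M b) + card (orders_not_max V a b c)"
    using split disj finM card_linear_orders[OF fin] by (metis card_Un_disjoint)
  \<comment> \<open>If \<open>b\<close> is not the maximum of the triple, then \<open>a\<close> or
    \<open>c\<close> is: two of three disjoint classes of equal size, whence the fraction two
    thirds.\<close>
  moreover have "orders_not_max V a b c = M a \<union> M c"
  proof (intro equalityI subsetI)
    fix r assume "r \<in> orders_not_max V a b c"
    then have r: "linear_order_on V r" "\<not> ((a, b) \<in> r \<and> (c, b) \<in> r)"
      by (auto simp: orders_not_max_def)
    have refl: "(a, a) \<in> r" "(c, c) \<in> r" "(b, b) \<in> r" using linear_order_refl[OF r(1)] V by auto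
    have tot: "(a, b) \<in> r \<or> (b, a) \<in> r" "(c, b) \<in> r \<or> (b, c) \<in> r" "(a, c) \<in> r \<or> (c, a) \<in> r"
      using linear_order_total[OF r(1)] V by auto
    note tr = linear_order_trans[OF r(1)]
    have b: "(b, a) \<in> r \<or> (b, c) \<in> r" using r(2) tot by blast
    show "r \<in> M a \<union> M c"
    proof (cases "(a, c) \<in> r")
      case True
      then have "(b, c) \<in> r" using b tr[of b a c] by blast
      then show ?thesis using True r(1) refl by (simp add: M_def)
    next
      case False
      then have "(c, a) \<in> r" using tot by blast
      moreover from this have "(b, a) \<in> r" using b tr[of b c a] by blast
      ultimately show ?thesis using r(1) refl by (simp add: M_def)
    qed
  next
    fix r assume "r \<in> M a \<union> M c"
    then have r: "linear_order_on V r" "(\<forall>y\<in>{a,b,c}. (y, a) \<in> r) \<or> (\<forall>y\<in>{a,b,c}. (y, c) \<in> r)"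
      by (auto simp: M_def)
    show "r \<in> orders_not_max V a b c"
      unfolding orders_not_max_def using r linear_order_antisym[OF r(1)] d by blast
  qed
  moreover have "M a \<inter> M c = {}" 
    using d linear_order_antisym[of V _ a c] by (auto simp: M_def)
  ultimately show ?thesis using swap[of a b] swap[of c b] finM
    by (simp add: card_Un_disjoint)
qed

section \<open>Kupisch series and quasi-hereditary orderings\<close>

text \<open>\<open>L x\<close> is the composition length of \<open>P(x)\<close>, and \<open>nx x\<close> the vertex following \<open>x\<close>.\<close>

locale kupisch =
  fixes V :: "'v set" and nx :: "'v \<Rightarrow> 'v" and L :: "'v \<Rightarrow> nat"
  assumes finite_V: "finite V"
    and L_pos: "x \<in> V \<Longrightarrow> 1 \<le> L x"
    and nx_in: "x \<in> V \<Longrightarrow> 2 \<le> L x \<Longrightarrow> nx x \<in> V"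
    and L_nx: "x \<in> V \<Longrightarrow> 2 \<le> L x \<Longrightarrow> L x \<le> L (nx x) + 1"
begin

text \<open>The iteration is total although \<open>nx\<close> may leave \<open>V\<close>, as behind
  the sink of the linear quiver; membership of \<open>sh x k\<close> in \<open>V\<close> therefore
  needs a bound on \<open>k\<close>.\<close>

definition sh :: "'v \<Rightarrow> nat \<Rightarrow> 'v" where "sh x k = (nx ^^ k) x"

lemma sh_0 [simp]: "sh x 0 = x" by (simp add: sh_def)

lemma sh_Suc: "sh x (Suc k) = nx (sh x k)" by (simp add: sh_def)

lemma sh_add: "sh (sh x k) l = sh x (k + l)"
  by (simp add: sh_def funpow_add add.commute[of k])

lemma sh_1: "sh x (Suc 0) = nx x" by (simp add: sh_def)

lemma sh_nx: "sh (nx x) k = sh x (Suc k)"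
  by (simp add: sh_def funpow_swap1)

text \<open>The estimate expresses that the submodule of P(x) at depth k is a quotient of
  P(\<open>sh x k\<close>). Both claims go through one induction, since the estimate at k supplies
  the premise \<open>2 \<le> L (sh x k)\<close> under which \<open>nx\<close> stays in
  \<open>V\<close>.\<close>

lemma sh_in_L_le:
  assumes "x \<in> V" "k < L x"
  shows "sh x k \<in> V \<and> L x \<le> L (sh x k) + k"
  using assms(2)
proof (induction k)
  case (Suc k)
  then have "sh x k \<in> V" "L x \<le> L (sh x k) + k" "2 \<le> L (sh x k)" by auto
  then show ?case using nx_in L_nx[of "sh x k"] by (simp add: sh_Suc)
qed (use assms in simp)

lemma sh_in: "x \<in> V \<Longrightarrow> k < L x \<Longrightarrow> sh x k \<in> V"
  and L_le_sh: "x \<in> V \<Longrightarrow> k < L x \<Longrightarrow> L x \<le> L (sh x k) + k"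
  using sh_in_L_le by auto

text \<open>The composition length of the Weyl module \<open>\<Delta>(x)\<close>\<close>

definition D :: "'v rel \<Rightarrow> 'v \<Rightarrow> nat" where
  "D r x = (LEAST d. d = L x \<or> (sh x d, x) \<notin> r)"

lemma D_le: "D r x \<le> L x"
  unfolding D_def by (rule Least_le) simp

lemma D_less: "k < D r x \<Longrightarrow> (sh x k, x) \<in> r"
  unfolding D_def using not_less_Least by blast

lemma D_stop: "D r x < L x \<Longrightarrow> (sh x (D r x), x) \<notin> r"
  using LeastI[of "\<lambda>d. d = L x \<or> (sh x d, x) \<notin> r" "L x"] unfolding D_def by auto

lemma D_pos: "linear_order_on V r \<Longrightarrow> x \<in> V \<Longrightarrow> 0 < D r x"
  using D_stop[of r x] L_pos[of x] linear_order_refl[of V r x] by (cases "D r x = 0") auto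

text \<open>The positions at which a filtration of \<open>P(x)\<close> by Weyl modules, built from the top, can be cut\<close>

inductive reach :: "'v rel \<Rightarrow> 'v \<Rightarrow> nat \<Rightarrow> bool" for r x where
  reach_0: "reach r x 0"
| reach_step: "reach r x p \<Longrightarrow> p < L x \<Longrightarrow> reach r x (p + D r (sh x p))"

text \<open>The condition on \<open>sh x k\<close> says that x occurs in its Weyl module only at the
  top, which for a uniserial module amounts to the endomorphism ring being K.\<close>

definition q_ord :: "'v rel \<Rightarrow> bool" where
  "q_ord r \<longleftrightarrow> linear_order_on V r \<and>
    (\<forall>x\<in>V. (\<forall>k. 0 < k \<and> k < D r x \<longrightarrow> sh x k \<noteq> x) \<and> reach r x (L x))"

text \<open>In this case the path of \<open>L x\<close> arrows starting at \<open>x\<close> is a minimal relation of the algebra.\<close>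

definition relation_at :: "'v \<Rightarrow> bool" where
  "relation_at x \<longleftrightarrow> x \<in> V \<and> 2 \<le> L x \<and> nx x \<in> V \<and> L x \<le> L (nx x)"

lemma not_relation_at:
  "x \<in> V \<Longrightarrow> 2 \<le> L x \<Longrightarrow> \<not> relation_at x \<Longrightarrow> L x = L (nx x) + 1"
  using nx_in[of x] L_nx[of x] by (auto simp: relation_at_def)

text \<open>Applying \<open>sh_in_L_le\<close> to \<open>nx x\<close>, whose module is at least as
  long, gains one position: the vertex just behind the end of P(x) still exists, and strictness says
  that P(\<open>sh x k\<close>) reaches beyond the end of P(x).\<close>

lemma relation_at_sh:
  assumes "relation_at x" "0 < k" "k \<le> L x"
  shows "sh x k \<in> V" "L x < L (sh x k) + k"
proof -
  obtain j where j: "k = Suc j" using assms(2) by (cases k) auto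
  have "nx x \<in> V" "j < L (nx x)" "L x \<le> L (nx x)" using assms j by (auto simp: relation_at_def)
  from sh_in[OF this(1,2)] L_le_sh[OF this(1,2)] this(3)
  show "sh x k \<in> V" "L x < L (sh x k) + k" by (simp_all add: j sh_nx)
qed

text \<open>Cuts occur only at records of the sequence of composition factors.\<close>

lemma reach_record:
  assumes lin: "linear_order_on V r" and x: "x \<in> V" and "reach r x p" "p < L x" "k \<le> p"
  shows "(sh x k, sh x p) \<in> r"
  using assms(3-5)
proof (induction arbitrary: k rule: reach.induct)
  case reach_0
  then show ?case using linear_order_refl[OF lin x] by simp
next
  case (reach_step p)
  let ?y = "sh x p" and ?d = "D r (sh x p)"
  have y: "?y \<in> V" "L x \<le> L ?y + p" using sh_in L_le_sh x reach_step.hyps(2) by auto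
  have p': "sh x (p + ?d) \<in> V" using sh_in x reach_step.prems by blast
  \<comment> \<open>The cut \<open>p + ?d\<close> lies inside P(x), hence inside
    P(\<open>?y\<close>), so the Weyl module at \<open>?y\<close> was stopped by a larger vertex and
    not by the end of P(\<open>?y\<close>).\<close>
  have "(sh ?y ?d, ?y) \<notin> r" using D_stop[of r ?y] y reach_step.prems(1) by simp
  then have less: "(?y, sh x (p + ?d)) \<in> r"
    using linear_order_total[OF lin y(1) p'] by (simp add: sh_add)
  consider "k \<le> p" | "p < k" "k < p + ?d" | "k = p + ?d" using reach_step.prems by linarith
  then show ?case
  proof cases
    case 1
    then have "(sh x k, ?y) \<in> r" using reach_step.IH reach_step.hyps(2) by simp
    then show ?thesis using less linear_order_trans[OF lin] by blast
  next
    case 2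
    then have "(sh ?y (k - p), ?y) \<in> r" by (intro D_less) simp
    then have "(sh x k, ?y) \<in> r" using 2 by (simp add: sh_add)
    then show ?thesis using less linear_order_trans[OF lin] by blast
  next
    case 3
    then show ?thesis using linear_order_refl[OF lin p'] by simp
  qed
qed

text \<open>The alternative is whether the Weyl factor at the bottom of P(x) is all of P(x) or
  starts at a later cut p. Only in the second case does the vertex behind the end of P(x)
  matter.\<close>

lemma q_ord_relation_cases:
  assumes q: "q_ord r" and rel: "relation_at x"
  shows "D r x = L x \<or> (\<forall>k<L x. (sh x (L x), sh x k) \<notin> r)"
proof -
  have lin: "linear_order_on V r" and x: "x \<in> V" and re: "reach r x (L x)" and L: "2 \<le> L x"
    using q rel by (auto simp: q_ord_def relation_at_def)
  from re L obtain p where p: "reach r x p" "p < L x" "L x = p + D r (sh x p)"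
    by (cases rule: reach.cases) auto
  let ?y = "sh x p" and ?z = "sh x (L x)"
  show ?thesis
  proof (cases "p = 0")
    case False
    then have y: "?y \<in> V" "L x < L ?y + p" using relation_at_sh[OF rel] p(2) by auto
    have z: "?z \<in> V" using relation_at_sh[OF rel] L by auto
    \<comment> \<open>By the strict inequality \<open>L x < L ?y + p\<close>, the Weyl module at
      \<open>?y\<close> ends before P(\<open>?y\<close>) does.\<close>
    have "(?z, ?y) \<notin> r" using D_stop[of r ?y] y p(3) by (simp add: sh_add)
    moreover have "(sh x k, ?y) \<in> r" if "k < L x" for k
    proof (cases "k \<le> p")
      case True
      then show ?thesis using reach_record[OF lin x p(1,2)] by blast
    next
      case False
      then have "(sh ?y (k - p), ?y) \<in> r" using p that by (intro D_less) simp
      then show ?thesis using False by (simp add: sh_add)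
    qed
    ultimately show ?thesis using linear_order_trans[OF lin] by blast
  qed (use p in auto)
qed

text \<open>Position 1 lies strictly between 0 and \<open>L x\<close>, so a maximum at
  \<open>nx x\<close> contradicts both alternatives of \<open>q_ord_relation_cases\<close>, even if
  vertices repeat. One such order is enough to separate two relations and to deal with two
  vertices.\<close>

lemma not_q_ord_top_nx:
  assumes rel: "relation_at x" and ne: "nx x \<noteq> x"
    and lin: "linear_order_on V r" and top: "\<And>y. y \<in> V \<Longrightarrow> (y, nx x) \<in> r"
  shows "\<not> q_ord r"
proof
  assume "q_ord r"
  then consider "D r x = L x" | "(sh x (L x), sh x 1) \<notin> r"
    using q_ord_relation_cases[OF _ rel] rel unfolding relation_at_def
    by (metis Suc_1 Suc_le_lessD)
  then show False
  proof cases
    case 1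
    then have "(nx x, x) \<in> r" using D_less[of 1 r x] rel by (auto simp: relation_at_def sh_1)
    then show ?thesis using top[of x] ne linear_order_antisym[OF lin] rel
      by (auto simp: relation_at_def)
  next
    case 2
    then show ?thesis using top relation_at_sh[OF rel, of "L x"] rel
      by (auto simp: sh_1 relation_at_def)
  qed
qed

lemma finite_q_ord: "finite {r. q_ord r}"
  by (rule finite_subset[OF _ finite_linear_orders[OF finite_V]]) (auto simp: q_ord_def)

text \<open>Where no relation starts, the radical of the projective is again projective, so the
  submodule of P(x) at depth p is P(\<open>sh x p\<close>) itself.\<close>

lemma L_sh_eq:
  assumes nr: "\<And>j. j < p \<Longrightarrow> \<not> relation_at (sh x j)" and "x \<in> V" "p < L x"
  shows "L (sh x p) + p = L x"
  using assms(1,3)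
proof (induction p)
  case (Suc p)
  then have IH: "L (sh x p) + p = L x" by simp
  have "L (sh x p) = L (nx (sh x p)) + 1"
    using sh_in[OF assms(2)] Suc.prems IH by (intro not_relation_at) auto
  then show ?case using IH by (simp add: sh_Suc)
qed simp

text \<open>Cuts strictly increase because Weyl modules are not zero, so \<open>L x\<close> can be
  missed only by jumping over it. That requires P(\<open>sh x p\<close>) to be longer than what is
  left of P(x).\<close>

lemma reach_full:
  assumes lin: "linear_order_on V r" and x: "x \<in> V"
    and fit: "\<And>p. reach r x p \<Longrightarrow> p < L x \<Longrightarrow> p + D r (sh x p) \<le> L x"
  shows "reach r x (L x)"
proof -
  have "reach r x (L x)" if "reach r x p" "p \<le> L x" for p
    using that
  proof (induction "L x - p" arbitrary: p rule: less_induct)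
    case less
    show ?case
    proof (cases "p = L x")
      case False
      then have p: "p < L x" using less.prems by simp
      then have "0 < D r (sh x p)" using D_pos[OF lin] sh_in[OF x] by blast
      then show ?thesis
        using less.hyps[OF _ reach_step[OF less.prems(1) p] fit[OF less.prems(1) p]] p by simp
    qed (use less in simp)
  qed
  then show ?thesis using reach_0 by blast
qed

text \<open>P(\<open>sh x p\<close>) is exactly what is left of P(x), so its Weyl quotient fits in.
  A repetition of x would give P(x) two different lengths.\<close>

lemma q_ord_if_no_relation:
  assumes "\<And>x. \<not> relation_at x" "linear_order_on V r"
  shows "q_ord r"
  unfolding q_ord_def
proof (intro conjI ballI allI impI)
  fix x k assume x: "x \<in> V" and k: "0 < k \<and> k < D r x"
  then have "L (sh x k) + k = L x" using L_sh_eq[of k x] assms(1) D_le[of r x] by simp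
  then show "sh x k \<noteq> x" using k by auto
next
  fix x assume x: "x \<in> V"
  show "reach r x (L x)"
  proof (rule reach_full[OF assms(2) x])
    fix p assume "p < L x"
    then show "p + D r (sh x p) \<le> L x" using L_sh_eq[of p x] assms(1) D_le[of r "sh x p"] x by simp
  qed
qed (use assms in simp)

end

section \<open>Counting q-orderings on the line and on the cycle\<close>

locale kupisch_cycle = kupisch +
  assumes inj_nx: "inj_on nx V"
    and nx_neq: "x \<in> V \<Longrightarrow> nx x \<noteq> x"
    and nx_nx_neq: "3 \<le> card V \<Longrightarrow> x \<in> V \<Longrightarrow> nx (nx x) \<noteq> x"
begin

lemma relation_at_nx_nx:
  assumes "relation_at x"
  shows "nx (nx x) \<in> V"
  using relation_at_sh[OF assms, of 2] assms by (auto simp: relation_at_def sh_def numeral_2_eq_2)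

text \<open>The last clause serves the equality case: there \<open>L x = 2\<close>, and the vertex
  behind the end of P(x) is \<open>nx (nx x)\<close>.\<close>

lemma q_ord_subset_orders_not_max:
  assumes rel: "relation_at x" and V3: "3 \<le> card V"
  obtains c where "c \<in> V" "c \<noteq> x" "c \<noteq> nx x" "{r. q_ord r} \<subseteq> orders_not_max V x (nx x) c"
    "L x = 2 \<Longrightarrow> c = nx (nx x)"
proof -
  have x: "x \<in> V" "nx x \<in> V" "2 \<le> L x" using rel by (auto simp: relation_at_def)
  let ?z = "sh x (L x)"
  have z: "?z \<in> V" using relation_at_sh[OF rel, of "L x"] x by simp
  have 2: "nx (nx x) \<in> V" by (rule relation_at_nx_nx[OF rel])
  note ne = nx_neq[OF x(1)] nx_neq[OF x(2)] nx_nx_neq[OF V3 x(1)]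
  have cases: "(nx x, x) \<in> r \<or> (\<forall>k<L x. (?z, sh x k) \<notin> r)" if "q_ord r" for r
    using q_ord_relation_cases[OF that rel] D_less[of 1 r x] x(3) by (auto simp: sh_1)
  have anti: "\<not> (x, nx x) \<in> r" if "(nx x, x) \<in> r" "q_ord r" for r
    using that ne linear_order_antisym[of V r x "nx x"] by (auto simp: q_ord_def)
  show ?thesis
  proof (cases "?z = x \<or> ?z = nx x")
    case True
    have "L x \<noteq> 2" using True ne by (auto simp: sh_def numeral_2_eq_2)
    have "(nx x, x) \<in> r" if r: "q_ord r" for r
    proof -
      \<comment> \<open>\<open>?z\<close> itself occurs at position 0 or 1, so by reflexivity it
        cannot exceed all factors of P(x), and the first alternative remains.\<close>
      have "(?z, ?z) \<in> r" using linear_order_refl[of V r] z r by (simp add: q_ord_def)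
      then have "(?z, sh x 0) \<in> r \<or> (?z, sh x 1) \<in> r" using True by (auto simp: sh_1)
      then show ?thesis using cases[OF r] x by force
    qed
    then have "{r. q_ord r} \<subseteq> orders_not_max V x (nx x) (nx (nx x))"
      using anti by (auto simp: orders_not_max_def q_ord_def)
    then show ?thesis using that[of "nx (nx x)"] 2 ne \<open>L x \<noteq> 2\<close> by auto
  next
    case False
    have "{r. q_ord r} \<subseteq> orders_not_max V x (nx x) ?z"
    proof
      fix r assume "r \<in> {r. q_ord r}"
      then have r: "q_ord r" by simp
      have "(nx x, x) \<in> r \<or> (?z, sh x 1) \<notin> r" using cases[OF r] x(3) by force
      then show "r \<in> orders_not_max V x (nx x) ?z"
        using anti[OF _ r] r by (auto simp: orders_not_max_def q_ord_def sh_1)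
    qed
    then show ?thesis using that[of ?z] False z by (auto simp: sh_def numeral_2_eq_2)
  qed
qed

text \<open>In the case of equality the inclusion into \<open>orders_not_max\<close> is an equality,
  so every order of that set has to be a q-ordering. For \<open>L x\<close> at least 3 this fails,
  since the set contains an order whose maximum \<open>nx (nx x)\<close> sits at the inner position
  2.\<close>

lemma card_q_ord_le:
  assumes rel: "relation_at x" and V3: "3 \<le> card V"
  shows "3 * card {r. q_ord r} \<le> 2 * fact (card V)"
    and "3 * card {r. q_ord r} = 2 * fact (card V) \<Longrightarrow>
      L x = 2 \<and> {r. q_ord r} = orders_not_max V x (nx x) (nx (nx x))"
proof -
  have x: "x \<in> V" "nx x \<in> V" "2 \<le> L x" using rel by (auto simp: relation_at_def)
  note ne = nx_neq[OF x(1)] nx_neq[OF x(2)] nx_nx_neq[OF V3 x(1)]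
  have xx: "nx (nx x) \<in> V" by (rule relation_at_nx_nx[OF rel])
  obtain c where c: "c \<in> V" "c \<noteq> x" "c \<noteq> nx x" "{r. q_ord r} \<subseteq> orders_not_max V x (nx x) c"
    "L x = 2 \<Longrightarrow> c = nx (nx x)"
    using q_ord_subset_orders_not_max[OF rel V3] by blast
  have cT: "3 * card (orders_not_max V x (nx x) c) = 2 * fact (card V)"
    using c ne x by (intro card_orders_not_max[OF finite_V]) auto
  have finT: "finite (orders_not_max V x (nx x) c)"
    by (rule finite_subset[OF _ finite_linear_orders[OF finite_V]]) (auto simp: orders_not_max_def)
  then have le: "card {r. q_ord r} \<le> card (orders_not_max V x (nx x) c)" using c(4) by (rule card_mono)
  then show "3 * card {r. q_ord r} \<le> 2 * fact (card V)" using cT by linarith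
  assume eq: "3 * card {r. q_ord r} = 2 * fact (card V)"
  then have "card {r. q_ord r} = card (orders_not_max V x (nx x) c)" using cT by linarith
  then have same: "{r. q_ord r} = orders_not_max V x (nx x) c" using c(4) finT by (simp add: card_subset_eq)
  have "L x = 2"
  proof (rule ccontr)
    assume "L x \<noteq> 2"
    then have L3: "3 \<le> L x" using x by simp
    \<comment> \<open>With x as second largest, \<open>nx x\<close> lies below x, which puts
      \<open>r\<close> into the set whatever \<open>c\<close> is.\<close>
    obtain r where r: "linear_order_on V r" "\<And>y. y \<in> V \<Longrightarrow> (y, nx (nx x)) \<in> r"
      "\<And>y. y \<in> V \<Longrightarrow> y \<noteq> nx (nx x) \<Longrightarrow> (y, x) \<in> r"
      using linear_order_two_tops[OF finite_V x(1) xx] ne by metis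
    have "(nx x, x) \<in> r" using r(3)[of "nx x"] x ne by auto
    then have "r \<in> orders_not_max V x (nx x) c"
      using r(1) linear_order_antisym[OF r(1), of x "nx x"] ne by (auto simp: orders_not_max_def)
    then have q: "q_ord r" using same by auto
    show False using q_ord_relation_cases[OF q rel]
    proof
      assume "D r x = L x"
      then have "(nx (nx x), x) \<in> r"
        using D_less[of 2 r x] L3 by (simp add: sh_def numeral_2_eq_2)
      then show False using r(2)[OF x(1)] ne linear_order_antisym[OF r(1)] by blast
    next
      assume "\<forall>k<L x. (sh x (L x), sh x k) \<notin> r"
      then have "(sh x (L x), nx (nx x)) \<notin> r"
        using L3 by (auto simp: sh_def numeral_2_eq_2 dest: spec[of _ 2])
      then show False using r(2) relation_at_sh[OF rel, of "L x"] x by auto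
    qed
  qed
  then show "L x = 2 \<and> {r. q_ord r} = orders_not_max V x (nx x) (nx (nx x))"
    using same c(5) by auto
qed

text \<open>An order with \<open>nx y\<close> on top is never a q-ordering. If moreover
  \<open>nx x\<close> lies below x, it would have to be one by the equality case for x. Injectivity
  of \<open>nx\<close> makes the two requirements compatible.\<close>

lemma card_q_ord_eq_unique:
  assumes eq: "3 * card {r. q_ord r} = 2 * fact (card V)" and V3: "3 \<le> card V"
    and rel: "relation_at x" "relation_at y"
  shows "x = y"
proof (rule ccontr)
  assume "x \<noteq> y"
  have x: "x \<in> V" "nx x \<in> V" and y: "y \<in> V" "nx y \<in> V" using rel by (auto simp: relation_at_def)
  have "nx x \<noteq> nx y" using inj_nx \<open>x \<noteq> y\<close> x y by (auto dest: inj_onD)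
  \<comment> \<open>\<open>a\<close> becomes the second largest vertex. It is x, unless x is
    \<open>nx y\<close> and hence already the largest.\<close>
  obtain a where a: "a \<in> V" "a \<noteq> nx y" "x \<noteq> nx y \<Longrightarrow> a = x"
    using x y \<open>nx x \<noteq> nx y\<close> by metis
  obtain r where r: "linear_order_on V r" "\<And>z. z \<in> V \<Longrightarrow> (z, nx y) \<in> r"
    "\<And>z. z \<in> V \<Longrightarrow> z \<noteq> nx y \<Longrightarrow> (z, a) \<in> r"
    using linear_order_two_tops[OF finite_V a(1) y(2)] a(2) by metis
  have "(nx x, x) \<in> r"
    using r(2,3)[of "nx x"] x a(3) \<open>nx x \<noteq> nx y\<close> by (cases "x = nx y") auto
  then have "(x, nx x) \<notin> r" using linear_order_antisym[OF r(1)] nx_neq[OF x(1)] by metis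
  then have "q_ord r"
    using card_q_ord_le(2)[OF rel(1) V3 eq] r(1) by (auto simp: orders_not_max_def)
  then show False using not_q_ord_top_nx[OF rel(2) nx_neq[OF y(1)] r(1,2)] by blast
qed

lemma card_q_ord_le_two:
  assumes rel: "relation_at x" and V2: "card V = 2"
  shows "card {r. q_ord r} \<le> 1"
proof -
  have x: "x \<in> V" "nx x \<in> V" using rel by (auto simp: relation_at_def)
  obtain r where r: "linear_order_on V r" "\<And>z. z \<in> V \<Longrightarrow> (z, nx x) \<in> r"
    using linear_order_two_tops[OF finite_V x] nx_neq[OF x(1)] by metis
  have "{r. q_ord r} \<subset> {r. linear_order_on V r}"
    using not_q_ord_top_nx[OF rel nx_neq[OF x(1)] r] r(1) by (auto simp: q_ord_def)
  then have "card {r. q_ord r} < card {r. linear_order_on V r}"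
    by (rule psubset_card_mono[OF finite_linear_orders[OF finite_V]])
  then show ?thesis by (simp add: card_linear_orders[OF finite_V] V2)
qed

text \<open>Before x is met, lengths drop by one per step, and \<open>L x = 2\<close> makes P(y) end
  at the \<open>nx x\<close> after the first x. Hence this last position is the only place where a
  repetition in a Weyl module or an overshooting cut could arise.\<close>

lemma orders_not_max_subset_q_ord:
  assumes rel: "relation_at x" and L2: "L x = 2" and uniq: "\<And>y. relation_at y \<Longrightarrow> y = x"
    and r: "r \<in> orders_not_max V x (nx x) (nx (nx x))"
  shows "q_ord r"
  unfolding q_ord_def
proof (intro conjI ballI allI impI)
  show lin: "linear_order_on V r" using r by (simp add: orders_not_max_def)
  have x: "x \<in> V" "nx x \<in> V" using rel by (auto simp: relation_at_def)
  have xx: "nx (nx x) \<in> V" by (rule relation_at_nx_nx[OF rel])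
  have nr: "\<not> ((x, nx x) \<in> r \<and> (nx (nx x), nx x) \<in> r)" using r by (simp add: orders_not_max_def)
  fix y assume y: "y \<in> V"
  have Leq: "L (sh y p) + p = L y" if "\<And>j. j < p \<Longrightarrow> sh y j \<noteq> x" "p < L y" for p
    using L_sh_eq[of p y] that y uniq by blast
  have least: "\<exists>i. sh y i = x \<and> (\<forall>j<i. sh y j \<noteq> x) \<and> i < k" if ex: "\<exists>i<k. sh y i = x" for k
  proof -
    obtain j where "j < k" "sh y j = x" using ex by blast
    then show ?thesis
      using LeastI[of "\<lambda>i. sh y i = x" j] Least_le[of "\<lambda>i. sh y i = x" j]
      by (intro exI[of _ "LEAST i. sh y i = x"]) (auto dest: not_less_Least)
  qed
  have first: "L y = i + 2" if i: "sh y i = x" "Suc i < L y" "\<And>j. j < i \<Longrightarrow> sh y j \<noteq> x" for i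
    using Leq[of i] i L2 by simp
  {
    fix k assume k: "0 < k \<and> k < D r y"
    show "sh y k \<noteq> y"
    proof
      assume yk: "sh y k = y"
      have kL: "k < L y" using k D_le[of r y] by linarith
      show False
      proof (cases "\<exists>i<k. sh y i = x")
        case False
        then have "L (sh y k) + k = L y" using Leq[of k] kL by blast
        then show False using yk k by simp
      next
        case True
        then obtain i where i: "sh y i = x" "\<And>j. j < i \<Longrightarrow> sh y j \<noteq> x" "i < k" using least by blast
        have "L y = i + 2" using first[of i] i kL by simp
        then have "k = Suc i" using kL i(3) by linarith
        then have ynx: "nx x = y" using yk i(1) by (simp add: sh_Suc)
        \<comment> \<open>A second y in its own Weyl module puts both x and \<open>nx y\<close>
          below y, which is \<open>nx x\<close>; this is what \<open>nr\<close> rules out.\<close>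
        have "(x, y) \<in> r" using D_less[of i r y] i k by simp
        moreover have "(nx y, y) \<in> r" using D_less[of 1 r y] k by (simp add: sh_1)
        ultimately show False using nr ynx by simp
      qed
    qed
  next
    show "reach r y (L y)"
    proof (rule reach_full[OF lin y])
      fix p assume p: "reach r y p" "p < L y"
      show "p + D r (sh y p) \<le> L y"
      proof (cases "\<exists>i<p. sh y i = x")
        case False
        then have "L (sh y p) + p = L y" using Leq[of p] p by blast
        then show ?thesis using D_le[of r "sh y p"] by linarith
      next
        case True
        then obtain i where i: "sh y i = x" "\<And>j. j < i \<Longrightarrow> sh y j \<noteq> x" "i < p" using least by blast
        have Ly: "L y = i + 2" using first[of i] i p by simp
        then have pi: "p = Suc i" using p i(3) by linarith
        then have yp: "sh y p = nx x" using i(1) by (simp add: sh_Suc)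
        \<comment> \<open>A cut in front of \<open>nx x\<close> makes it a record, so x lies below
          it. By \<open>nr\<close> the vertex after it does not, and the Weyl module at
          \<open>nx x\<close> has length at most one.\<close>
        have "(x, nx x) \<in> r" using reach_record[OF lin y p, of i] i yp by simp
        then have "(nx (nx x), nx x) \<notin> r" using nr by blast
        then have "D r (nx x) \<le> 1"
          using D_less[of 1 r "nx x"] by (force simp: sh_1 not_le)
        then show ?thesis using pi Ly yp by simp
      qed
    qed
  }
qed

end

section \<open>Modules over an algebra with a basis of paths\<close>

text \<open>
  \<open>co a y l\<close> is the coefficient in \<open>a\<close> of the path with \<open>l\<close> arrows that starts at \<open>y\<close>;
  such a path is non-zero in the algebra iff \<open>l < L y\<close>.
\<close>

locale path_basis = kupisch V nx L + ring R
  for V :: "'v set" and nx L and R :: "('a, 'r) ring_scheme" (structure) +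
  fixes co :: "'a \<Rightarrow> 'v \<Rightarrow> nat \<Rightarrow> 'k::field"
  assumes co_out: "a \<in> carrier R \<Longrightarrow> \<not> (y \<in> V \<and> l < L y) \<Longrightarrow> co a y l = 0"
    and co_inj: "a \<in> carrier R \<Longrightarrow> b \<in> carrier R \<Longrightarrow> co a = co b \<Longrightarrow> a = b"
    and co_surj: "\<exists>a\<in>carrier R. \<forall>y\<in>V. \<forall>l<L y. co a y l = c y l"
    and co_add: "a \<in> carrier R \<Longrightarrow> b \<in> carrier R \<Longrightarrow> co (a \<oplus> b) y l = co a y l + co b y l"
    and co_mult: "a \<in> carrier R \<Longrightarrow> b \<in> carrier R \<Longrightarrow> y \<in> V \<Longrightarrow> l < L y \<Longrightarrow>
      co (a \<otimes> b) y l = (\<Sum>i\<le>l. co a (sh y i) (l - i) * co b y i)"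
begin

lemma co_zero: "co \<zero> y l = 0"
proof -
  have "co \<zero> y l + co \<zero> y l = co \<zero> y l + 0" using co_add[of \<zero> \<zero> y l] by simp
  then show ?thesis by (simp only: add_left_cancel)
qed

definition el :: "('v \<Rightarrow> nat \<Rightarrow> 'k) \<Rightarrow> 'a" where
  "el c = (SOME a. a \<in> carrier R \<and> (\<forall>y\<in>V. \<forall>l<L y. co a y l = c y l))"

lemma el: "el c \<in> carrier R" "y \<in> V \<Longrightarrow> l < L y \<Longrightarrow> co (el c) y l = c y l"
  using someI_ex[of "\<lambda>a. a \<in> carrier R \<and> (\<forall>y\<in>V. \<forall>l<L y. co a y l = c y l)"] co_surj[of c]
  unfolding el_def by auto

definition single :: "'k \<Rightarrow> 'v \<Rightarrow> nat \<Rightarrow> 'a" where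
  "single c y l = el (\<lambda>z j. if z = y \<and> j = l then c else 0)"

lemma single_in [simp]: "single c y l \<in> carrier R"
  by (simp add: single_def el)

lemma co_single: "y \<in> V \<Longrightarrow> l < L y \<Longrightarrow> co (single c y l) z j = (if z = y \<and> j = l then c else 0)"
  unfolding single_def using el co_out by (cases "z \<in> V \<and> j < L z") auto

text \<open>A module with coordinates \<open>\<phi>\<close> identifying it with the uniserial module \<open>P(x)\<close> modulo its part
  of depth at least \<open>m\<close>\<close>

definition coord :: "('a, 'b) module \<Rightarrow> 'v \<Rightarrow> nat \<Rightarrow> ('b \<Rightarrow> nat \<Rightarrow> 'k) \<Rightarrow> bool" where
  "coord M x m \<phi> \<longleftrightarrow> (m = 0 \<or> x \<in> V \<and> m \<le> L x) \<and>
    bij_betw \<phi> (carrier M) {f. \<forall>k\<ge>m. f k = 0} \<and>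
    \<zero>\<^bsub>M\<^esub> \<in> carrier M \<and> \<phi> \<zero>\<^bsub>M\<^esub> = (\<lambda>_. 0) \<and>
    (\<forall>u\<in>carrier M. \<forall>v\<in>carrier M. u \<oplus>\<^bsub>M\<^esub> v \<in> carrier M \<and> \<phi> (u \<oplus>\<^bsub>M\<^esub> v) = (\<lambda>k. \<phi> u k + \<phi> v k)) \<and>
    (\<forall>a\<in>carrier R. \<forall>u\<in>carrier M. a \<odot>\<^bsub>M\<^esub> u \<in> carrier M \<and>
      (\<forall>k<m. \<phi> (a \<odot>\<^bsub>M\<^esub> u) k = (\<Sum>i\<le>k. co a (sh x i) (k - i) * \<phi> u i)))"

text \<open>The a-th power of the radical in coordinates; from \<open>m\<close> on it is
  zero.\<close>

definition lay :: "('a, 'b) module \<Rightarrow> ('b \<Rightarrow> nat \<Rightarrow> 'k) \<Rightarrow> nat \<Rightarrow> 'b set" where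
  "lay M \<phi> a = {u \<in> carrier M. \<forall>k<a. \<phi> u k = 0}"

section \<open>Submodules and quotients of uniserial modules\<close>

context
  fixes M :: "('a, 'b) module" and x m \<phi>
  assumes M: "coord M x m \<phi>"
begin

lemma coord_le: "0 < m \<Longrightarrow> x \<in> V \<and> m \<le> L x"
  and coord_out: "u \<in> carrier M \<Longrightarrow> m \<le> k \<Longrightarrow> \<phi> u k = 0"
  and coord_zero_in: "\<zero>\<^bsub>M\<^esub> \<in> carrier M"
  and coord_zero: "\<phi> \<zero>\<^bsub>M\<^esub> k = 0"
  and coord_add_in: "u \<in> carrier M \<Longrightarrow> v \<in> carrier M \<Longrightarrow> u \<oplus>\<^bsub>M\<^esub> v \<in> carrier M"
  and coord_add: "u \<in> carrier M \<Longrightarrow> v \<in> carrier M \<Longrightarrow> \<phi> (u \<oplus>\<^bsub>M\<^esub> v) k = \<phi> u k + \<phi> v k"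
  and coord_smult_in: "a \<in> carrier R \<Longrightarrow> u \<in> carrier M \<Longrightarrow> a \<odot>\<^bsub>M\<^esub> u \<in> carrier M"
  and coord_smult: "a \<in> carrier R \<Longrightarrow> u \<in> carrier M \<Longrightarrow> k < m \<Longrightarrow>
    \<phi> (a \<odot>\<^bsub>M\<^esub> u) k = (\<Sum>i\<le>k. co a (sh x i) (k - i) * \<phi> u i)"
  using M unfolding coord_def bij_betw_def by auto

lemma coord_inj:
  assumes "u \<in> carrier M" "v \<in> carrier M" "\<And>k. k < m \<Longrightarrow> \<phi> u k = \<phi> v k"
  shows "u = v"
proof -
  have "\<phi> u = \<phi> v"
  proof
    fix k show "\<phi> u k = \<phi> v k"
      using assms coord_out[of u k] coord_out[of v k] by (cases "k < m") auto
  qed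
  moreover have "inj_on \<phi> (carrier M)" using M by (simp add: coord_def bij_betw_def)
  ultimately show ?thesis using assms by (auto dest: inj_onD)
qed

lemma coord_surj: "\<exists>u\<in>carrier M. \<forall>k<m. \<phi> u k = c k"
proof -
  have "(\<lambda>k. if k < m then c k else 0) \<in> \<phi> ` carrier M"
    using M unfolding coord_def bij_betw_def by auto
  then obtain u where u: "(\<lambda>k. if k < m then c k else 0) = \<phi> u" "u \<in> carrier M" by blast
  have "\<phi> u k = c k" if "k < m" for k using fun_cong[OF u(1), of k] that by simp
  then show ?thesis using u by blast
qed

lemma coord_sh:
  assumes "i \<le> k" "k < m"
  shows "sh x i \<in> V \<and> k - i < L (sh x i)"
proof -
  have "x \<in> V \<and> m \<le> L x" using assms by (intro coord_le) simp
  then show ?thesis using assms sh_in_L_le[of x i] by auto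
qed

lemma coord_single:
  assumes "y \<in> V" "l < L y" "u \<in> carrier M" "k < m"
  shows "\<phi> (single c y l \<odot>\<^bsub>M\<^esub> u) k = (if l \<le> k \<and> sh x (k - l) = y then c * \<phi> u (k - l) else 0)"
proof -
  have "\<phi> (single c y l \<odot>\<^bsub>M\<^esub> u) k =
      (\<Sum>i\<le>k. if i = k - l \<and> l \<le> k \<and> sh x (k - l) = y then c * \<phi> u i else 0)"
    unfolding coord_smult[OF single_in assms(3,4)]
    by (rule sum.cong) (use assms in \<open>auto simp: co_single\<close>)
  also have "\<dots> = (if l \<le> k \<and> sh x (k - l) = y then c * \<phi> u (k - l) else 0)"
    by (cases "l \<le> k \<and> sh x (k - l) = y") (auto simp: sum.delta)
  finally show ?thesis .
qed

lemma coord_abelian_group: "abelian_group M"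
proof (rule abelian_groupI)
  fix u assume u: "u \<in> carrier M"
  obtain v where v: "v \<in> carrier M" "\<forall>k<m. \<phi> v k = - \<phi> u k"
    using coord_surj[of "\<lambda>k. - \<phi> u k"] by blast
  have "v \<oplus>\<^bsub>M\<^esub> u = \<zero>\<^bsub>M\<^esub>"
    by (rule coord_inj) (use u v in \<open>simp_all add: coord_add_in coord_zero_in coord_add coord_zero\<close>)
  then show "\<exists>v\<in>carrier M. v \<oplus>\<^bsub>M\<^esub> u = \<zero>\<^bsub>M\<^esub>" using v by blast
next
  fix u v w assume "u \<in> carrier M" "v \<in> carrier M" "w \<in> carrier M"
  then show "u \<oplus>\<^bsub>M\<^esub> v \<oplus>\<^bsub>M\<^esub> w = u \<oplus>\<^bsub>M\<^esub> (v \<oplus>\<^bsub>M\<^esub> w)"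
    by (intro coord_inj) (simp_all add: coord_add_in coord_add)
next
  fix u v assume "u \<in> carrier M" "v \<in> carrier M"
  then show "u \<oplus>\<^bsub>M\<^esub> v = v \<oplus>\<^bsub>M\<^esub> u"
    by (intro coord_inj) (simp_all add: coord_add_in coord_add)
next
  fix u assume "u \<in> carrier M"
  then show "\<zero>\<^bsub>M\<^esub> \<oplus>\<^bsub>M\<^esub> u = u"
    by (intro coord_inj) (simp_all add: coord_add_in coord_add coord_zero coord_zero_in)
qed (simp_all add: coord_add_in coord_zero_in)

lemma coord_minus:
  assumes "u \<in> carrier M"
  shows "\<ominus>\<^bsub>M\<^esub> u \<in> carrier M" "\<phi> (\<ominus>\<^bsub>M\<^esub> u) k = - \<phi> u k"
proof -
  interpret A: abelian_group M by (rule coord_abelian_group)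
  show minus_in: "\<ominus>\<^bsub>M\<^esub> u \<in> carrier M" using assms by simp
  have "\<phi> (u \<oplus>\<^bsub>M\<^esub> \<ominus>\<^bsub>M\<^esub> u) k = 0" using assms by (simp add: A.r_neg coord_zero)
  then show "\<phi> (\<ominus>\<^bsub>M\<^esub> u) k = - \<phi> u k"
    using coord_add[OF assms minus_in] by (simp add: eq_neg_iff_add_eq_0 add.commute)
qed

lemma submoduleI':
  assumes "H \<subseteq> carrier M" "\<zero>\<^bsub>M\<^esub> \<in> H" "\<And>u. u \<in> H \<Longrightarrow> \<ominus>\<^bsub>M\<^esub> u \<in> H"
    "\<And>u v. u \<in> H \<Longrightarrow> v \<in> H \<Longrightarrow> u \<oplus>\<^bsub>M\<^esub> v \<in> H" "\<And>a u. a \<in> carrier R \<Longrightarrow> u \<in> H \<Longrightarrow> a \<odot>\<^bsub>M\<^esub> u \<in> H"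
  shows "submodule H R M"
  using assms by (intro submodule.intro subgroup.intro submodule_axioms.intro) (auto simp: a_inv_def)

lemma lay_0: "lay M \<phi> 0 = carrier M"
  by (simp add: lay_def)

lemma lay_max: "lay M \<phi> m = {\<zero>\<^bsub>M\<^esub>}"
  using coord_inj[of _ "\<zero>\<^bsub>M\<^esub>"] by (auto simp: lay_def coord_zero coord_zero_in)

lemma lay_subset_iff:
  assumes "a \<le> m"
  shows "lay M \<phi> b \<subseteq> lay M \<phi> a \<longleftrightarrow> a \<le> b"
proof
  assume sub: "lay M \<phi> b \<subseteq> lay M \<phi> a"
  obtain u where u: "u \<in> carrier M" "\<forall>k<m. \<phi> u k = (if k = b then 1 else 0)"
    using coord_surj[of "\<lambda>k. if k = b then 1 else 0"] by blast
  have "\<forall>k<b. \<phi> u k = 0"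
    using u coord_out[OF u(1)] by (metis less_irrefl not_le)
  then have "u \<in> lay M \<phi> a" using sub u by (auto simp: lay_def)
  then have "\<phi> u b = 0" if "b < a" using that by (simp add: lay_def)
  then show "a \<le> b" using u assms by (metis leI less_le_trans zero_neq_one)
qed (auto simp: lay_def)

lemma lay_eq_iff: "a \<le> m \<Longrightarrow> b \<le> m \<Longrightarrow> lay M \<phi> a = lay M \<phi> b \<longleftrightarrow> a = b"
  using lay_subset_iff[of a b] lay_subset_iff[of b a] by auto

lemma lay_submodule: "submodule (lay M \<phi> a) R M"
proof (rule submoduleI')
  fix r u assume r: "r \<in> carrier R" and u: "u \<in> lay M \<phi> a"
  have "\<phi> (r \<odot>\<^bsub>M\<^esub> u) k = 0" if "k < a" for k
  proof (cases "k < m")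
    case True
    then show ?thesis using r u that by (auto simp: coord_smult lay_def intro!: sum.neutral)
  qed (use r u in \<open>auto simp: lay_def coord_smult_in coord_out\<close>)
  then show "r \<odot>\<^bsub>M\<^esub> u \<in> lay M \<phi> a" using r u by (auto simp: lay_def coord_smult_in)
qed (auto simp: lay_def coord_zero coord_zero_in coord_add coord_add_in coord_minus)

text \<open>Uniseriality: an element of \<open>H\<close> with first nonzero coordinate at
  \<open>a\<close> can be moved by a path to any greater depth, so layers are absorbed into
  \<open>H\<close> one after the other from the bottom upwards.\<close>

lemma submodule_is_lay:
  assumes H: "submodule H R M"
  obtains a where "a \<le> m" "H = lay M \<phi> a"
proof -
  interpret H: submodule H R M by (rule H)
  have sub: "u \<in> carrier M" if "u \<in> H" for u using H.subset that by auto
  have add: "u \<oplus>\<^bsub>M\<^esub> v \<in> H" if "u \<in> H" "v \<in> H" for u v using H.m_closed that by simp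
  define a where "a = (LEAST a. a = m \<or> (\<exists>u\<in>H. \<phi> u a \<noteq> 0))"
  have am: "a \<le> m" unfolding a_def by (rule Least_le) simp
  have "H \<subseteq> lay M \<phi> a"
    unfolding lay_def a_def using sub not_less_Least by blast
  moreover have "lay M \<phi> k \<subseteq> H" if "a \<le> k" "k \<le> m" for k
    using that(2,1)
  proof (induction k rule: inc_induct)
    case base
    have "\<zero>\<^bsub>M\<^esub> \<in> H" using H.one_closed by simp
    then show ?case unfolding lay_max by simp
  next
    case (step k)
    have "a = m \<or> (\<exists>u\<in>H. \<phi> u a \<noteq> 0)"
      unfolding a_def by (rule LeastI[of _ m]) simp
    then obtain u where u: "u \<in> H" "\<phi> u a \<noteq> 0" using step by auto
    have u0: "\<phi> u j = 0" if "j < a" for j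
      using not_less_Least[of j "\<lambda>a. a = m \<or> (\<exists>u\<in>H. \<phi> u a \<noteq> 0)"] that u unfolding a_def by blast
    have valid: "sh x a \<in> V" "k - a < L (sh x a)" using coord_sh[of a k] step by auto
    show ?case
    proof
      fix v assume "v \<in> lay M \<phi> k"
      then have v: "v \<in> carrier M" "\<And>j. j < k \<Longrightarrow> \<phi> v j = 0" by (auto simp: lay_def)
      \<comment> \<open>Moves the leading coordinate of \<open>u\<close> from \<open>a\<close> to
        \<open>k\<close> and scales it to that of \<open>v\<close>. If the path acts on further
        coordinates, these come to lie deeper than \<open>k\<close>, so \<open>v\<close> minus
        \<open>w\<close> vanishes up to \<open>k\<close>.\<close>
      define w where "w = single (\<phi> v k / \<phi> u a) (sh x a) (k - a) \<odot>\<^bsub>M\<^esub> u"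
      have w: "w \<in> H" unfolding w_def using u(1) H.smult_closed by simp
      have wc: "\<phi> w j = (if k - a \<le> j \<and> sh x (j - (k - a)) = sh x a
          then \<phi> v k / \<phi> u a * \<phi> u (j - (k - a)) else 0)" if "j < m" for j
        unfolding w_def using coord_single[OF valid sub[OF u(1)] that] by simp
      obtain d where d: "d \<in> carrier M" "\<forall>j<m. \<phi> d j = \<phi> v j - \<phi> w j"
        using coord_surj[of "\<lambda>j. \<phi> v j - \<phi> w j"] by blast
      have "\<phi> d j = 0" if "j < Suc k" for j
      proof (cases "j = k")
        case True
        then show ?thesis using d wc[of k] step u(2) by simp
      next
        case False
        then have "j < k" using that by simp
        then have "j - (k - a) < a \<or> \<not> k - a \<le> j" using step by linarith
        then have "\<phi> w j = 0" using wc[of j] u0 \<open>j < k\<close> step by auto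
        then show ?thesis using d v \<open>j < k\<close> step by simp
      qed
      then have "d \<in> H" using step d by (auto simp: lay_def)
      moreover have "v = w \<oplus>\<^bsub>M\<^esub> d"
        using v d w sub by (intro coord_inj) (auto simp: coord_add coord_add_in)
      ultimately show "v \<in> H" using w add by simp
    qed
  qed
  ultimately show ?thesis using that[OF am] am by blast
qed

lemma coord_restrict:
  assumes "a \<le> m"
  shows "coord (restrict_module M (lay M \<phi> a)) (sh x a) (m - a) (\<lambda>u k. \<phi> u (k + a))"
proof -
  have sel: "carrier (restrict_module M N) = N" "\<zero>\<^bsub>restrict_module M N\<^esub> = \<zero>\<^bsub>M\<^esub>"
    "(\<oplus>\<^bsub>restrict_module M N\<^esub>) = (\<oplus>\<^bsub>M\<^esub>)" "(\<odot>\<^bsub>restrict_module M N\<^esub>) = (\<odot>\<^bsub>M\<^esub>)" for N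
    by (simp_all add: restrict_module_def)
  have "bij_betw (\<lambda>u k. \<phi> u (k + a)) (lay M \<phi> a) {f. \<forall>k\<ge>m - a. f k = 0}"
    unfolding bij_betw_def
  proof
    show "inj_on (\<lambda>u k. \<phi> u (k + a)) (lay M \<phi> a)"
    proof (rule inj_onI)
      fix u v assume uv: "u \<in> lay M \<phi> a" "v \<in> lay M \<phi> a" "(\<lambda>k. \<phi> u (k + a)) = (\<lambda>k. \<phi> v (k + a))"
      have "\<phi> u k = \<phi> v k" for k
      proof (cases "k < a")
        case False
        then show ?thesis using fun_cong[OF uv(3), of "k - a"] by simp
      qed (use uv in \<open>auto simp: lay_def\<close>)
      then show "u = v" using uv by (intro coord_inj) (auto simp: lay_def)
    qed
    show "(\<lambda>u k. \<phi> u (k + a)) ` lay M \<phi> a = {f. \<forall>k\<ge>m - a. f k = 0}"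
    proof (intro equalityI subsetI)
      fix f assume "f \<in> (\<lambda>u k. \<phi> u (k + a)) ` lay M \<phi> a"
      then show "f \<in> {f. \<forall>k\<ge>m - a. f k = 0}" by (auto simp: lay_def coord_out)
    next
      fix f :: "nat \<Rightarrow> 'k" assume f: "f \<in> {f. \<forall>k\<ge>m - a. f k = 0}"
      obtain u where u: "u \<in> carrier M" "\<forall>k<m. \<phi> u k = (if k < a then 0 else f (k - a))"
        using coord_surj[of "\<lambda>k. if k < a then 0 else f (k - a)"] by blast
      have "f = (\<lambda>k. \<phi> u (k + a))"
      proof
        fix k show "f k = \<phi> u (k + a)"
          using u f assms coord_out[OF u(1), of "k + a"] by (cases "k + a < m") auto
      qed
      moreover have "u \<in> lay M \<phi> a" using u assms by (auto simp: lay_def)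
      ultimately show "f \<in> (\<lambda>u k. \<phi> u (k + a)) ` lay M \<phi> a" by blast
    qed
  qed
  moreover have "m - a = 0 \<or> sh x a \<in> V \<and> m - a \<le> L (sh x a)"
  proof (cases "a < m")
    case True
    then have "x \<in> V \<and> m \<le> L x" by (intro coord_le) simp
    then show ?thesis using True sh_in_L_le[of x a] by auto
  qed simp
  moreover have "\<phi> (r \<odot>\<^bsub>M\<^esub> u) (k + a) = (\<Sum>i\<le>k. co r (sh (sh x a) i) (k - i) * \<phi> u (i + a))"
    if "r \<in> carrier R" "u \<in> lay M \<phi> a" "k < m - a" for r u k
  proof -
    have "\<phi> (r \<odot>\<^bsub>M\<^esub> u) (k + a) = (\<Sum>i\<le>k + a. co r (sh x i) (k + a - i) * \<phi> u i)"
      using that by (intro coord_smult) (auto simp: lay_def)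
    also have "\<dots> = (\<Sum>i\<in>{0 + a..k + a}. co r (sh x i) (k + a - i) * \<phi> u i)"
      by (rule sum.mono_neutral_right) (use that in \<open>auto simp: lay_def\<close>)
    also have "\<dots> = (\<Sum>i\<in>{0..k}. co r (sh x (i + a)) (k + a - (i + a)) * \<phi> u (i + a))"
      by (rule sum.shift_bounds_cl_nat_ivl)
    also have "\<dots> = (\<Sum>i\<le>k. co r (sh (sh x a) i) (k - i) * \<phi> u (i + a))"
      by (simp add: sh_add atMost_atLeast0 add.commute)
    finally show ?thesis .
  qed
  moreover have "submodule (lay M \<phi> a) R M" by (rule lay_submodule)
  then have "\<zero>\<^bsub>M\<^esub> \<in> lay M \<phi> a" "\<And>u v. u \<in> lay M \<phi> a \<Longrightarrow> v \<in> lay M \<phi> a \<Longrightarrow> u \<oplus>\<^bsub>M\<^esub> v \<in> lay M \<phi> a"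
    "\<And>r u. r \<in> carrier R \<Longrightarrow> u \<in> lay M \<phi> a \<Longrightarrow> r \<odot>\<^bsub>M\<^esub> u \<in> lay M \<phi> a"
    using submodule.axioms(1)[THEN subgroup.one_closed] submodule.axioms(1)[THEN subgroup.m_closed]
      submodule.smult_closed by fastforce+
  ultimately show ?thesis
    unfolding coord_def sel by (auto simp: coord_zero coord_add lay_def)
qed

lemma lay_coset:
  assumes "u \<in> carrier M"
  shows "lay M \<phi> a +>\<^bsub>M\<^esub> u = {v \<in> carrier M. \<forall>k<a. \<phi> v k = \<phi> u k}"
proof (intro equalityI subsetI)
  fix v assume "v \<in> lay M \<phi> a +>\<^bsub>M\<^esub> u"
  then obtain h where "h \<in> lay M \<phi> a" "v = h \<oplus>\<^bsub>M\<^esub> u" by (auto simp: a_r_coset_def')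
  then show "v \<in> {v \<in> carrier M. \<forall>k<a. \<phi> v k = \<phi> u k}"
    using assms by (auto simp: lay_def coord_add coord_add_in)
next
  fix v assume v: "v \<in> {v \<in> carrier M. \<forall>k<a. \<phi> v k = \<phi> u k}"
  have "v \<oplus>\<^bsub>M\<^esub> \<ominus>\<^bsub>M\<^esub> u \<in> lay M \<phi> a"
    using v assms by (auto simp: lay_def coord_add coord_add_in coord_minus)
  moreover have "v = (v \<oplus>\<^bsub>M\<^esub> \<ominus>\<^bsub>M\<^esub> u) \<oplus>\<^bsub>M\<^esub> u"
    using v assms by (intro coord_inj) (auto simp: coord_add coord_add_in coord_minus)
  ultimately show "v \<in> lay M \<phi> a +>\<^bsub>M\<^esub> u" unfolding a_r_coset_def' by blast
qed

lemma coord_quot: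
  assumes "a \<le> m"
  shows "\<exists>\<psi>. coord (quot_module M (lay M \<phi> a)) x a \<psi>"
proof -
  let ?N = "lay M \<phi> a" and ?q = "quot_module M (lay M \<phi> a)"
  let ?C = "\<lambda>u. {v \<in> carrier M. \<forall>k<a. \<phi> v k = \<phi> u k}"
  \<comment> \<open>The first \<open>a\<close> coordinates are constant on a coset, so any
    representative gives them; the coset itself is the fibre \<open>?C u\<close>.\<close>
  define \<psi> where "\<psi> B k = (if k < a then \<phi> (SOME u. u \<in> B) k else 0)" for B k
  have sel: "carrier ?q = ?C ` carrier M" "\<zero>\<^bsub>?q\<^esub> = ?C \<zero>\<^bsub>M\<^esub>" "(\<oplus>\<^bsub>?q\<^esub>) = (<+>\<^bsub>M\<^esub>)"
    "(\<odot>\<^bsub>?q\<^esub>) = (\<lambda>r B. \<Union>u\<in>B. ?N +>\<^bsub>M\<^esub> (r \<odot>\<^bsub>M\<^esub> u))"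
  proof -
    have "carrier ?q = (\<lambda>u. ?N +>\<^bsub>M\<^esub> u) ` carrier M"
      by (simp add: quot_module_def A_RCOSETS_def' UNION_singleton_eq_range)
    also have "\<dots> = ?C ` carrier M" by (rule image_cong[OF refl lay_coset])
    finally show "carrier ?q = ?C ` carrier M" .
    show "\<zero>\<^bsub>?q\<^esub> = ?C \<zero>\<^bsub>M\<^esub>" by (simp add: quot_module_def lay_def coord_zero)
  qed (simp_all add: quot_module_def)
  have \<psi>: "\<psi> (?C u) = (\<lambda>k. if k < a then \<phi> u k else 0)" if "u \<in> carrier M" for u
  proof
    have "u \<in> ?C u" using that by simp
    then have "k < a \<longrightarrow> \<phi> (SOME v. v \<in> ?C u) k = \<phi> u k" for k
      by (rule someI2[where P = "\<lambda>v. v \<in> ?C u" and Q = "\<lambda>v. k < a \<longrightarrow> \<phi> v k = \<phi> u k"]) simp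
    then show "\<psi> (?C u) k = (if k < a then \<phi> u k else 0)" for k
      unfolding \<psi>_def by (intro if_cong) simp_all
  qed
  have add: "?C u \<oplus>\<^bsub>?q\<^esub> ?C v = ?C (u \<oplus>\<^bsub>M\<^esub> v)" if "u \<in> carrier M" "v \<in> carrier M" for u v
    unfolding sel(3)
  proof (intro equalityI subsetI)
    fix w assume "w \<in> ?C u <+>\<^bsub>M\<^esub> ?C v"
    then show "w \<in> ?C (u \<oplus>\<^bsub>M\<^esub> v)"
      using that by (auto simp: set_add_def' coord_add coord_add_in)
  next
    fix w assume w: "w \<in> ?C (u \<oplus>\<^bsub>M\<^esub> v)"
    let ?d = "w \<oplus>\<^bsub>M\<^esub> \<ominus>\<^bsub>M\<^esub> v"
    have "?d \<in> ?C u" using w that by (auto simp: coord_add coord_add_in coord_minus)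
    moreover have "w = ?d \<oplus>\<^bsub>M\<^esub> v"
      using w that by (intro coord_inj) (auto simp: coord_add coord_add_in coord_minus)
    moreover have "v \<in> ?C v" using that by simp
    ultimately show "w \<in> ?C u <+>\<^bsub>M\<^esub> ?C v" unfolding set_add_def' by blast
  qed
  have smult: "r \<odot>\<^bsub>?q\<^esub> ?C u = ?C (r \<odot>\<^bsub>M\<^esub> u)" if r: "r \<in> carrier R" and u: "u \<in> carrier M" for r u
  proof -
    have "?N +>\<^bsub>M\<^esub> (r \<odot>\<^bsub>M\<^esub> v) = ?C (r \<odot>\<^bsub>M\<^esub> u)" if v: "v \<in> ?C u" for v
    proof -
      have "\<phi> (r \<odot>\<^bsub>M\<^esub> v) k = \<phi> (r \<odot>\<^bsub>M\<^esub> u) k" if "k < a" for k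
        using r u v that assms by (simp add: coord_smult)
      then show ?thesis using r v by (simp add: lay_coset coord_smult_in)
    qed
    then show ?thesis unfolding sel(4) using u by auto
  qed
  have "bij_betw \<psi> (carrier ?q) {f. \<forall>k\<ge>a. f k = 0}"
    unfolding bij_betw_def sel
  proof
    show "inj_on \<psi> (?C ` carrier M)"
    proof (rule inj_onI)
      fix B B' assume "B \<in> ?C ` carrier M" "B' \<in> ?C ` carrier M" and eq: "\<psi> B = \<psi> B'"
      then obtain u v where uv: "u \<in> carrier M" "v \<in> carrier M" "B = ?C u" "B' = ?C v" by blast
      then have "\<phi> u k = \<phi> v k" if "k < a" for k
        using fun_cong[OF eq, of k] that by (simp add: \<psi>)
      then show "B = B'" using uv by auto
    qed
    show "\<psi> ` ?C ` carrier M = {f. \<forall>k\<ge>a. f k = 0}"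
    proof (intro equalityI subsetI)
      fix f :: "nat \<Rightarrow> 'k" assume f: "f \<in> {f. \<forall>k\<ge>a. f k = 0}"
      obtain u where u: "u \<in> carrier M" "\<forall>k<m. \<phi> u k = f k" using coord_surj[of f] by blast
      have "\<psi> (?C u) = f" unfolding \<psi>[OF u(1)] using u f assms by auto
      then show "f \<in> \<psi> ` ?C ` carrier M" using u(1) by blast
    qed (auto simp: \<psi>)
  qed
  moreover have "a = 0 \<or> x \<in> V \<and> a \<le> L x" using coord_le assms by (cases "a = 0") auto
  moreover have "\<zero>\<^bsub>?q\<^esub> \<in> carrier ?q" "\<psi> \<zero>\<^bsub>?q\<^esub> = (\<lambda>_. 0)"
  proof -
    show "\<zero>\<^bsub>?q\<^esub> \<in> carrier ?q" unfolding sel(1,2) by (rule imageI[OF coord_zero_in])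
    show "\<psi> \<zero>\<^bsub>?q\<^esub> = (\<lambda>_. 0)" unfolding sel(2) \<psi>[OF coord_zero_in] by (rule ext) (simp add: coord_zero)
  qed
  moreover have "B \<oplus>\<^bsub>?q\<^esub> B' \<in> carrier ?q \<and> \<psi> (B \<oplus>\<^bsub>?q\<^esub> B') = (\<lambda>k. \<psi> B k + \<psi> B' k)"
    if B: "B \<in> carrier ?q" "B' \<in> carrier ?q" for B B'
  proof -
    obtain u where u: "B = ?C u" "u \<in> carrier M" using B(1) unfolding sel(1) by (rule imageE)
    obtain v where v: "B' = ?C v" "v \<in> carrier M" using B(2) unfolding sel(1) by (rule imageE)
    note uv = u(2) v(2) u(1) v(1)
    have *: "B \<oplus>\<^bsub>?q\<^esub> B' = ?C (u \<oplus>\<^bsub>M\<^esub> v)" unfolding uv(3,4) by (rule add[OF uv(1,2)])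
    have "\<psi> (B \<oplus>\<^bsub>?q\<^esub> B') = (\<lambda>k. \<psi> B k + \<psi> B' k)"
      unfolding * unfolding uv(3,4) \<psi>[OF uv(1)] \<psi>[OF uv(2)] \<psi>[OF coord_add_in[OF uv(1,2)]]
      by (rule ext) (simp add: coord_add[OF uv(1,2)])
    then show ?thesis unfolding * sel(1) using imageI[OF coord_add_in[OF uv(1,2)], of ?C] by simp
  qed
  moreover have "r \<odot>\<^bsub>?q\<^esub> B \<in> carrier ?q \<and>
      (\<forall>k<a. \<psi> (r \<odot>\<^bsub>?q\<^esub> B) k = (\<Sum>i\<le>k. co r (sh x i) (k - i) * \<psi> B i))"
    if B: "r \<in> carrier R" "B \<in> carrier ?q" for r B
  proof -
    obtain u where u: "B = ?C u" "u \<in> carrier M" using B(2) unfolding sel(1) by (rule imageE)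
    have *: "r \<odot>\<^bsub>?q\<^esub> B = ?C (r \<odot>\<^bsub>M\<^esub> u)" unfolding u(1) by (rule smult[OF that(1) u(2)])
    have "\<forall>k<a. \<psi> (r \<odot>\<^bsub>?q\<^esub> B) k = (\<Sum>i\<le>k. co r (sh x i) (k - i) * \<psi> B i)"
      unfolding * unfolding u(1) \<psi>[OF u(2)] \<psi>[OF coord_smult_in[OF that(1) u(2)]]
      using u that assms by (auto simp: coord_smult)
    then show ?thesis unfolding * sel(1) using imageI[OF coord_smult_in[OF that(1) u(2)], of ?C] by simp
  qed
  ultimately have "coord ?q x a \<psi>" unfolding coord_def by blast
  then show ?thesis by blast
qed

end

text \<open>Since submodules are layers, this covers every quotient that occurs in a filtration or a
  composition series.\<close>

lemma coord_subquot:
  assumes M: "coord M x m \<phi>" and "a \<le> b" "b \<le> m"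
  shows "\<exists>\<psi>. coord (quot_module (restrict_module M (lay M \<phi> a)) (lay M \<phi> b)) (sh x a) (b - a) \<psi>"
proof -
  let ?N = "restrict_module M (lay M \<phi> a)"
  have "lay ?N (\<lambda>u k. \<phi> u (k + a)) (b - a) = lay M \<phi> b"
  proof (intro equalityI subsetI)
    fix u assume u: "u \<in> lay ?N (\<lambda>u k. \<phi> u (k + a)) (b - a)"
    have "\<phi> u k = 0" if "k < b" for k
    proof (cases "k < a")
      case False
      have "\<forall>j<b - a. \<phi> u (j + a) = 0" using u by (simp add: lay_def)
      then have "\<phi> u (k - a + a) = 0" using False that by (metis diff_less_mono not_less)
      then show ?thesis using False by simp
    qed (use u in \<open>auto simp: lay_def restrict_module_def\<close>)
    then show "u \<in> lay M \<phi> b" using u by (auto simp: lay_def restrict_module_def)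
  qed (use assms in \<open>auto simp: lay_def restrict_module_def\<close>)
  then show ?thesis
    using coord_quot[OF coord_restrict[OF M, of a], of "b - a"] assms by simp
qed

end

section \<open>Homomorphisms and filtrations in coordinates\<close>

context path_basis
begin

lemma coord_hom_zero:
  assumes "coord M x m \<phi>" "coord N y m' \<psi>" "f \<in> mod_hom R M N"
  shows "f \<zero>\<^bsub>M\<^esub> = \<zero>\<^bsub>N\<^esub>"
proof -
  let ?z = "\<zero>\<^bsub>M\<^esub>"
  note z = coord_zero_in[OF assms(1)]
  have fz: "f ?z \<in> carrier N" using assms(3) z by (auto simp: mod_hom_def)
  have "?z \<oplus>\<^bsub>M\<^esub> ?z = ?z"
    using z by (intro coord_inj[OF assms(1)]) (simp_all add: coord_add_in[OF assms(1)] coord_add[OF assms(1)] coord_zero[OF assms(1)])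
  moreover have "f (?z \<oplus>\<^bsub>M\<^esub> ?z) = f ?z \<oplus>\<^bsub>N\<^esub> f ?z" using assms(3) z by (auto simp: mod_hom_def)
  ultimately have eq: "f ?z \<oplus>\<^bsub>N\<^esub> f ?z = f ?z" by simp
  have "\<psi> (f ?z) k + \<psi> (f ?z) k = \<psi> (f ?z) k + 0" for k
    using coord_add[OF assms(2) fz fz, of k] unfolding eq by simp
  then have "\<psi> (f ?z) k = 0" for k by (simp only: add_left_cancel)
  then show ?thesis
    using fz by (intro coord_inj[OF assms(2)]) (simp_all add: coord_zero[OF assms(2)] coord_zero_in[OF assms(2)])
qed

lemma coord_generator:
  assumes "coord M x m \<phi>" "0 < m"
  obtains g where "g \<in> carrier M" "\<And>k. \<phi> g k = (if k = 0 then 1 else 0)"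
proof -
  obtain g where g: "g \<in> carrier M" "\<forall>k<m. \<phi> g k = (if k = 0 then 1 else 0)"
    using coord_surj[OF assms(1), of "\<lambda>k. if k = 0 then 1 else 0"] by blast
  have "\<phi> g k = (if k = 0 then 1 else 0)" for k
    using g coord_out[OF assms(1) g(1), of k] assms(2) by (cases "k < m") auto
  then show ?thesis using that g(1) by blast
qed

text \<open>The algebra element that takes the generator at the top to the module element with
  coordinates \<open>c\<close>. The modules are thus cyclic, and homomorphisms are determined by the
  image of the generator.\<close>

definition act_on_top :: "'v \<Rightarrow> (nat \<Rightarrow> 'k) \<Rightarrow> 'a" where
  "act_on_top x c = el (\<lambda>z l. if z = x then c l else 0)"

lemma act_on_top:
  shows "act_on_top x c \<in> carrier R" "x \<in> V \<Longrightarrow> l < L x \<Longrightarrow> co (act_on_top x c) x l = c l"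
  unfolding act_on_top_def by (auto simp: el)

lemma coord_smult_top:
  assumes M: "coord M x m \<phi>" "u \<in> carrier M" "r \<in> carrier R" "\<And>k. k \<noteq> 0 \<Longrightarrow> \<phi> u k = 0" "k < m"
  shows "\<phi> (r \<odot>\<^bsub>M\<^esub> u) k = co r x k * \<phi> u 0"
proof -
  have "\<phi> (r \<odot>\<^bsub>M\<^esub> u) k = (\<Sum>i\<le>k. if i = 0 then co r x k * \<phi> u 0 else 0)"
    unfolding coord_smult[OF M(1) M(3) M(2) M(5)] by (rule sum.cong) (use M(4) in auto)
  then show ?thesis by simp
qed

lemma coord_generated:
  assumes M: "coord M x m \<phi>" and u: "u \<in> carrier M"
    and g: "g \<in> carrier M" "\<And>k. \<phi> g k = (if k = 0 then 1 else 0)"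
  shows "act_on_top x (\<phi> u) \<odot>\<^bsub>M\<^esub> g = u"
proof (rule coord_inj[OF M coord_smult_in[OF M act_on_top(1) g(1)] u])
  fix k assume k: "k < m"
  then have "x \<in> V \<and> m \<le> L x" using coord_le[OF M] by simp
  then show "\<phi> (act_on_top x (\<phi> u) \<odot>\<^bsub>M\<^esub> g) k = \<phi> u k"
    using coord_smult_top[OF M g(1) act_on_top(1) _ k] g(2) k by (simp add: act_on_top(2))
qed

text \<open>The idempotent at \<open>x\<close> fixes the generator \<open>g\<close>, hence also its image.\<close>

lemma coord_hom_generator:
  assumes M: "coord M x m \<phi>" "0 < m" and N: "coord N y m' \<psi>" and f: "f \<in> mod_hom R M N"
    and g: "g \<in> carrier M" "\<And>k. \<phi> g k = (if k = 0 then 1 else 0)"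
    and nz: "\<psi> (f g) k \<noteq> 0"
  shows "sh y k = x"
proof -
  have x: "x \<in> V" "0 < L x" using coord_le[OF M] M(2) by auto
  have fg: "f g \<in> carrier N" using f g(1) by (auto simp: mod_hom_def)
  have k: "k < m'" using coord_out[OF N fg, of k] nz by (meson not_le)
  have "single 1 x 0 \<odot>\<^bsub>M\<^esub> g = g"
    using g coord_single[OF M(1) x g(1), of _ 1] coord_le[OF M]
    by (intro coord_inj[OF M(1)]) (auto simp: coord_smult_in[OF M(1)])
  moreover have "f (single 1 x 0 \<odot>\<^bsub>M\<^esub> g) = single 1 x 0 \<odot>\<^bsub>N\<^esub> f g"
    using f g(1) by (auto simp: mod_hom_def)
  ultimately have "\<psi> (single 1 x 0 \<odot>\<^bsub>N\<^esub> f g) k \<noteq> 0" using nz by simp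
  then show ?thesis using coord_single[OF N x fg k, of 1] by (auto split: if_splits)
qed

text \<open>The idempotent detects the top, and the path from x with as many arrows as the shorter
  length kills the generator of the shorter module but not that of the longer one. A zero module has
  no recognizable top, hence \<open>0 < m'\<close>.\<close>

lemma coord_mod_iso_iff:
  assumes M: "coord M x m \<phi>" and N: "coord N y m' \<psi>" and m': "0 < m'"
  shows "mod_iso R M N \<longleftrightarrow> x = y \<and> m = m'"
proof
  assume "mod_iso R M N"
  then obtain f where f: "f \<in> mod_hom R M N" and bij: "bij_betw f (carrier M) (carrier N)"
    by (auto simp: mod_iso_def)
  have f0: "f \<zero>\<^bsub>M\<^esub> = \<zero>\<^bsub>N\<^esub>" by (rule coord_hom_zero[OF M N f])
  have fsm: "f (r \<odot>\<^bsub>M\<^esub> u) = r \<odot>\<^bsub>N\<^esub> f u" if "r \<in> carrier R" "u \<in> carrier M" for r u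
    using f that by (auto simp: mod_hom_def)
  obtain n0 where n0: "n0 \<in> carrier N" "\<And>k. \<psi> n0 k = (if k = 0 then 1 else 0)"
    using coord_generator[OF N m'] by blast
  obtain u0 where u0: "u0 \<in> carrier M" "f u0 = n0" using bij n0(1) by (metis bij_betw_imp_surj_on imageE)
  have m: "0 < m"
  proof (rule ccontr)
    assume "\<not> 0 < m"
    then have "u0 = \<zero>\<^bsub>M\<^esub>" by (intro coord_inj[OF M u0(1) coord_zero_in[OF M]]) simp
    then have "\<psi> n0 0 = 0" using f0 u0(2) coord_zero[OF N] by simp
    then show False using n0(2) by simp
  qed
  obtain g where g: "g \<in> carrier M" "\<And>k. \<phi> g k = (if k = 0 then 1 else 0)"
    using coord_generator[OF M m] by blast
  have fg: "f g \<in> carrier N" using f g(1) by (auto simp: mod_hom_def)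
  \<comment> \<open>A surjection cannot send the generator into the radical, as its multiples would
    then miss \<open>n0\<close>.\<close>
  have nz: "\<psi> (f g) 0 \<noteq> 0"
  proof
    assume 0: "\<psi> (f g) 0 = 0"
    have "n0 = act_on_top x (\<phi> u0) \<odot>\<^bsub>N\<^esub> f g"
      using coord_generated[OF M u0(1) g] fsm[OF act_on_top(1) g(1)] u0(2) by metis
    then have "\<psi> n0 0 = 0" using coord_smult[OF N act_on_top(1) fg m'] 0 by simp
    then show False using n0(2) by simp
  qed
  have yx: "y = x" using coord_hom_generator[OF M m N f g nz] by simp
  have Lx: "x \<in> V" "m \<le> L x" "m' \<le> L x" using coord_le[OF M m] coord_le[OF N m'] yx by auto
  have "m = m'"
  proof (rule linorder_cases[of m m'])
    assume less: "m < m'"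
    have "single 1 x m \<odot>\<^bsub>M\<^esub> g = \<zero>\<^bsub>M\<^esub>"
      using coord_single[OF M Lx(1) _ g(1)] less Lx
      by (intro coord_inj[OF M]) (simp_all add: coord_smult_in[OF M] g coord_zero_in[OF M] coord_zero[OF M])
    then have "single 1 x m \<odot>\<^bsub>N\<^esub> f g = \<zero>\<^bsub>N\<^esub>" using fsm[OF single_in g(1)] f0 by metis
    then have "\<psi> (single 1 x m \<odot>\<^bsub>N\<^esub> f g) m = 0" using coord_zero[OF N] by simp
    then show ?thesis using coord_single[OF N Lx(1) _ fg less, of m 1] less Lx nz yx by simp
  next
    assume less: "m' < m"
    have "single 1 x m' \<odot>\<^bsub>N\<^esub> f g = \<zero>\<^bsub>N\<^esub>"
      using coord_single[OF N Lx(1) _ fg] less Lx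
      by (intro coord_inj[OF N]) (simp_all add: coord_smult_in[OF N] fg coord_zero_in[OF N] coord_zero[OF N])
    then have "f (single 1 x m' \<odot>\<^bsub>M\<^esub> g) = f \<zero>\<^bsub>M\<^esub>" using fsm[OF single_in g(1)] f0 by metis
    then have "single 1 x m' \<odot>\<^bsub>M\<^esub> g = \<zero>\<^bsub>M\<^esub>"
      using bij coord_smult_in[OF M single_in g(1)] coord_zero_in[OF M]
      by (auto simp: bij_betw_def dest: inj_onD)
    then have "\<phi> (single 1 x m' \<odot>\<^bsub>M\<^esub> g) m' = 0" using coord_zero[OF M] by simp
    then show ?thesis using coord_single[OF M Lx(1) _ g(1) less, of m' 1] less Lx g(2) by simp
  qed
  then show "x = y \<and> m = m'" using yx by simp
next
  assume "x = y \<and> m = m'"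
  then have N: "coord N x m \<psi>" using N by simp
  have bM: "bij_betw \<phi> (carrier M) {f. \<forall>k\<ge>m. f k = 0}" and bN: "bij_betw \<psi> (carrier N) {f. \<forall>k\<ge>m. f k = 0}"
    using M N by (auto simp: coord_def)
  define f where "f = inv_into (carrier N) \<psi> \<circ> \<phi>"
  have bij: "bij_betw f (carrier M) (carrier N)"
    unfolding f_def by (rule bij_betw_trans[OF bM bij_betw_inv_into[OF bN]])
  have fin: "f u \<in> carrier N" if "u \<in> carrier M" for u using bij that by (auto simp: bij_betw_def)
  have pf: "\<psi> (f u) = \<phi> u" if "u \<in> carrier M" for u
    unfolding f_def comp_def using that bM bN by (intro bij_betw_inv_into_right[OF bN]) (auto simp: bij_betw_def)
  have "f (u \<oplus>\<^bsub>M\<^esub> v) = f u \<oplus>\<^bsub>N\<^esub> f v" if "u \<in> carrier M" "v \<in> carrier M" for u v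
    using that by (intro coord_inj[OF N])
      (simp_all add: fin pf coord_add_in[OF M] coord_add_in[OF N] coord_add[OF M] coord_add[OF N])
  moreover have "f (r \<odot>\<^bsub>M\<^esub> u) = r \<odot>\<^bsub>N\<^esub> f u" if "r \<in> carrier R" "u \<in> carrier M" for r u
    using that by (intro coord_inj[OF N])
      (simp_all add: fin pf coord_smult_in[OF M] coord_smult_in[OF N] coord_smult[OF M] coord_smult[OF N])
  ultimately have "f \<in> mod_hom R M N" using fin by (auto simp: mod_hom_def)
  then show "mod_iso R M N" unfolding mod_iso_def using bij by blast
qed

lemma coord_smult_scalar:
  assumes s: "s \<in> carrier R" "\<And>y l. y \<in> V \<Longrightarrow> l < L y \<Longrightarrow> co s y l = (if l = 0 then c else 0)"
    and M: "coord M x m \<phi>" and u: "u \<in> carrier M"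
  shows "\<phi> (s \<odot>\<^bsub>M\<^esub> u) k = c * \<phi> u k"
proof (cases "k < m")
  case True
  have "\<phi> (s \<odot>\<^bsub>M\<^esub> u) k = (\<Sum>i\<le>k. if i = k then c * \<phi> u k else 0)"
    unfolding coord_smult[OF M s(1) u True]
    by (rule sum.cong) (use coord_sh[OF M _ True] s(2) in auto)
  then show ?thesis by simp
next
  case False
  then show ?thesis using coord_out[OF M] u coord_smult_in[OF M s(1) u] by simp
qed

lemma coord_scalar_End:
  assumes s: "s \<in> carrier R" "\<And>y l. y \<in> V \<Longrightarrow> l < L y \<Longrightarrow> co s y l = (if l = 0 then c else 0)"
    and M: "coord M x m \<phi>"
  shows "(\<lambda>u\<in>carrier M. s \<odot>\<^bsub>M\<^esub> u) \<in> carrier (End_ring R M)"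
proof -
  have sM: "\<phi> (s \<odot>\<^bsub>M\<^esub> u) k = c * \<phi> u k" if "u \<in> carrier M" for u k
    by (rule coord_smult_scalar[OF s(1) _ M that]) (rule s(2))
  have "s \<odot>\<^bsub>M\<^esub> (u \<oplus>\<^bsub>M\<^esub> v) = s \<odot>\<^bsub>M\<^esub> u \<oplus>\<^bsub>M\<^esub> s \<odot>\<^bsub>M\<^esub> v" if "u \<in> carrier M" "v \<in> carrier M" for u v
    using that by (intro coord_inj[OF M]) (simp_all add: coord_smult_in[OF M] s
      coord_add_in[OF M] coord_add[OF M] sM algebra_simps)
  moreover have "s \<odot>\<^bsub>M\<^esub> (r \<odot>\<^bsub>M\<^esub> u) = r \<odot>\<^bsub>M\<^esub> (s \<odot>\<^bsub>M\<^esub> u)" if r: "r \<in> carrier R" and u: "u \<in> carrier M" for r u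
  proof -
    have in': "r \<odot>\<^bsub>M\<^esub> u \<in> carrier M" "s \<odot>\<^bsub>M\<^esub> u \<in> carrier M" using coord_smult_in[OF M] r u s by auto
    show ?thesis
    proof (rule coord_inj[OF M coord_smult_in[OF M s(1) in'(1)] coord_smult_in[OF M r in'(2)]])
      fix k assume k: "k < m"
      show "\<phi> (s \<odot>\<^bsub>M\<^esub> (r \<odot>\<^bsub>M\<^esub> u)) k = \<phi> (r \<odot>\<^bsub>M\<^esub> (s \<odot>\<^bsub>M\<^esub> u)) k"
        unfolding sM[OF in'(1)] coord_smult[OF M r u k] coord_smult[OF M r in'(2) k] sM[OF u]
        by (simp add: sum_distrib_left mult.left_commute)
    qed
  qed
  ultimately show ?thesis
    by (auto simp: End_ring_def mod_hom_def coord_smult_in[OF M] coord_add_in[OF M] s)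
qed

text \<open>An endomorphism is given by the image of the generator, which can have nonzero
  coordinates only at occurrences of x. A single occurrence leaves the scalars, a second one at
  depth k allows the shift by k. The elements \<open>s c\<close> stand for the image of K in the
  algebra.\<close>

lemma coord_End_iff:
  fixes M :: "('a, 'b) module"
  assumes s: "\<And>c. s c \<in> carrier R"
      "\<And>c y l. y \<in> V \<Longrightarrow> l < L y \<Longrightarrow> co (s c) y l = (if l = 0 then c else 0)"
    and M: "coord M x m \<phi>" "0 < m"
  shows "(\<exists>h\<in>ring_iso (End_ring R M) (ring_of_type_algebra :: 'k ring).
      \<forall>c. \<forall>f\<in>carrier (End_ring R M). h (\<lambda>u\<in>carrier M. s c \<odot>\<^bsub>M\<^esub> f u) = c * h f)
    \<longleftrightarrow> (\<forall>k. 0 < k \<and> k < m \<longrightarrow> sh x k \<noteq> x)" (is "?E \<longleftrightarrow> _")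
proof -
  obtain g where g: "g \<in> carrier M" "\<And>k. \<phi> g k = (if k = 0 then 1 else 0)"
    using coord_generator[OF M] by blast
  have sM: "\<phi> (s c \<odot>\<^bsub>M\<^esub> u) k = c * \<phi> u k" if "u \<in> carrier M" for c u k
    by (rule coord_smult_scalar[OF s(1) _ M(1) that]) (rule s(2))
  have sE: "(\<lambda>u\<in>carrier M. s c \<odot>\<^bsub>M\<^esub> u) \<in> carrier (End_ring R M)" for c
    by (rule coord_scalar_End[OF s(1) _ M(1)]) (rule s(2))
  have E: "carrier (End_ring R M) = mod_hom R M M \<inter> extensional (carrier M)"
    by (simp add: End_ring_def)
  have id: "(\<lambda>u\<in>carrier M. u) \<in> carrier (End_ring R M)"
    using coord_add_in[OF M(1)] coord_smult_in[OF M(1)] by (auto simp: E mod_hom_def)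
  show ?thesis
  proof
    assume ?E
    then obtain h :: "('b \<Rightarrow> 'b) \<Rightarrow> 'k" where
      h: "h \<in> ring_iso (End_ring R M) ring_of_type_algebra"
      "\<And>c f. f \<in> carrier (End_ring R M) \<Longrightarrow> h (\<lambda>u\<in>carrier M. s c \<odot>\<^bsub>M\<^esub> f u) = c * h f" by blast
    have h1: "h (\<lambda>u\<in>carrier M. u) = 1"
      using ring_iso_memE(4)[OF h(1)] by (simp add: End_ring_def ring_of_type_algebra_def)
    have hinj: "inj_on h (carrier (End_ring R M))"
      using ring_iso_memE(5)[OF h(1)] by (simp add: bij_betw_def)
    \<comment> \<open>By linearity \<open>h\<close> sends the scalar endomorphism belonging to
      \<open>h f\<close> to \<open>h f\<close> times 1, so by injectivity it is
      \<open>f\<close>.\<close>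
    have scalar: "f u = s (h f) \<odot>\<^bsub>M\<^esub> u" if f: "f \<in> carrier (End_ring R M)" and u: "u \<in> carrier M" for f u
    proof -
      let ?f = "\<lambda>u\<in>carrier M. s (h f) \<odot>\<^bsub>M\<^esub> (\<lambda>u\<in>carrier M. u) u"
      have "?f = (\<lambda>u\<in>carrier M. s (h f) \<odot>\<^bsub>M\<^esub> u)" by (rule restrict_ext) simp
      then have "?f \<in> carrier (End_ring R M)" using sE by simp
      moreover have "h ?f = h f" using h(2)[OF id] h1 by simp
      ultimately have "?f = f" using hinj f by (auto dest: inj_onD)
      from fun_cong[OF this, of u] show ?thesis using u by simp
    qed
    show "\<forall>k. 0 < k \<and> k < m \<longrightarrow> sh x k \<noteq> x"
    proof (intro allI impI notI)
      fix k assume k: "0 < k \<and> k < m" and xk: "sh x k = x"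
      have "\<exists>v\<in>carrier M. \<forall>j<m. \<phi> v j = (if k \<le> j then \<phi> u (j - k) else 0)" for u
        by (rule coord_surj[OF M(1)])
      then obtain f0 where f0: "\<And>u. f0 u \<in> carrier M"
        "\<And>u j. j < m \<Longrightarrow> \<phi> (f0 u) j = (if k \<le> j then \<phi> u (j - k) else 0)" by metis
      \<comment> \<open>The vertices repeat with period k, so the coefficients acting on shifted
        coordinates are the same as before, and the shift commutes with the algebra.\<close>
      have shk: "sh x (i + k) = sh x i" for i
        using xk sh_add[of x k i] by (simp add: add.commute)
      have "f0 (u \<oplus>\<^bsub>M\<^esub> v) = f0 u \<oplus>\<^bsub>M\<^esub> f0 v" if "u \<in> carrier M" "v \<in> carrier M" for u v
        using that by (intro coord_inj[OF M(1)])
          (simp_all add: f0 coord_add_in[OF M(1)] coord_add[OF M(1)])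
      moreover have "f0 (r \<odot>\<^bsub>M\<^esub> u) = r \<odot>\<^bsub>M\<^esub> f0 u" if r: "r \<in> carrier R" and u: "u \<in> carrier M" for r u
      proof (rule coord_inj[OF M(1) f0(1) coord_smult_in[OF M(1) r f0(1)]])
        fix j assume j: "j < m"
        show "\<phi> (f0 (r \<odot>\<^bsub>M\<^esub> u)) j = \<phi> (r \<odot>\<^bsub>M\<^esub> f0 u) j"
        proof (cases "k \<le> j")
          case True
          have "\<phi> (r \<odot>\<^bsub>M\<^esub> f0 u) j = (\<Sum>i\<le>j. co r (sh x i) (j - i) * (if k \<le> i then \<phi> u (i - k) else 0))"
            unfolding coord_smult[OF M(1) r f0(1) j] by (rule sum.cong) (use f0(2) j in auto)
          also have "\<dots> = (\<Sum>i\<in>{0 + k..(j - k) + k}. co r (sh x i) (j - i) * (if k \<le> i then \<phi> u (i - k) else 0))"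
            by (rule sum.mono_neutral_right) (use True in auto)
          also have "\<dots> = (\<Sum>i\<in>{0..j - k}. co r (sh x (i + k)) (j - (i + k)) * (if k \<le> i + k then \<phi> u (i + k - k) else 0))"
            by (rule sum.shift_bounds_cl_nat_ivl)
          also have "\<dots> = (\<Sum>i\<le>j - k. co r (sh x i) (j - k - i) * \<phi> u i)"
            by (simp add: shk atMost_atLeast0 add.commute)
          also have "\<dots> = \<phi> (f0 (r \<odot>\<^bsub>M\<^esub> u)) j"
            using True j by (simp add: f0(2) coord_smult[OF M(1) r u])
          finally show ?thesis by simp
        next
          case False
          then show ?thesis using j by (simp add: f0(2) coord_smult[OF M(1) r f0(1)])
        qed
      qed
      ultimately have "restrict f0 (carrier M) \<in> carrier (End_ring R M)"
        using f0(1) coord_add_in[OF M(1)] coord_smult_in[OF M(1)] by (auto simp: E mod_hom_def)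
      from scalar[OF this g(1)] have eq: "f0 g = s (h (restrict f0 (carrier M))) \<odot>\<^bsub>M\<^esub> g" using g(1) by simp
      have "\<phi> (f0 g) 0 = 0" "\<phi> (f0 g) k = 1" using f0(2)[of _ g] k g(2) by auto
      then show False unfolding eq sM[OF g(1)] using g(2) k by simp
    qed
  next
    assume nc: "\<forall>k. 0 < k \<and> k < m \<longrightarrow> sh x k \<noteq> x"
    have fg: "\<phi> (f g) k = 0" if "f \<in> mod_hom R M M" "k \<noteq> 0" for f k
    proof (rule ccontr)
      assume nz: "\<phi> (f g) k \<noteq> 0"
      have "f g \<in> carrier M" using that g(1) by (auto simp: mod_hom_def)
      then have "k < m" using nz coord_out[OF M(1), of "f g" k] by (meson not_le)
      then show False using coord_hom_generator[OF M M(1) that(1) g nz] nc that(2) by simp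
    qed
    have scalar: "f u = s (\<phi> (f g) 0) \<odot>\<^bsub>M\<^esub> u" if f: "f \<in> mod_hom R M M" and u: "u \<in> carrier M" for f u
    proof -
      have fgin: "f g \<in> carrier M" and fuin: "f u \<in> carrier M" using f g(1) u by (auto simp: mod_hom_def)
      have "f (act_on_top x (\<phi> u) \<odot>\<^bsub>M\<^esub> g) = act_on_top x (\<phi> u) \<odot>\<^bsub>M\<^esub> f g"
        using f g(1) act_on_top(1) by (auto simp: mod_hom_def)
      then have fu: "f u = act_on_top x (\<phi> u) \<odot>\<^bsub>M\<^esub> f g" using coord_generated[OF M(1) u g] by simp
      have x: "x \<in> V" "m \<le> L x" using coord_le[OF M] by auto
      show ?thesis
      proof (rule coord_inj[OF M(1) fuin coord_smult_in[OF M(1) s(1) u]])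
        fix k assume k: "k < m"
        then show "\<phi> (f u) k = \<phi> (s (\<phi> (f g) 0) \<odot>\<^bsub>M\<^esub> u) k"
          unfolding fu sM[OF u]
          using coord_smult_top[OF M(1) fgin act_on_top(1) fg[OF f] k] x by (simp add: act_on_top(2))
      qed
    qed
    define h where "h f = \<phi> (f g) 0" for f :: "'b \<Rightarrow> 'b"
    have Ein: "f \<in> mod_hom R M M" "f g \<in> carrier M" "f \<in> extensional (carrier M)"
      if "f \<in> carrier (End_ring R M)" for f
      using that g(1) by (auto simp: E mod_hom_def)
    have "h \<in> ring_iso (End_ring R M) ring_of_type_algebra"
    proof (rule ring_iso_memI)
      fix f f' assume f: "f \<in> carrier (End_ring R M)" "f' \<in> carrier (End_ring R M)"
      have "f (f' g) = s (h f) \<odot>\<^bsub>M\<^esub> f' g" unfolding h_def by (rule scalar[OF Ein(1)[OF f(1)] Ein(2)[OF f(2)]])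
      then show "h (f \<otimes>\<^bsub>End_ring R M\<^esub> f') = h f \<otimes>\<^bsub>ring_of_type_algebra\<^esub> h f'"
        using g(1) sM[OF Ein(2)[OF f(2)]] by (simp add: End_ring_def compose_def ring_of_type_algebra_def h_def)
      show "h (f \<oplus>\<^bsub>End_ring R M\<^esub> f') = h f \<oplus>\<^bsub>ring_of_type_algebra\<^esub> h f'"
        using g(1) coord_add[OF M(1) Ein(2)[OF f(1)] Ein(2)[OF f(2)]]
        by (simp add: End_ring_def ring_of_type_algebra_def h_def)
    next
      show "h \<one>\<^bsub>End_ring R M\<^esub> = \<one>\<^bsub>ring_of_type_algebra\<^esub>"
        using g by (simp add: End_ring_def ring_of_type_algebra_def h_def)
    next
      show "bij_betw h (carrier (End_ring R M)) (carrier ring_of_type_algebra)"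
        unfolding bij_betw_def
      proof
        show "inj_on h (carrier (End_ring R M))"
        proof (rule inj_onI)
          fix f f' assume f: "f \<in> carrier (End_ring R M)" "f' \<in> carrier (End_ring R M)" "h f = h f'"
          show "f = f'"
          proof (rule extensionalityI[OF Ein(3)[OF f(1)] Ein(3)[OF f(2)]])
            fix u assume "u \<in> carrier M"
            then show "f u = f' u"
              using scalar[OF Ein(1)[OF f(1)]] scalar[OF Ein(1)[OF f(2)]] f(3) by (simp add: h_def)
          qed
        qed
        have "h (\<lambda>u\<in>carrier M. s c \<odot>\<^bsub>M\<^esub> u) = c" for c
          using g sM[OF g(1)] by (simp add: h_def)
        then have "c \<in> h ` carrier (End_ring R M)" for c using sE[of c] by (metis imageI)
        then show "h ` carrier (End_ring R M) = carrier ring_of_type_algebra"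
          by (auto simp: ring_of_type_algebra_def)
      qed
    qed (simp add: ring_of_type_algebra_def)
    moreover have "h (\<lambda>u\<in>carrier M. s c \<odot>\<^bsub>M\<^esub> f u) = c * h f" if "f \<in> carrier (End_ring R M)" for c f
      using g(1) sM[OF Ein(2)[OF that]] by (simp add: h_def)
    ultimately show ?E by blast
  qed
qed

text \<open>Submodules form a chain, so only one of them is maximal.\<close>

lemma coord_radical:
  assumes M: "coord M x m \<phi>" "0 < m"
  shows "module_radical R M = lay M \<phi> 1"
proof -
  have sub: "lay M \<phi> a \<subseteq> carrier M" for a by (auto simp: lay_def)
  have ne: "lay M \<phi> a \<noteq> carrier M" if "0 < a" "a \<le> m" for a
    using lay_eq_iff[OF M(1), of a 0] that by (simp add: lay_0[OF M(1)])
  have "maximal_submodule N R M \<longleftrightarrow> N = lay M \<phi> 1" for N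
  proof
    assume N: "maximal_submodule N R M"
    then obtain a where a: "a \<le> m" "N = lay M \<phi> a"
      using submodule_is_lay[OF M(1), of N] by (auto simp: maximal_submodule_def)
    have "a \<noteq> 0" using N a by (auto simp: maximal_submodule_def lay_0[OF M(1)])
    then have "N \<subseteq> lay M \<phi> 1" using lay_subset_iff[OF M(1), of 1 a] a M(2) by simp
    then have "lay M \<phi> 1 = N \<or> lay M \<phi> 1 = carrier M"
      using N lay_submodule[OF M(1)] by (auto simp: maximal_submodule_def)
    then show "N = lay M \<phi> 1" using ne[of 1] M(2) by auto
  next
    assume N: "N = lay M \<phi> 1"
    have "H = N \<or> H = carrier M" if H: "submodule H R M" "N \<subseteq> H" for H
    proof -
      obtain a where a: "a \<le> m" "H = lay M \<phi> a" using submodule_is_lay[OF M(1) H(1)] by blast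
      then have "a \<le> 1" using lay_subset_iff[OF M(1), of a 1] H(2) N by simp
      then consider "a = 0" | "a = 1" by linarith
      then show ?thesis
      proof cases
        case 1
        then have "H = carrier M" using a(2) lay_0[OF M(1)] by (simp only:)
        then show ?thesis by (rule disjI2)
      next
        case 2
        then have "H = N" using a(2) N by (simp only:)
        then show ?thesis by (rule disjI1)
      qed
    qed
    moreover have "submodule N R M" "N \<noteq> carrier M"
      using N ne[of 1] M(2) lay_submodule[OF M(1)] by simp_all
    ultimately show "maximal_submodule N R M" unfolding maximal_submodule_def by blast
  qed
  then have "{N. maximal_submodule N R M} = {lay M \<phi> 1}" by blast
  then show ?thesis using sub[of 1] unfolding module_radical_def by (simp add: Int_absorb1)
qed

lemma coord_simple:
  assumes M: "coord M x 1 \<phi>"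
  shows "simple_module R M"
proof -
  have "H = {\<zero>\<^bsub>M\<^esub>} \<or> H = carrier M" if H: "submodule H R M" for H
  proof -
    obtain a where a: "a \<le> 1" "H = lay M \<phi> a" using submodule_is_lay[OF M H] by blast
    then consider "a = 0" | "a = 1" by linarith
    then show ?thesis
    proof cases
      case 1
      then show ?thesis using a(2) lay_0[OF M] by simp
    next
      case 2
      then show ?thesis using a(2) lay_max[OF M] by simp
    qed
  qed
  moreover have "carrier M \<noteq> {\<zero>\<^bsub>M\<^esub>}"
  proof -
    have "lay M \<phi> 0 \<noteq> lay M \<phi> 1" by (subst lay_eq_iff[OF M]) auto
    then show ?thesis unfolding lay_0[OF M] lay_max[OF M] .
  qed
  ultimately show ?thesis by (simp add: simple_module_def)
qed

text \<open>All members of any composition series are layers, so its factors are single positions;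
  conversely, the series of all layers exhibits every position.\<close>

lemma coord_composition_factor:
  assumes M: "coord M x m \<phi>" and S: "coord S y 1 \<tau>"
  shows "composition_factor R M S \<longleftrightarrow> (\<exists>k<m. sh x k = y)"
proof
  assume "composition_factor R M S"
  then obtain Ns i where cs: "composition_series R M Ns" and i: "Suc i < length Ns"
    and iso: "mod_iso R (filtration_quot M Ns i) S"
    by (auto simp: composition_factor_def)
  have fil: "filtration R M Ns" using cs by (simp add: composition_series_def)
  then have sm: "submodule (Ns ! i) R M" "submodule (Ns ! Suc i) R M" "Ns ! i \<subseteq> Ns ! Suc i"
    using i by (auto simp: filtration_def)
  obtain b where b: "b \<le> m" "Ns ! i = lay M \<phi> b" using submodule_is_lay[OF M sm(1)] by blast
  obtain a where a: "a \<le> m" "Ns ! Suc i = lay M \<phi> a" using submodule_is_lay[OF M sm(2)] by blast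
  have ab: "a \<le> b" using lay_subset_iff[OF M a(1), of b] a b sm(3) by simp
  obtain \<psi> where \<psi>: "coord (filtration_quot M Ns i) (sh x a) (b - a) \<psi>"
    using coord_subquot[OF M ab b(1)] by (auto simp: filtration_quot_def a b)
  then have "sh x a = y \<and> b - a = 1" using coord_mod_iso_iff[OF \<psi> S] iso by simp
  then show "\<exists>k<m. sh x k = y" using b by (intro exI[of _ a]) auto
next
  assume "\<exists>k<m. sh x k = y"
  then obtain k where k: "k < m" "sh x k = y" by blast
  \<comment> \<open>Series are listed from zero upwards, layers from the whole module downwards,
    hence the index \<open>m - i\<close>.\<close>
  define Ns where "Ns = map (\<lambda>i. lay M \<phi> (m - i)) [0..<Suc m]"
  have len: "length Ns = Suc m" by (simp add: Ns_def)
  have nth: "Ns ! i = lay M \<phi> (m - i)" if "i \<le> m" for i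
    using that by (simp add: Ns_def del: upt_Suc)
  have "hd Ns = {\<zero>\<^bsub>M\<^esub>}" using len nth[of 0] lay_max[OF M] by (cases Ns) auto
  moreover have "last Ns = carrier M"
    using len nth[of m] lay_0[OF M] by (subst last_conv_nth) auto
  moreover have "\<forall>N\<in>set Ns. submodule N R M" by (auto simp: Ns_def lay_submodule[OF M])
  moreover have "Ns ! i \<subseteq> Ns ! Suc i" if "Suc i < length Ns" for i
    using that lay_subset_iff[OF M] by (simp add: len nth)
  ultimately have fil: "filtration R M Ns" using len by (auto simp: filtration_def)
  have quot: "\<exists>\<psi>. coord (filtration_quot M Ns i) (sh x (m - Suc i)) 1 \<psi>" if "Suc i < length Ns" for i
    using coord_subquot[OF M, of "m - Suc i" "m - i"] that
    by (simp add: filtration_quot_def len nth Suc_diff_Suc)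
  have "composition_series R M Ns"
    unfolding composition_series_def using fil quot coord_simple by blast
  moreover have "Suc (m - Suc k) < length Ns" using k by (simp add: len)
  moreover from quot[OF this] have "\<exists>\<psi>. coord (filtration_quot M Ns (m - Suc k)) y 1 \<psi>"
    using k by (simp add: Suc_diff_Suc)
  then have "mod_iso R (filtration_quot M Ns (m - Suc k)) S"
    using coord_mod_iso_iff[OF _ S] by auto
  ultimately show "composition_factor R M S" unfolding composition_factor_def by blast
qed

text \<open>The list of submodules ascends, whereas the Weyl modules are cut off from the top; so
  the first direction runs backwards through the list. A quotient that starts at depth
  \<open>a\<close> has top \<open>sh x a\<close>, which leaves only one Weyl module and thereby
  fixes the next cut.\<close>

lemma coord_good_iff:
  assumes lin: "linear_order_on V r" and M: "coord M x (L x) \<phi>" and x: "x \<in> V"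
    and W: "\<And>y. y \<in> V \<Longrightarrow> \<exists>\<psi>. coord (W y) y (D r y) \<psi>"
  shows "(\<exists>Ns. filtration R M Ns \<and>
      (\<forall>i. Suc i < length Ns \<longrightarrow> (\<exists>y\<in>V. mod_iso R (filtration_quot M Ns i) (W y)))) \<longleftrightarrow> reach r x (L x)"
    (is "?good \<longleftrightarrow> _")
proof
  assume ?good
  then obtain Ns where fil: "filtration R M Ns"
    and iso: "\<And>i. Suc i < length Ns \<Longrightarrow> \<exists>y\<in>V. mod_iso R (filtration_quot M Ns i) (W y)" by blast
  have ne: "Ns \<noteq> []" and hd: "hd Ns = {\<zero>\<^bsub>M\<^esub>}" and last: "last Ns = carrier M"
    and sm: "\<And>i. i < length Ns \<Longrightarrow> submodule (Ns ! i) R M"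
    and mono: "\<And>i. Suc i < length Ns \<Longrightarrow> Ns ! i \<subseteq> Ns ! Suc i"
    using fil by (auto simp: filtration_def)
  have "\<exists>a\<le>L x. Ns ! i = lay M \<phi> a \<and> reach r x a" if "i \<le> length Ns - 1" for i
    using that
  proof (induction i rule: inc_induct)
    case base
    have "Ns ! (length Ns - 1) = lay M \<phi> 0"
      using last ne by (simp add: last_conv_nth lay_0[OF M])
    then show ?case using reach_0 by blast
  next
    case (step i)
    then obtain a where a: "a \<le> L x" "Ns ! Suc i = lay M \<phi> a" "reach r x a" by auto
    have i: "Suc i < length Ns" using step by simp
    obtain b where b: "b \<le> L x" "Ns ! i = lay M \<phi> b"
      using submodule_is_lay[OF M sm[of i]] i by auto
    have ab: "a \<le> b" using lay_subset_iff[OF M a(1), of b] a b mono[OF i] by simp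
    obtain \<psi> where \<psi>: "coord (filtration_quot M Ns i) (sh x a) (b - a) \<psi>"
      using coord_subquot[OF M ab b(1)] by (auto simp: filtration_quot_def a b)
    obtain y where y: "y \<in> V" "mod_iso R (filtration_quot M Ns i) (W y)" using iso[OF i] by blast
    obtain \<chi> where \<chi>: "coord (W y) y (D r y) \<chi>" using W[OF y(1)] by blast
    have "sh x a = y \<and> b - a = D r y"
      using coord_mod_iso_iff[OF \<psi> \<chi> D_pos[OF lin y(1)]] y(2) by simp
    \<comment> \<open>Weyl modules being nonzero also yields \<open>a < L x\<close>, the condition
      for a further \<open>reach_step\<close>.\<close>
    moreover from this have "a < b" using D_pos[OF lin y(1)] by linarith
    ultimately have "b = a + D r (sh x a)" "a < L x" using b by auto
    then show ?case using b reach_step[OF a(3)] by auto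
  qed
  then obtain a where a: "a \<le> L x" "Ns ! 0 = lay M \<phi> a" "reach r x a" by blast
  have "lay M \<phi> a = lay M \<phi> (L x)" using a(2) hd ne by (simp add: lay_max[OF M] hd_conv_nth)
  then have "a = L x" using lay_eq_iff[OF M a(1)] by simp
  then show "reach r x (L x)" using a(3) by simp
next
  assume "reach r x (L x)"
  have "\<exists>Ns. Ns \<noteq> [] \<and> hd Ns = lay M \<phi> p \<and> last Ns = carrier M \<and> (\<forall>N\<in>set Ns. submodule N R M) \<and>
      (\<forall>i. Suc i < length Ns \<longrightarrow> Ns ! i \<subseteq> Ns ! Suc i) \<and>
      (\<forall>i. Suc i < length Ns \<longrightarrow> (\<exists>y\<in>V. mod_iso R (filtration_quot M Ns i) (W y)))"
    if "reach r x p" "p \<le> L x" for p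
    using that
  proof (induction rule: reach.induct)
    case reach_0
    have "submodule (carrier M) R M" using lay_submodule[OF M, of 0] by (simp add: lay_0[OF M])
    then show ?case by (intro exI[of _ "[carrier M]"]) (simp add: lay_0[OF M])
  next
    case (reach_step p)
    let ?q = "p + D r (sh x p)"
    obtain Ns where Ns: "Ns \<noteq> []" "hd Ns = lay M \<phi> p" "last Ns = carrier M" "\<forall>N\<in>set Ns. submodule N R M"
      "\<forall>i. Suc i < length Ns \<longrightarrow> Ns ! i \<subseteq> Ns ! Suc i"
      "\<forall>i. Suc i < length Ns \<longrightarrow> (\<exists>y\<in>V. mod_iso R (filtration_quot M Ns i) (W y))"
      using reach_step by auto
    have hd: "Ns ! 0 = lay M \<phi> p" using Ns by (simp add: hd_conv_nth)
    have y: "sh x p \<in> V" using sh_in[OF x] reach_step.hyps by blast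
    obtain \<chi> where \<chi>: "coord (W (sh x p)) (sh x p) (D r (sh x p)) \<chi>" using W[OF y] by blast
    obtain \<psi> where \<psi>: "coord (filtration_quot M (lay M \<phi> ?q # Ns) 0) (sh x p) (D r (sh x p)) \<psi>"
      using coord_subquot[OF M, of p ?q] reach_step.prems by (auto simp: filtration_quot_def hd)
    have iso0: "mod_iso R (filtration_quot M (lay M \<phi> ?q # Ns) 0) (W (sh x p))"
      using coord_mod_iso_iff[OF \<psi> \<chi> D_pos[OF lin y]] by simp
    have sub0: "lay M \<phi> ?q \<subseteq> Ns ! 0" unfolding hd by (auto simp: lay_def)
    have cons: "filtration_quot M (N # Ns) (Suc i) = filtration_quot M Ns i" for N i
      by (simp add: filtration_quot_def)
    show ?case
    proof (intro exI[of _ "lay M \<phi> ?q # Ns"] conjI allI impI)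
      fix i assume i: "Suc i < length (lay M \<phi> ?q # Ns)"
      show "(lay M \<phi> ?q # Ns) ! i \<subseteq> (lay M \<phi> ?q # Ns) ! Suc i"
        using i Ns(5) sub0 by (cases i) auto
      show "\<exists>y\<in>V. mod_iso R (filtration_quot M (lay M \<phi> ?q # Ns) i) (W y)"
        using i Ns(6) iso0 y by (cases i) (auto simp: cons)
    qed (use Ns lay_submodule[OF M] in auto)
  qed
  from this[OF \<open>reach r x (L x)\<close> order_refl] obtain Ns where
    "Ns \<noteq> []" "hd Ns = lay M \<phi> (L x)" "last Ns = carrier M" "\<forall>N\<in>set Ns. submodule N R M"
    "\<forall>i. Suc i < length Ns \<longrightarrow> Ns ! i \<subseteq> Ns ! Suc i"
    "\<forall>i. Suc i < length Ns \<longrightarrow> (\<exists>y\<in>V. mod_iso R (filtration_quot M Ns i) (W y))" by blast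
  then show ?good
    by (intro exI[of _ Ns]) (auto simp: filtration_def lay_max[OF M])
qed

text \<open>\<open>single 1 x 0\<close> is the idempotent \<open>e\<^sub>x\<close>.\<close>

definition proj :: "'v \<Rightarrow> ('a, 'a) module" where
  "proj x = restrict_module (regular_module R) {a \<otimes> single 1 x 0 | a. a \<in> carrier R}"

lemma co_mult_single:
  assumes "a \<in> carrier R" "x \<in> V"
  shows "co (a \<otimes> single 1 x 0) y l = (if y = x then co a x l else 0)"
proof (cases "y \<in> V \<and> l < L y")
  case True
  have x: "0 < L x" using L_pos[OF assms(2)] by simp
  have "co (a \<otimes> single 1 x 0) y l = (\<Sum>i\<le>l. co a (sh y i) (l - i) * co (single 1 x 0) y i)"
    using True assms by (intro co_mult) auto
  also have "\<dots> = (\<Sum>i\<le>l. if i = 0 then (if y = x then co a x l else 0) else 0)"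
    by (rule sum.cong) (auto simp: co_single[OF assms(2) x])
  finally show ?thesis by simp
next
  case False
  then show ?thesis using co_out assms by (cases "y = x") auto
qed

lemma carrier_proj:
  assumes "x \<in> V"
  shows "carrier (proj x) = {a \<in> carrier R. \<forall>y l. y \<noteq> x \<longrightarrow> co a y l = 0}"
proof (intro equalityI subsetI)
  fix a assume "a \<in> {a \<in> carrier R. \<forall>y l. y \<noteq> x \<longrightarrow> co a y l = 0}"
  then have a: "a \<in> carrier R" "\<And>y l. y \<noteq> x \<Longrightarrow> co a y l = 0" by auto
  have "a = a \<otimes> single 1 x 0"
    using a assms by (intro co_inj) (auto simp: co_mult_single fun_eq_iff)
  then show "a \<in> carrier (proj x)" using a by (auto simp: proj_def restrict_module_def)
qed (use assms in \<open>auto simp: proj_def restrict_module_def co_mult_single\<close>)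

lemma coord_proj:
  assumes x: "x \<in> V"
  shows "coord (proj x) x (L x) (\<lambda>a. co a x)"
proof -
  have sel: "\<zero>\<^bsub>proj x\<^esub> = \<zero>" "(\<oplus>\<^bsub>proj x\<^esub>) = (\<oplus>)" "(\<odot>\<^bsub>proj x\<^esub>) = (\<otimes>)"
    by (simp_all add: proj_def restrict_module_def regular_module_def)
  have "bij_betw (\<lambda>a. co a x) (carrier (proj x)) {f. \<forall>k\<ge>L x. f k = 0}"
    unfolding bij_betw_def
  proof
    show "inj_on (\<lambda>a. co a x) (carrier (proj x))"
    proof (rule inj_onI)
      fix a b assume ab: "a \<in> carrier (proj x)" "b \<in> carrier (proj x)" "co a x = co b x"
      have "co a y l = co b y l" for y l using ab by (cases "y = x") (auto simp: carrier_proj[OF x])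
      then show "a = b" using ab by (intro co_inj) (auto simp: carrier_proj[OF x] fun_eq_iff)
    qed
    show "(\<lambda>a. co a x) ` carrier (proj x) = {f. \<forall>k\<ge>L x. f k = 0}"
    proof (intro equalityI subsetI)
      fix f :: "nat \<Rightarrow> 'k" assume f: "f \<in> {f. \<forall>k\<ge>L x. f k = 0}"
      let ?a = "act_on_top x f"
      have "co ?a y l = 0" if "y \<noteq> x" for y l
        using that co_out[OF act_on_top(1)] unfolding act_on_top_def
        by (cases "y \<in> V \<and> l < L y") (auto simp: el)
      then have "?a \<in> carrier (proj x)" by (simp add: carrier_proj[OF x] act_on_top(1))
      moreover have "co ?a x = f"
      proof
        fix l show "co ?a x l = f l"
          using f x act_on_top(2) co_out[OF act_on_top(1)] by (cases "l < L x") auto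
      qed
      ultimately show "f \<in> (\<lambda>a. co a x) ` carrier (proj x)" by (metis imageI)
    qed (use co_out in \<open>auto simp: carrier_proj[OF x]\<close>)
  qed
  moreover have "r \<otimes> u \<in> carrier (proj x)" if ru: "r \<in> carrier R" "u \<in> carrier (proj x)" for r u
  proof -
    obtain a where "a \<in> carrier R" "u = a \<otimes> single 1 x 0"
      using ru by (auto simp: proj_def restrict_module_def)
    then have "r \<otimes> u = (r \<otimes> a) \<otimes> single 1 x 0" "r \<otimes> a \<in> carrier R" using ru by (auto simp: m_assoc)
    then show ?thesis by (auto simp: proj_def restrict_module_def)
  qed
  moreover have "\<zero> \<in> carrier (proj x)" "co \<zero> x = (\<lambda>_. 0)"
    by (auto simp: carrier_proj[OF x] co_zero)
  moreover have "u \<oplus> v \<in> carrier (proj x) \<and> co (u \<oplus> v) x = (\<lambda>k. co u x k + co v x k)"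
    if "u \<in> carrier (proj x)" "v \<in> carrier (proj x)" for u v
    using that by (auto simp: carrier_proj[OF x] co_add)
  moreover have "co (r \<otimes> u) x k = (\<Sum>i\<le>k. co r (sh x i) (k - i) * co u x i)"
    if "r \<in> carrier R" "u \<in> carrier (proj x)" "k < L x" for r u k
    using that x by (intro co_mult) (auto simp: carrier_proj[OF x])
  ultimately show ?thesis
    unfolding coord_def sel using x by blast
qed

section \<open>Simple modules and Weyl modules\<close>

definition simp_mod :: "'v \<Rightarrow> ('a, 'a set) module" where
  "simp_mod x = quot_module (proj x) (module_radical R (proj x))"

definition weyl :: "'v rel \<Rightarrow> 'v \<Rightarrow> ('a, 'a set) module" where
  "weyl r x = quot_module (proj x) (\<Inter>{U. submodule U R (proj x) \<and>
    (\<forall>y\<in>V. composition_factor R (quot_module (proj x) U) (simp_mod y) \<longrightarrow> (y, x) \<in> r)})"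

lemma coord_simp_mod: "x \<in> V \<Longrightarrow> \<exists>\<psi>. coord (simp_mod x) x 1 \<psi>"
  unfolding simp_mod_def using coord_radical[OF coord_proj] coord_quot[OF coord_proj] L_pos[of x] by auto

text \<open>Among the layers, exactly those of index at most \<open>D r x\<close> have the property
  defining the submodules to be intersected, so the intersection is the layer of that index.\<close>

lemma coord_weyl:
  assumes x: "x \<in> V"
  shows "\<exists>\<psi>. coord (weyl r x) x (D r x) \<psi>"
proof -
  note P = coord_proj[OF x]
  let ?lay = "lay (proj x) (\<lambda>a. co a x)"
  let ?U = "{U. submodule U R (proj x) \<and>
    (\<forall>y\<in>V. composition_factor R (quot_module (proj x) U) (simp_mod y) \<longrightarrow> (y, x) \<in> r)}"
  have cf: "(\<forall>y\<in>V. composition_factor R (quot_module (proj x) (?lay a)) (simp_mod y) \<longrightarrow> (y, x) \<in> r)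
      \<longleftrightarrow> a \<le> D r x" if a: "a \<le> L x" for a
  proof -
    obtain \<psi> where \<psi>: "coord (quot_module (proj x) (?lay a)) x a \<psi>" using coord_quot[OF P a] by blast
    have "(\<forall>y\<in>V. composition_factor R (quot_module (proj x) (?lay a)) (simp_mod y) \<longrightarrow> (y, x) \<in> r)
        \<longleftrightarrow> (\<forall>y\<in>V. (\<exists>k<a. sh x k = y) \<longrightarrow> (y, x) \<in> r)"
      using coord_composition_factor[OF \<psi>] coord_simp_mod by (metis (no_types))
    also have "\<dots> \<longleftrightarrow> (\<forall>k<a. (sh x k, x) \<in> r)" using sh_in[OF x] a by force
    also have "\<dots> \<longleftrightarrow> a \<le> D r x"
      using D_less D_stop[of r x] a by (meson leI le_less_trans less_le_trans not_le)
    finally show ?thesis .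
  qed
  have "\<Inter>?U = ?lay (D r x)"
  proof (intro equalityI)
    have "?lay (D r x) \<in> ?U" using cf[OF D_le] lay_submodule[OF P] by simp
    then show "\<Inter>?U \<subseteq> ?lay (D r x)" by blast
    show "?lay (D r x) \<subseteq> \<Inter>?U"
    proof (rule Inter_greatest)
      fix U assume U: "U \<in> ?U"
      then obtain a where a: "a \<le> L x" "U = ?lay a" using submodule_is_lay[OF P, of U] by blast
      then have "a \<le> D r x" using cf U by blast
      then show "?lay (D r x) \<subseteq> U" using a by (auto simp: lay_def)
    qed
  qed
  then show ?thesis unfolding weyl_def using coord_quot[OF P D_le] by simp
qed

end

section \<open>Hereditary algebras\<close>

lemma regular_module_sel:
  "carrier (restrict_module (regular_module R) N) = N"
  "\<zero>\<^bsub>restrict_module (regular_module R) N\<^esub> = \<zero>\<^bsub>R\<^esub>"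
  "x \<oplus>\<^bsub>restrict_module (regular_module R) N\<^esub> y = x \<oplus>\<^bsub>R\<^esub> y"
  "a \<odot>\<^bsub>restrict_module (regular_module R) N\<^esub> x = a \<otimes>\<^bsub>R\<^esub> x"
  "carrier (regular_module R) = carrier R"
  by (simp_all add: restrict_module_def regular_module_def)

lemma free_module_sel:
  "F \<in> carrier (free_module R B) \<longleftrightarrow> F \<in> B \<rightarrow>\<^sub>E carrier R \<and> finite {x \<in> B. F x \<noteq> \<zero>\<^bsub>R\<^esub>}"
  "F \<oplus>\<^bsub>free_module R B\<^esub> G = (\<lambda>b\<in>B. F b \<oplus>\<^bsub>R\<^esub> G b)"
  "a \<odot>\<^bsub>free_module R B\<^esub> F = (\<lambda>b\<in>B. a \<otimes>\<^bsub>R\<^esub> F b)"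
  by (simp_all add: free_module_def)

lemma submodule_regular_iff:
  fixes R (structure)
  assumes "ring R"
  shows "submodule N R (regular_module R) \<longleftrightarrow> N \<subseteq> carrier R \<and> \<zero>\<^bsub>R\<^esub> \<in> N \<and>
    (\<forall>a\<in>N. \<forall>b\<in>N. a \<oplus>\<^bsub>R\<^esub> b \<in> N) \<and> (\<forall>r\<in>carrier R. \<forall>a\<in>N. r \<otimes>\<^bsub>R\<^esub> a \<in> N)"
proof -
  interpret ring R by (rule assms)
  have inv: "inv\<^bsub>add_monoid (regular_module R)\<^esub> a = \<ominus> a" for a
    by (simp add: a_inv_def m_inv_def regular_module_def)
  have sel: "carrier (add_monoid (regular_module R)) = carrier R"
    "a \<otimes>\<^bsub>add_monoid (regular_module R)\<^esub> b = a \<oplus> b" "\<one>\<^bsub>add_monoid (regular_module R)\<^esub> = \<zero>"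
    "r \<odot>\<^bsub>regular_module R\<^esub> a = r \<otimes> a" for a b r
    by (simp_all add: regular_module_def)
  have sel2: "carrier (regular_module R) = carrier R" "\<zero>\<^bsub>regular_module R\<^esub> = \<zero>"
    "a \<oplus>\<^bsub>regular_module R\<^esub> b = a \<oplus> b" for a b
    by (simp_all add: regular_module_def)
  show ?thesis
  proof
    assume "submodule N R (regular_module R)"
    then interpret N: submodule N R "regular_module R" .
    show "N \<subseteq> carrier R \<and> \<zero> \<in> N \<and> (\<forall>a\<in>N. \<forall>b\<in>N. a \<oplus> b \<in> N) \<and> (\<forall>r\<in>carrier R. \<forall>a\<in>N. r \<otimes> a \<in> N)"
    proof (intro conjI ballI)
      show "N \<subseteq> carrier R" using N.subset unfolding sel .
      show "\<zero> \<in> N" using N.one_closed unfolding sel .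
      show "a \<oplus> b \<in> N" if "a \<in> N" "b \<in> N" for a b using N.m_closed[OF that] unfolding sel .
      show "r \<otimes> a \<in> N" if "r \<in> carrier R" "a \<in> N" for r a
        using N.smult_closed[OF that] unfolding sel .
    qed
  next
    assume N: "N \<subseteq> carrier R \<and> \<zero> \<in> N \<and> (\<forall>a\<in>N. \<forall>b\<in>N. a \<oplus> b \<in> N) \<and> (\<forall>r\<in>carrier R. \<forall>a\<in>N. r \<otimes> a \<in> N)"
    have neg: "\<ominus> a \<in> N" if a: "a \<in> N" for a
    proof -
      have "\<ominus> a = (\<ominus> \<one>) \<otimes> a" using N a by (metis l_minus l_one one_closed subsetD)
      then show ?thesis using N a by simp
    qed
    show "submodule N R (regular_module R)"
    proof (intro submodule.intro subgroup.intro submodule_axioms.intro)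
      fix a assume "a \<in> N"
      then show "inv\<^bsub>add_monoid (regular_module R)\<^esub> a \<in> N" unfolding inv by (rule neg)
    qed (use N in \<open>auto simp: sel2 sel(4)\<close>)
  qed
qed

context path_basis
begin

abbreviation left_ideal_module :: "'a set \<Rightarrow> ('a, 'a) module" where
  "left_ideal_module N \<equiv> restrict_module (regular_module R) N"

lemma co_minus: "a \<in> carrier R \<Longrightarrow> co (\<ominus> a) y l = - co a y l"
  using co_add[of a "\<ominus> a" y l] co_zero[of y l] by (simp add: r_neg eq_neg_iff_add_eq_0 add.commute)

text \<open>The radical of \<open>P(x)\<close> is a proper quotient of its projective cover \<open>P(nx x)\<close>, hence not projective.\<close>

lemma relation_at_not_hereditary:
  assumes rel: "relation_at x"
  shows "\<not> hereditary R"
proof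
  assume her: "hereditary R"
  have x: "x \<in> V" "2 \<le> L x" "nx x \<in> V" "L x \<le> L (nx x)" using rel by (auto simp: relation_at_def)
  \<comment> \<open>The radical of P(x), as a left ideal.\<close>
  define N where "N = {a \<in> carrier R. (\<forall>y l. y \<noteq> x \<longrightarrow> co a y l = 0) \<and> co a x 0 = 0}"
  have "submodule N R (regular_module R)"
    unfolding submodule_regular_iff[OF ring_axioms]
  proof (intro conjI ballI)
    fix r a assume r: "r \<in> carrier R" and a: "a \<in> N"
    have "co (r \<otimes> a) y l = 0" if "y \<noteq> x \<or> l = 0" for y l
    proof (cases "y \<in> V \<and> l < L y")
      case True
      then show ?thesis using co_mult[of r a y l] r a that by (auto simp: N_def)
    qed (use r a co_out in \<open>auto simp: N_def\<close>)
    then show "r \<otimes> a \<in> N" using r a by (auto simp: N_def)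
  qed (auto simp: N_def co_zero co_add)
  then have "projective_module R (left_ideal_module N)" using her by (simp add: hereditary_def)
  then obtain B s p where s: "s \<in> mod_hom R (left_ideal_module N) (free_module R (B :: 'a set))"
    and p: "p \<in> mod_hom R (free_module R B) (left_ideal_module N)"
    and ps: "\<And>a. a \<in> N \<Longrightarrow> p (s a) = a"
    by (auto simp: projective_module_def regular_module_sel)
  define g where "g = single 1 x 1"
  have co_g: "co g y l = (if y = x \<and> l = 1 then 1 else 0)" for y l
    unfolding g_def using x by (intro co_single) auto
  have g: "g \<in> N" "g \<in> carrier R" by (auto simp: N_def co_g) (simp_all add: g_def)
  \<comment> \<open>\<open>w\<close> is nonzero because \<open>L x - 1 < L (nx x)\<close>, yet it
    annihilates the arrow \<open>g\<close>, the path with \<open>L x\<close> arrows from x being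
    zero.\<close>
  define w where "w = single 1 (nx x) (L x - 1)"
  have w: "w \<in> carrier R" by (simp add: w_def)
  have co_w: "co w y l = (if y = nx x \<and> l = L x - 1 then 1 else 0)" for y l
    unfolding w_def using x by (intro co_single) auto
  have wg: "w \<otimes> g = \<zero>"
  proof (rule co_inj)
    have "co (w \<otimes> g) y l = 0" for y l
    proof (cases "y \<in> V \<and> l < L y")
      case True
      have "co w (sh y i) (l - i) * co g y i = 0" if "i \<le> l" for i
        using True that x by (auto simp: co_w co_g)
      then have "(\<Sum>i\<le>l. co w (sh y i) (l - i) * co g y i) = 0" by (intro sum.neutral) blast
      then show ?thesis using co_mult[OF w g(2), of y l] True by simp
    qed (use co_out w g in auto)
    then show "co (w \<otimes> g) = co \<zero>" by (auto simp: fun_eq_iff co_zero)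
  qed (use w g in auto)
  have F: "s g \<in> carrier (free_module R B)" using s g by (auto simp: mod_hom_def regular_module_sel)
  \<comment> \<open>\<open>w\<close> annihilates \<open>s g\<close> too, and at depth
    \<open>L x - 1\<close> a product with \<open>w\<close> shows just the coefficient at the trivial
    path of \<open>nx x\<close>.\<close>
  have top0: "co (s g b) (nx x) 0 = 0" if b: "b \<in> B" for b
  proof -
    have "s g b \<in> carrier R" using F b by (auto simp: free_module_sel)
    have z: "\<zero> \<in> N" by (simp add: N_def co_zero)
    have zz: "s \<zero> b = \<zero>"
    proof -
      have "s \<zero> \<in> carrier (free_module R B)" using s z by (auto simp: mod_hom_def regular_module_sel)
      then have in': "s \<zero> b \<in> carrier R" using b by (auto simp: free_module_sel)
      have "s (\<zero> \<otimes> \<zero>) = \<zero> \<odot>\<^bsub>free_module R B\<^esub> s \<zero>"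
        using s z zero_closed unfolding mod_hom_def regular_module_sel by blast
      from fun_cong[OF this, of b] have "s \<zero> b = \<zero> \<otimes> s \<zero> b" using b by (simp add: free_module_sel)
      also have "\<dots> = \<zero>" using in' by (rule l_null)
      finally show ?thesis .
    qed
    have "s (w \<otimes> g) = w \<odot>\<^bsub>free_module R B\<^esub> s g"
      using s w g by (auto simp: mod_hom_def regular_module_sel)
    then have "w \<otimes> s g b = \<zero>" using b zz wg by (simp add: free_module_sel)
    then have "co (w \<otimes> s g b) (nx x) (L x - 1) = 0" by (simp add: co_zero)
    also have "co (w \<otimes> s g b) (nx x) (L x - 1) =
        (\<Sum>i\<le>L x - 1. co w (sh (nx x) i) (L x - 1 - i) * co (s g b) (nx x) i)"
      using w \<open>s g b \<in> carrier R\<close> x by (intro co_mult) auto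
    also have "\<dots> = (\<Sum>i\<le>L x - 1. if i = 0 then co (s g b) (nx x) 0 else 0)"
      by (rule sum.cong) (auto simp: co_w)
    finally show ?thesis by simp
  qed
  \<comment> \<open>\<open>p\<close> maps the basis of the free module into the radical, so the
    arrow at x can only come from coefficients at the trivial path of \<open>nx x\<close>. In
    \<open>s g\<close> these vanish, whereas \<open>p (s g)\<close> is that arrow.\<close>
  have "co (p H) x 1 = 0"
    if "finite C" "H \<in> carrier (free_module R B)" "{b \<in> B. H b \<noteq> \<zero>} = C" "\<forall>b\<in>B. co (H b) (nx x) 0 = 0" for C H
    using that
  proof (induction C arbitrary: H rule: finite_induct)
    case empty
    have "\<zero> \<odot>\<^bsub>free_module R B\<^esub> H = H"
    proof
      fix b show "(\<zero> \<odot>\<^bsub>free_module R B\<^esub> H) b = H b"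
        using empty.prems by (auto simp: free_module_sel restrict_def PiE_def extensional_def)
    qed
    moreover have "p (\<zero> \<odot>\<^bsub>free_module R B\<^esub> H) = \<zero> \<otimes> p H"
      using p empty.prems by (auto simp: mod_hom_def regular_module_sel)
    moreover have "p H \<in> carrier R" using p empty.prems by (auto simp: mod_hom_def regular_module_sel N_def)
    ultimately have "p H = \<zero>" by simp
    then show ?case by (simp add: co_zero)
  next
    case (insert b C)
    have b: "b \<in> B" "b \<notin> C" using insert by auto
    have Hin: "H z \<in> carrier R" if "z \<in> B" for z using insert.prems that by (auto simp: free_module_sel)
    define G where "G = (\<lambda>z\<in>B. if z = b then \<zero> else H z)"
    define E where "E = (\<lambda>z\<in>B. if z = b then \<one> else \<zero>)"
    have E: "E \<in> carrier (free_module R B)"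
    proof -
      have "finite {z \<in> B. E z \<noteq> \<zero>}" by (rule finite_subset[of _ "{b}"]) (auto simp: E_def)
      then show ?thesis by (auto simp: free_module_sel E_def)
    qed
    have supp: "{z \<in> B. G z \<noteq> \<zero>} = C" using insert.prems(2) insert.hyps(2) by (auto simp: G_def)
    have G: "G \<in> carrier (free_module R B)"
      unfolding free_module_sel supp using insert.hyps(1) Hin by (auto simp: G_def)
    have HbE: "H b \<odot>\<^bsub>free_module R B\<^esub> E \<in> carrier (free_module R B)"
    proof -
      have "finite {z \<in> B. (H b \<odot>\<^bsub>free_module R B\<^esub> E) z \<noteq> \<zero>}"
        by (rule finite_subset[of _ "{b}"]) (use Hin b in \<open>auto simp: E_def free_module_sel\<close>)
      then show ?thesis using Hin b by (auto simp: free_module_sel E_def)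
    qed
    have "H = G \<oplus>\<^bsub>free_module R B\<^esub> (H b \<odot>\<^bsub>free_module R B\<^esub> E)"
    proof
      fix z show "H z = (G \<oplus>\<^bsub>free_module R B\<^esub> (H b \<odot>\<^bsub>free_module R B\<^esub> E)) z"
        using insert.prems(1) Hin b
        by (cases "z \<in> B"; cases "z = b") (auto simp: free_module_sel G_def E_def PiE_def extensional_def)
    qed
    moreover have "p (G \<oplus>\<^bsub>free_module R B\<^esub> K) = p G \<oplus> p K" if "K \<in> carrier (free_module R B)" for K
      using p G that unfolding mod_hom_def regular_module_sel by blast
    ultimately have "p H = p G \<oplus> p (H b \<odot>\<^bsub>free_module R B\<^esub> E)"
      using HbE by metis
    moreover have "p (H b \<odot>\<^bsub>free_module R B\<^esub> E) = H b \<otimes> p E"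
      using p E Hin b by (auto simp: mod_hom_def regular_module_sel)
    ultimately have pH: "p H = p G \<oplus> H b \<otimes> p E" by simp
    have pin: "p E \<in> N" "p G \<in> N" using p E G by (auto simp: mod_hom_def regular_module_sel)
    have "co (p G) x 1 = 0"
      using insert.prems(3) by (intro insert.IH[OF G supp]) (auto simp: G_def co_zero)
    moreover have "co (H b \<otimes> p E) x 1 = (\<Sum>i\<le>1. co (H b) (sh x i) (1 - i) * co (p E) x i)"
      using pin x Hin b by (intro co_mult) (auto simp: N_def)
    then have "co (H b \<otimes> p E) x 1 = 0"
      using pin insert.prems(3) b by (simp add: N_def sh_1)
    ultimately show ?case unfolding pH using co_add[of "p G" "H b \<otimes> p E"] pin Hin b by (auto simp: N_def)
  qed
  from this[of _ "s g"] have "co (p (s g)) x 1 = 0" using F top0 by (auto simp: free_module_sel)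
  then show False using ps[OF g(1)] by (simp add: co_g)
qed

section \<open>Left ideals are projective when there are no minimal relations\<close>

definition splits_over :: "'a set \<Rightarrow> 'a set \<Rightarrow> bool" where
  "splits_over N B \<longleftrightarrow> (\<exists>s p. s \<in> mod_hom R (left_ideal_module N) (free_module R B) \<and>
    p \<in> mod_hom R (free_module R B) (left_ideal_module N) \<and> (\<forall>a\<in>N. p (s a) = a))"

text \<open>Splits off one generator: \<open>a\<close> goes to the pair of \<open>f a\<close> and
  the image of \<open>a \<ominus> f a \<otimes> g\<close> under the old map, and back by multiplying
  with \<open>g\<close> and adding. The generators serve as indices of the free module, as
  \<open>projective_module\<close> asks for, so \<open>g\<close> has to be new.\<close>

lemma splits_over_insert:
  assumes N: "submodule N R (regular_module R)" and N0: "N0 \<subseteq> N" "splits_over N0 B"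
    and B: "finite B" and g: "g \<in> N" "g \<notin> B"
    and f: "\<And>a. a \<in> N \<Longrightarrow> f a \<in> carrier R" "\<And>a b. a \<in> N \<Longrightarrow> b \<in> N \<Longrightarrow> f (a \<oplus> b) = f a \<oplus> f b"
      "\<And>r a. r \<in> carrier R \<Longrightarrow> a \<in> N \<Longrightarrow> f (r \<otimes> a) = r \<otimes> f a"
    and fg: "\<And>a. a \<in> N \<Longrightarrow> a \<ominus> f a \<otimes> g \<in> N0"
  shows "splits_over N (insert g B)"
proof -
  obtain s p where s: "s \<in> mod_hom R (left_ideal_module N0) (free_module R B)"
    and p: "p \<in> mod_hom R (free_module R B) (left_ideal_module N0)" and ps: "\<And>a. a \<in> N0 \<Longrightarrow> p (s a) = a"
    using N0(2) by (auto simp: splits_over_def)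
  have Nc: "a \<in> carrier R" if "a \<in> N" for a using N that by (auto simp: submodule_regular_iff[OF ring_axioms])
  have Nadd: "a \<oplus> b \<in> N" if "a \<in> N" "b \<in> N" for a b
    using N that by (auto simp: submodule_regular_iff[OF ring_axioms])
  have Nmult: "r \<otimes> a \<in> N" if "r \<in> carrier R" "a \<in> N" for r a
    using N that by (auto simp: submodule_regular_iff[OF ring_axioms])
  have gc: "g \<in> carrier R" using Nc g by blast
  have free: "F \<in> carrier (free_module R C) \<longleftrightarrow> F \<in> C \<rightarrow>\<^sub>E carrier R" if "finite C" for F and C :: "'a set"
    using that by (simp add: free_module_sel)
  define t where "t a = a \<ominus> f a \<otimes> g" for a
  have t: "t a \<in> N0" "t a \<in> carrier R" if "a \<in> N" for a using fg[OF that] N0(1) Nc by (auto simp: t_def)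
  have t_add: "t (a \<oplus> b) = t a \<oplus> t b" if "a \<in> N" "b \<in> N" for a b
    unfolding t_def f(2)[OF that] using Nc[OF that(1)] Nc[OF that(2)] f(1)[OF that(1)] f(1)[OF that(2)] gc
    by algebra
  have t_mult: "t (r \<otimes> a) = r \<otimes> t a" if "r \<in> carrier R" "a \<in> N" for r a
    unfolding t_def f(3)[OF that] using Nc[OF that(2)] f(1)[OF that(2)] gc that(1)
    by (simp add: minus_eq r_distr r_minus m_assoc)
  have st: "s (t a) \<in> B \<rightarrow>\<^sub>E carrier R" if "a \<in> N" for a
  proof -
    have "s (t a) \<in> carrier (free_module R B)"
      using s t(1)[OF that] by (auto simp: mod_hom_def regular_module_sel)
    then show ?thesis by (simp add: free[OF B])
  qed
  have s_add: "s (t (a \<oplus> b)) = (\<lambda>z\<in>B. s (t a) z \<oplus> s (t b) z)" if "a \<in> N" "b \<in> N" for a b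
    unfolding t_add[OF that] using s t(1)[OF that(1)] t(1)[OF that(2)]
    by (auto simp: mod_hom_def regular_module_sel free_module_sel)
  have s_mult: "s (t (r \<otimes> a)) = (\<lambda>z\<in>B. r \<otimes> s (t a) z)" if "r \<in> carrier R" "a \<in> N" for r a
    unfolding t_mult[OF that] using s t(1)[OF that(2)] that(1)
    by (auto simp: mod_hom_def regular_module_sel free_module_sel)
  define s' where "s' a = (\<lambda>z\<in>insert g B. if z = g then f a else s (t a) z)" for a
  define p' where "p' F = F g \<otimes> g \<oplus> p (restrict F B)" for F
  have B': "finite (insert g B)" using B by simp
  have s': "s' \<in> mod_hom R (left_ideal_module N) (free_module R (insert g B))"
    unfolding mod_hom_def
  proof (intro CollectI conjI ballI funcsetI)
    fix a assume "a \<in> carrier (left_ideal_module N)"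
    then have a: "a \<in> N" by (simp add: regular_module_sel)
    show "s' a \<in> carrier (free_module R (insert g B))"
      unfolding free[OF B'] s'_def using st[OF a] f(1)[OF a] by (auto split: if_splits)
    {
      fix b assume "b \<in> carrier (left_ideal_module N)"
      then have b: "b \<in> N" by (simp add: regular_module_sel)
      show "s' (a \<oplus>\<^bsub>left_ideal_module N\<^esub> b) = s' a \<oplus>\<^bsub>free_module R (insert g B)\<^esub> s' b"
        unfolding regular_module_sel free_module_sel
        by (rule ext) (use g(2) in \<open>auto simp: s'_def f(2)[OF a b] s_add[OF a b]\<close>)
    }
    fix r assume r: "r \<in> carrier R"
    show "s' (r \<odot>\<^bsub>left_ideal_module N\<^esub> a) = r \<odot>\<^bsub>free_module R (insert g B)\<^esub> s' a"
      unfolding regular_module_sel free_module_sel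
      by (rule ext) (use g(2) in \<open>auto simp: s'_def f(3)[OF r a] s_mult[OF r a]\<close>)
  qed
  have rest: "restrict F B \<in> carrier (free_module R B)" "F g \<in> carrier R"
    if "F \<in> carrier (free_module R (insert g B))" for F
    using that by (auto simp: free[OF B] free[OF B'])
  have pN: "p F \<in> N0" "p F \<in> carrier R" if "F \<in> carrier (free_module R B)" for F
    using p that N0(1) Nc by (auto simp: mod_hom_def regular_module_sel)
  have p_add: "p (F \<oplus>\<^bsub>free_module R B\<^esub> G) = p F \<oplus> p G"
    if "F \<in> carrier (free_module R B)" "G \<in> carrier (free_module R B)" for F G
    using p that by (auto simp: mod_hom_def regular_module_sel)
  have p_mult: "p (r \<odot>\<^bsub>free_module R B\<^esub> F) = r \<otimes> p F"
    if "r \<in> carrier R" "F \<in> carrier (free_module R B)" for r F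
    using p that by (auto simp: mod_hom_def regular_module_sel)
  have p': "p' \<in> mod_hom R (free_module R (insert g B)) (left_ideal_module N)"
    unfolding mod_hom_def
  proof (intro CollectI conjI ballI funcsetI)
    fix F assume F: "F \<in> carrier (free_module R (insert g B))"
    show "p' F \<in> carrier (left_ideal_module N)"
      unfolding regular_module_sel p'_def using pN(1)[OF rest(1)[OF F]] rest(2)[OF F] g(1) N0(1)
      by (intro Nadd Nmult) auto
    {
      fix G assume G: "G \<in> carrier (free_module R (insert g B))"
      have "restrict (F \<oplus>\<^bsub>free_module R (insert g B)\<^esub> G) B = restrict F B \<oplus>\<^bsub>free_module R B\<^esub> restrict G B"
        unfolding free_module_sel by (rule ext) auto
      moreover have "(F \<oplus>\<^bsub>free_module R (insert g B)\<^esub> G) g = F g \<oplus> G g" by (simp add: free_module_sel)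
      moreover have "(F g \<oplus> G g) \<otimes> g \<oplus> (p (restrict F B) \<oplus> p (restrict G B)) =
          (F g \<otimes> g \<oplus> p (restrict F B)) \<oplus> (G g \<otimes> g \<oplus> p (restrict G B))"
        using rest(2)[OF F] rest(2)[OF G] gc pN(2)[OF rest(1)[OF F]] pN(2)[OF rest(1)[OF G]]
        by (simp add: l_distr a_ac)
      ultimately show "p' (F \<oplus>\<^bsub>free_module R (insert g B)\<^esub> G) = p' F \<oplus>\<^bsub>left_ideal_module N\<^esub> p' G"
        unfolding regular_module_sel p'_def by (simp add: p_add[OF rest(1)[OF F] rest(1)[OF G]])
    }
    fix r assume r: "r \<in> carrier R"
    have "restrict (r \<odot>\<^bsub>free_module R (insert g B)\<^esub> F) B = r \<odot>\<^bsub>free_module R B\<^esub> restrict F B"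
      unfolding free_module_sel by (rule ext) auto
    moreover have "(r \<odot>\<^bsub>free_module R (insert g B)\<^esub> F) g = r \<otimes> F g" by (simp add: free_module_sel)
    moreover have "(r \<otimes> F g) \<otimes> g \<oplus> r \<otimes> p (restrict F B) = r \<otimes> (F g \<otimes> g \<oplus> p (restrict F B))"
      using rest(2)[OF F] gc pN(2)[OF rest(1)[OF F]] r by (simp add: r_distr m_assoc)
    ultimately show "p' (r \<odot>\<^bsub>free_module R (insert g B)\<^esub> F) = r \<odot>\<^bsub>left_ideal_module N\<^esub> p' F"
      unfolding regular_module_sel p'_def by (simp add: p_mult[OF r rest(1)[OF F]])
  qed
  have "p' (s' a) = a" if a: "a \<in> N" for a
  proof -
    have "restrict (s' a) B = s (t a)"
    proof
      fix z show "restrict (s' a) B z = s (t a) z"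
        using st[OF a] g(2) by (auto simp: s'_def restrict_def PiE_def extensional_def)
    qed
    then have "p' (s' a) = f a \<otimes> g \<oplus> t a" using ps[OF t(1)[OF a]] by (simp add: p'_def s'_def)
    also have "\<dots> = a" unfolding t_def using f(1)[OF a] gc Nc[OF a] by (simp add: minus_eq a_lcomm r_neg)
    finally show ?thesis .
  qed
  then show ?thesis unfolding splits_over_def using s' p' by blast
qed

lemma no_relation_hereditary:
  assumes nr: "\<And>x. \<not> relation_at x"
  shows "hereditary R"
  unfolding hereditary_def
proof (intro allI impI)
  fix N assume "submodule N R (regular_module R)"
  then have N: "N \<subseteq> carrier R" "\<zero> \<in> N" "\<And>a b. a \<in> N \<Longrightarrow> b \<in> N \<Longrightarrow> a \<oplus> b \<in> N"
    "\<And>r a. r \<in> carrier R \<Longrightarrow> a \<in> N \<Longrightarrow> r \<otimes> a \<in> N"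
    by (auto simp: submodule_regular_iff[OF ring_axioms])
  define NS where "NS S = {a \<in> N. \<forall>y l. y \<notin> S \<longrightarrow> co a y l = 0}" for S
  have NSc: "a \<in> carrier R" if "a \<in> NS S" for a S using that N(1) by (auto simp: NS_def)
  have NSmult: "r \<otimes> a \<in> NS S" if r: "r \<in> carrier R" and a: "a \<in> NS S" for r a S
  proof -
    have "co (r \<otimes> a) y l = 0" if "y \<notin> S" for y l
    proof (cases "y \<in> V \<and> l < L y")
      case True
      then show ?thesis using co_mult[OF r NSc[OF a], of y l] a that by (simp add: NS_def)
    qed (use co_out r NSc[OF a] in auto)
    then show ?thesis using a r N by (auto simp: NS_def)
  qed
  have NSadd: "a \<oplus> b \<in> NS S" if "a \<in> NS S" "b \<in> NS S" for a b S
    using that N NSc[OF that(1)] NSc[OF that(2)] by (auto simp: NS_def co_add)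
  have NSsub: "submodule (NS S) R (regular_module R)" for S
    unfolding submodule_regular_iff[OF ring_axioms]
    using NSc NSadd NSmult N by (auto simp: NS_def co_zero)
  have NSminus: "\<ominus> a \<in> NS S" if "a \<in> NS S" for a S
  proof -
    have "\<ominus> a = (\<ominus> \<one>) \<otimes> a" using NSc[OF that] by (simp add: l_minus)
    then show ?thesis using NSmult[OF _ that] by simp
  qed
  have "\<exists>B. finite B \<and> B \<subseteq> NS S \<and> splits_over (NS S) B" if "finite S" "S \<subseteq> V" for S
    using that
  proof (induction S rule: finite_induct)
    case empty
    have NS0: "NS {} = {\<zero>}"
    proof -
      have "a = \<zero>" if "a \<in> NS {}" for a
        using that NSc[OF that] by (intro co_inj) (auto simp: NS_def fun_eq_iff co_zero)
      then show ?thesis using N(2) by (auto simp: NS_def co_zero)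
    qed
    have "splits_over (NS {}) {}"
      unfolding splits_over_def NS0
      by (intro exI[of _ "\<lambda>a. \<lambda>b\<in>{}. undefined"] exI[of _ "\<lambda>_. \<zero>"])
        (auto simp: mod_hom_def regular_module_sel free_module_sel)
    then show ?case by blast
  next
    case (insert x S)
    then obtain B where B: "finite B" "B \<subseteq> NS S" "splits_over (NS S) B" by auto
    have x: "x \<in> V" using insert.prems by simp
    have sub: "NS S \<subseteq> NS (insert x S)" by (auto simp: NS_def)
    note P = coord_proj[OF x]
    \<comment> \<open>Image of the ideal under the projection to P(x); being a submodule, it is a
      layer.\<close>
    define H where "H = (\<lambda>a. a \<otimes> single 1 x 0) ` NS (insert x S)"
    have Psel: "\<zero>\<^bsub>proj x\<^esub> = \<zero>" "a \<oplus>\<^bsub>proj x\<^esub> b = a \<oplus> b" "r \<odot>\<^bsub>proj x\<^esub> a = r \<otimes> a" for a b r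
      by (simp_all add: proj_def restrict_module_def regular_module_def)
    have "submodule H R (proj x)"
    proof (rule submoduleI'[OF P])
      show HP: "H \<subseteq> carrier (proj x)"
        using NSc by (auto simp: H_def proj_def restrict_module_def)
      have "\<zero> \<otimes> single 1 x 0 \<in> H" unfolding H_def using N(2) by (intro imageI) (simp add: NS_def co_zero)
      then show "\<zero>\<^bsub>proj x\<^esub> \<in> H" by (simp add: Psel)
      fix u assume u: "u \<in> H"
      then obtain a where a: "a \<in> NS (insert x S)" "u = a \<otimes> single 1 x 0" by (auto simp: H_def)
      show "r \<odot>\<^bsub>proj x\<^esub> u \<in> H" if "r \<in> carrier R" for r
        unfolding Psel H_def using a NSc[OF a(1)] NSmult[OF that a(1)] that
        by (intro image_eqI[of _ _ "r \<otimes> a"]) (auto simp: m_assoc)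
      show "u \<oplus>\<^bsub>proj x\<^esub> v \<in> H" if "v \<in> H" for v
      proof -
        obtain b where b: "b \<in> NS (insert x S)" "v = b \<otimes> single 1 x 0" using \<open>v \<in> H\<close> by (auto simp: H_def)
        show ?thesis unfolding Psel H_def using a b NSc[OF a(1)] NSc[OF b(1)] NSadd[OF a(1) b(1)]
          by (intro image_eqI[of _ _ "a \<oplus> b"]) (auto simp: l_distr)
      qed
      have uP: "u \<in> carrier (proj x)" "u \<in> carrier R" using u HP by (auto simp: carrier_proj[OF x])
      have mu: "\<ominus> u \<in> carrier (proj x)" using uP by (simp add: carrier_proj[OF x] co_minus)
      have "\<ominus>\<^bsub>proj x\<^esub> u = \<ominus> u"
        using uP by (intro coord_inj[OF P coord_minus(1)[OF P uP(1)] mu])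
          (simp add: coord_minus(2)[OF P uP(1)] co_minus)
      moreover have "\<ominus> u = (\<ominus> a) \<otimes> single 1 x 0" using a NSc[OF a(1)] by (simp add: l_minus)
      ultimately show "\<ominus>\<^bsub>proj x\<^esub> u \<in> H" unfolding H_def using NSminus[OF a(1)] by simp
    qed
    then obtain d where d: "d \<le> L x" "H = lay (proj x) (\<lambda>a. co a x) d"
      using submodule_is_lay[OF P] by blast
    have low: "co a x k = 0" if "a \<in> NS (insert x S)" "k < d" for a k
    proof -
      have "a \<otimes> single 1 x 0 \<in> lay (proj x) (\<lambda>a. co a x) d" using d(2) that(1) by (auto simp: H_def)
      then show ?thesis using that(2) co_mult_single[OF NSc[OF that(1)] x, of x k] by (simp add: lay_def)
    qed
    show ?case
    proof (cases "d = L x")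
      case True
      have "co a x k = 0" if "a \<in> NS (insert x S)" for a k
        using low[OF that] co_out[OF NSc[OF that], of x k] True by (cases "k < L x") auto
      then have "NS (insert x S) = NS S" by (fastforce simp: NS_def)
      then show ?thesis using B by auto
    next
      case False
      then have dL: "d < L x" using d by simp
      obtain u where u: "u \<in> carrier (proj x)" "\<forall>k<L x. co u x k = (if k = d then 1 else 0)"
        using coord_surj[OF P, of "\<lambda>k. if k = d then 1 else 0"] by blast
      have "u \<in> H" unfolding d(2) lay_def using u dL by auto
      then obtain g where g: "g \<in> NS (insert x S)" "u = g \<otimes> single 1 x 0" by (auto simp: H_def)
      have co_g: "co g x k = (if k = d then 1 else 0)" if "k < L x" for k
        using u(2) that co_mult_single[OF NSc[OF g(1)] x, of x k] g(2) by simp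
      have gB: "g \<notin> B"
      proof
        assume "g \<in> B"
        then have "co g x d = 0" using B(2) insert.hyps(2) by (auto simp: NS_def)
        then show False using co_g[OF dL] by simp
      qed
      let ?y = "sh x d"
      have y: "?y \<in> V" "L ?y + d = L x" using sh_in[OF x dL] L_sh_eq[OF _ x dL] nr by auto
      \<comment> \<open>Identifies the layer \<open>H\<close> with P(\<open>?y\<close>) inside the
        algebra by shifting coordinates by d. The lengths match because of
        \<open>L ?y + d = L x\<close>, which is where the absence of relations enters.\<close>
      define f where "f a = el (\<lambda>z k. if z = ?y then co a x (k + d) else 0)" for a
      have f: "f a \<in> carrier R" for a by (simp add: f_def el)
      have co_f: "co (f a) z k = (if z = ?y then co a x (k + d) else 0)" if "a \<in> carrier R" for a z k
      proof (cases "z \<in> V \<and> k < L z")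
        case False
        then show ?thesis using co_out[OF f False] co_out[OF that, of x "k + d"] y by auto
      qed (simp add: f_def el)
      have "splits_over (NS (insert x S)) (insert g B)"
      proof (rule splits_over_insert[OF NSsub sub B(3,1) g(1) gB f])
        fix a b assume "a \<in> NS (insert x S)" "b \<in> NS (insert x S)"
        then have ab: "a \<in> carrier R" "b \<in> carrier R" using NSc by auto
        then show "f (a \<oplus> b) = f a \<oplus> f b"
          using f by (intro co_inj) (auto simp: fun_eq_iff co_add co_f)
      next
        fix r a assume r: "r \<in> carrier R" and a': "a \<in> NS (insert x S)"
        then have a: "a \<in> carrier R" using NSc by auto
        have "co (f (r \<otimes> a)) z k = co (r \<otimes> f a) z k" for z k
        proof (cases "z \<in> V \<and> k < L z")
          case True
          have rhs: "co (r \<otimes> f a) z k = (\<Sum>i\<le>k. co r (sh z i) (k - i) * co (f a) z i)"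
            using True r f by (intro co_mult) auto
          show ?thesis
          proof (cases "z = ?y")
            case z: True
            then have kd: "k + d < L x" using True y by simp
            have "co (f (r \<otimes> a)) z k = co (r \<otimes> a) x (k + d)" using z r a by (simp add: co_f)
            also have "\<dots> = (\<Sum>i\<le>k + d. co r (sh x i) (k + d - i) * co a x i)"
              using r a x kd by (intro co_mult) auto
            also have "\<dots> = (\<Sum>i\<in>{0 + d..k + d}. co r (sh x i) (k + d - i) * co a x i)"
              by (rule sum.mono_neutral_right) (use low[OF a'] in auto)
            also have "\<dots> = (\<Sum>i\<in>{0..k}. co r (sh x (i + d)) (k + d - (i + d)) * co a x (i + d))"
              by (rule sum.shift_bounds_cl_nat_ivl)
            also have "\<dots> = co (r \<otimes> f a) z k"
              unfolding rhs using z a by (simp add: co_f sh_add atMost_atLeast0 add.commute)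
            finally show ?thesis .
          next
            case z: False
            then show ?thesis unfolding rhs using r a by (simp add: co_f)
          qed
        qed (use co_out f r in auto)
        then show "f (r \<otimes> a) = r \<otimes> f a" using r f by (intro co_inj) (auto simp: fun_eq_iff)
      next
        fix a assume a': "a \<in> NS (insert x S)"
        then have a: "a \<in> carrier R" and gc: "g \<in> carrier R" using NSc g(1) by auto
        have "f a \<otimes> g \<in> NS (insert x S)" using NSmult[OF f g(1)] .
        then have in': "a \<ominus> f a \<otimes> g \<in> NS (insert x S)"
          unfolding minus_eq using NSadd[OF a' NSminus] by blast
        have "co (a \<ominus> f a \<otimes> g) x k = 0" for k
        proof (cases "k < L x \<and> d \<le> k")
          case True
          \<comment> \<open>Among the paths from x, \<open>g\<close> involves only the one of depth
            d, with coefficient 1, so \<open>f a \<otimes> g\<close> reproduces the coefficients of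
            \<open>a\<close> at x.\<close>
          have "co (f a \<otimes> g) x k = (\<Sum>i\<le>k. co (f a) (sh x i) (k - i) * co g x i)"
            using True x f gc by (intro co_mult) auto
          also have "\<dots> = (\<Sum>i\<le>k. if i = d then co a x k else 0)"
            by (rule sum.cong) (use True a in \<open>auto simp: co_g co_f\<close>)
          finally have "co (f a \<otimes> g) x k = co a x k" using True by simp
          then show ?thesis using a f gc by (simp add: minus_eq co_add co_minus)
        next
          case False
          then show ?thesis using low[OF in'] co_out[OF NSc[OF in'], of x k] by force
        qed
        then have "co (a \<ominus> f a \<otimes> g) z k = 0" if "z \<notin> S" for z k
          using in' that by (cases "z = x") (auto simp: NS_def)
        then show "a \<ominus> f a \<otimes> g \<in> NS S" using in' by (auto simp: NS_def)
      qed
      then show ?thesis using B g(1) sub by (intro exI[of _ "insert g B"]) auto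
    qed
  qed
  from this[OF finite_V order_refl] obtain B where B: "splits_over (NS V) B" by blast
  have "co a y l = 0" if "a \<in> N" "y \<notin> V" for a y l
    using that N(1) by (intro co_out) auto
  then have NSV: "NS V = N" unfolding NS_def by blast
  show "projective_module R (left_ideal_module N)"
    unfolding projective_module_def regular_module_sel
    by (rule exI[of _ B]) (use B in \<open>simp add: splits_over_def NSV\<close>)
qed

lemma hereditary_iff: "hereditary R \<longleftrightarrow> (\<forall>x. \<not> relation_at x)"
  using relation_at_not_hereditary no_relation_hereditary by blast

end

section \<open>Path algebras of quivers with at most one arrow out of each vertex\<close>

text \<open>Arrows are named by their tails, so at most one leaves each vertex; both quivers of the
  theorem are of this kind.\<close>

locale succ_quiver =
  fixes Q :: "('v, 'v) pre_digraph"
  assumes finite_verts: "finite (verts Q)"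
    and arcs_verts: "a \<in> arcs Q \<Longrightarrow> a \<in> verts Q"
    and tail_id: "tail Q a = a"
    and head_verts: "a \<in> arcs Q \<Longrightarrow> head Q a \<in> verts Q"
begin

abbreviation PA :: "(('v, 'v) path \<Rightarrow> 'k::field) ring" where "PA \<equiv> path_algebra Q"

definition st :: "'v \<Rightarrow> nat \<Rightarrow> 'v" where "st x k = (head Q ^^ k) x"

definition pth :: "'v \<Rightarrow> nat \<Rightarrow> ('v, 'v) path" where "pth x l = (x, map (st x) [0..<l])"

text \<open>\<open>st\<close> runs on where the arrows end, so \<open>pth\<close> alone need not be
  a path of the quiver.\<close>

definition valid :: "'v \<Rightarrow> nat \<Rightarrow> bool" where
  "valid x l \<longleftrightarrow> x \<in> verts Q \<and> (\<forall>i<l. st x i \<in> arcs Q)"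

lemma st_0 [simp]: "st x 0 = x" by (simp add: st_def)

lemma st_Suc: "st x (Suc k) = head Q (st x k)" by (simp add: st_def)

lemma st_add: "st (st x k) l = st x (k + l)"
  by (simp add: st_def funpow_add add.commute[of k])

lemma st_head: "st (head Q x) k = st x (Suc k)"
  by (simp add: st_def funpow_swap1)

lemma st_head_fun: "st (head Q x) = (\<lambda>k. st x (Suc k))"
  by (simp add: fun_eq_iff st_head)

lemma pth_inj [simp]: "pth x l = pth y m \<longleftrightarrow> x = y \<and> l = m"
proof -
  have "length (snd (pth x l)) = l" for x l by (simp add: pth_def)
  then show ?thesis by (metis fst_conv pth_def)
qed

lemma map_st_Suc: "map (st x) [0..<Suc l] = x # map (st (head Q x)) [0..<l]"
  by (simp add: upt_conv_Cons map_Suc_upt[symmetric] st_head comp_def del: upt_Suc)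

lemma cas_iff: "pre_digraph.cas Q u as v \<longleftrightarrow> as = map (st u) [0..<length as] \<and> v = st u (length as)"
proof (induction as arbitrary: u)
  case (Cons a as)
  show ?case
    using Cons[of "head Q u"]
    by (auto simp: pre_digraph.cas.simps tail_id map_st_Suc st_head_fun simp del: upt_Suc)
qed (simp add: pre_digraph.cas.simps eq_commute)

lemma paths_iff: "p \<in> paths Q \<longleftrightarrow> (\<exists>x l. p = pth x l \<and> valid x l)"
proof
  assume "p \<in> paths Q"
  then obtain v where "pre_digraph.awalk Q (fst p) (snd p) v" by (auto simp: paths_def)
  then have "fst p \<in> verts Q" "set (snd p) \<subseteq> arcs Q" "snd p = map (st (fst p)) [0..<length (snd p)]"
    by (auto simp: pre_digraph.awalk_def cas_iff)
  moreover from this have "st (fst p) i \<in> arcs Q" if "i < length (snd p)" for i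
    using that by (metis (no_types, lifting) add_0 diff_zero nth_map_upt nth_mem subsetD)
  ultimately have "p = pth (fst p) (length (snd p)) \<and> valid (fst p) (length (snd p))"
    by (simp add: pth_def valid_def prod_eq_iff)
  then show "\<exists>x l. p = pth x l \<and> valid x l" by blast
next
  assume "\<exists>x l. p = pth x l \<and> valid x l"
  then show "p \<in> paths Q"
    by (auto simp: paths_def pth_def valid_def pre_digraph.awalk_def cas_iff)
qed

lemma path_end_pth: "path_end Q (pth x l) = st x l"
  by (cases l) (auto simp: path_end_def pth_def pre_digraph.awalk_verts_conv last_map st_Suc)

lemma take_pth: "k \<le> l \<Longrightarrow> (x, take k (snd (pth x l))) = pth x k"
  by (simp add: pth_def take_map)

lemma drop_pth:
  assumes "k \<le> l"
  shows "(st x k, drop k (snd (pth x l))) = pth (st x k) (l - k)"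
proof -
  have "drop k (map (st x) [0..<l]) = map (st (st x k)) [0..<l - k]"
    by (rule nth_equalityI) (use assms in \<open>auto simp: st_add\<close>)
  then show ?thesis by (simp add: pth_def)
qed

lemma valid_split: "valid x (k + l) \<longleftrightarrow> valid x k \<and> valid (st x k) l"
proof
  assume v: "valid x (k + l)"
  have "st x k \<in> verts Q"
    using v by (cases k) (auto simp: valid_def st_Suc head_verts)
  moreover have "st (st x k) i \<in> arcs Q" if "i < l" for i
    using v that by (simp add: valid_def st_add)
  ultimately show "valid x k \<and> valid (st x k) l" using v by (simp add: valid_def)
next
  assume v: "valid x k \<and> valid (st x k) l"
  have "st x i \<in> arcs Q" if "i < k + l" for i
  proof (cases "i < k")
    case False
    then have "st (st x k) (i - k) \<in> arcs Q" using v that by (auto simp: valid_def)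
    then show ?thesis using False by (simp add: st_add)
  qed (use v in \<open>simp add: valid_def\<close>)
  then show "valid x (k + l)" using v by (simp add: valid_def)
qed

lemma carrier_path_algebra:
  "f \<in> carrier (PA) \<longleftrightarrow> finite {p. f p \<noteq> 0} \<and> (\<forall>p. f p \<noteq> 0 \<longrightarrow> p \<in> paths Q)"
  by (auto simp: path_algebra_def)

lemma path_algebra_supp: "f \<in> carrier (PA) \<Longrightarrow> f p \<noteq> 0 \<Longrightarrow> p \<in> paths Q"
  unfolding carrier_path_algebra by blast

lemma path_algebra_ext:
  assumes "f \<in> carrier (PA)" "g \<in> carrier (PA)"
    "\<And>x l. valid x l \<Longrightarrow> f (pth x l) = g (pth x l)"
  shows "f = g"
proof
  fix p show "f p = g p"
  proof (cases "p \<in> paths Q")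
    case True
    then obtain x l where "p = pth x l" "valid x l" using paths_iff by blast
    then show ?thesis using assms(3) by simp
  next
    case False
    then have "f p = 0" "g p = 0" using path_algebra_supp assms by blast+
    then show ?thesis by simp
  qed
qed

lemma path_algebra_add: "(f \<oplus>\<^bsub>PA\<^esub> g) p = f p + g p"
  and path_algebra_zero: "\<zero>\<^bsub>PA\<^esub> p = 0"
  and path_algebra_one: "valid x l \<Longrightarrow> \<one>\<^bsub>PA\<^esub> (pth x l) = (if l = 0 then 1 else 0)"
  by (simp_all add: path_algebra_def pth_def valid_def)

lemma path_algebra_mult:
  "(f \<otimes>\<^bsub>PA\<^esub> g) (pth x l) = (\<Sum>k\<le>l. f (pth (st x k) (l - k)) * g (pth x k))"
proof -
  have "(f \<otimes>\<^bsub>PA\<^esub> g) (pth x l) = (\<Sum>k\<le>length (snd (pth x l)).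
      f (path_end Q (x, take k (snd (pth x l))), drop k (snd (pth x l))) * g (x, take k (snd (pth x l))))"
    by (simp add: path_algebra_def pth_def)
  also have "\<dots> = (\<Sum>k\<le>l. f (pth (st x k) (l - k)) * g (pth x k))"
    by (rule sum.cong) (auto simp: pth_def take_pth[unfolded pth_def] path_end_pth[unfolded pth_def]
      drop_pth[unfolded pth_def, simplified] take_map min_def)
  finally show ?thesis .
qed

lemma path_algebra_mult_closed:
  assumes f: "f \<in> carrier (PA)" and g: "g \<in> carrier (PA)"
  shows "f \<otimes>\<^bsub>PA\<^esub> g \<in> carrier (PA)"
proof -
  \<comment> \<open>The support of a product consists of concatenations of paths from the two
    supports, hence is finite.\<close>
  let ?cat = "\<lambda>(p, q). (fst q, snd q @ snd p)"
  have nz: "(u, as) \<in> ?cat ` ({p. f p \<noteq> 0} \<times> {p. g p \<noteq> 0}) \<and> (u, as) \<in> paths Q"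
    if "(f \<otimes>\<^bsub>PA\<^esub> g) (u, as) \<noteq> 0" for u as
  proof -
    have "(\<Sum>k\<le>length as. f (path_end Q (u, take k as), drop k as) * g (u, take k as)) \<noteq> 0"
      using that by (simp add: path_algebra_def)
    then obtain k where k: "k \<le> length as" "f (path_end Q (u, take k as), drop k as) \<noteq> 0" "g (u, take k as) \<noteq> 0"
      by (elim sum.not_neutral_contains_not_neutral) auto
    have "(u, as) = ?cat ((path_end Q (u, take k as), drop k as), (u, take k as))" by simp
    then have 1: "(u, as) \<in> ?cat ` ({p. f p \<noteq> 0} \<times> {p. g p \<noteq> 0})" using k by blast
    obtain x l where xl: "(u, take k as) = pth x l" "valid x l"
      using path_algebra_supp[OF g k(3)] unfolding paths_iff by blast
    obtain y m where ym: "(path_end Q (u, take k as), drop k as) = pth y m" "valid y m"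
      using path_algebra_supp[OF f k(2)] unfolding paths_iff by blast
    have y: "y = st x l" using ym(1) path_end_pth[of x l] xl(1) by (simp add: pth_def)
    have "as = take k as @ drop k as" by simp
    also have "\<dots> = map (st x) [0..<l] @ map (st (st x l)) [0..<m]"
      using xl(1) ym(1) y by (simp add: pth_def)
    also have "\<dots> = map (st x) [0..<l + m]"
      by (rule nth_equalityI) (auto simp: nth_append st_add)
    finally have "(u, as) = pth x (l + m)" using xl(1) by (simp add: pth_def)
    moreover have "valid x (l + m)" using xl(2) ym(2) y by (simp add: valid_split)
    ultimately have "(u, as) \<in> paths Q" by (auto simp: paths_iff)
    then show ?thesis using 1 by blast
  qed
  have "{p. (f \<otimes>\<^bsub>PA\<^esub> g) p \<noteq> 0} \<subseteq> ?cat ` ({p. f p \<noteq> 0} \<times> {p. g p \<noteq> 0})"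
    using nz by auto
  moreover have "finite (?cat ` ({p. f p \<noteq> 0} \<times> {p. g p \<noteq> 0}))"
    using f g by (simp add: carrier_path_algebra)
  ultimately have "finite {p. (f \<otimes>\<^bsub>PA\<^esub> g) p \<noteq> 0}" by (rule finite_subset)
  then show ?thesis using nz unfolding carrier_path_algebra by (metis prod.collapse)
qed

lemma path_elem_pth: "path_elem (pth x l) (pth y m) = (if y = x \<and> m = l then 1 else 0)"
  by (simp add: path_elem_def)

lemma path_elem_in: "valid x l \<Longrightarrow> path_elem (pth x l) \<in> carrier (PA)"
  by (auto simp: carrier_path_algebra path_elem_def paths_iff)

lemma path_algebra_add_closed:
  assumes f: "f \<in> carrier (PA)" and g: "g \<in> carrier (PA)"
  shows "f \<oplus>\<^bsub>PA\<^esub> g \<in> carrier (PA)"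
proof -
  have "finite {p. f p + g p \<noteq> 0}"
    by (rule finite_subset[of _ "{p. f p \<noteq> 0} \<union> {p. g p \<noteq> 0}"])
      (use f g in \<open>auto simp: carrier_path_algebra\<close>)
  moreover have "p \<in> paths Q" if "f p + g p \<noteq> 0" for p
    using that path_algebra_supp[OF f, of p] path_algebra_supp[OF g, of p] by fastforce
  ultimately show ?thesis by (auto simp: carrier_path_algebra path_algebra_add)
qed

lemma scaled_in:
  assumes "f \<in> carrier (PA)"
  shows "(\<lambda>p. c * f p) \<in> carrier (PA)"
proof -
  have "finite {p. c * f p \<noteq> 0}"
    by (rule finite_subset[of _ "{p. f p \<noteq> 0}"]) (use assms in \<open>auto simp: carrier_path_algebra\<close>)
  then show ?thesis using assms by (simp add: carrier_path_algebra)
qed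

lemma path_algebra_one_closed:
  "\<one>\<^bsub>PA\<^esub> \<in> carrier (PA :: (('v, 'v) path \<Rightarrow> 'k::field) ring)"
proof -
  have sub: "{p. \<one>\<^bsub>PA\<^esub> p \<noteq> (0 :: 'k)} \<subseteq> (\<lambda>x. pth x 0) ` verts Q"
    by (auto simp: path_algebra_def pth_def split: if_splits)
  then have "finite {p. \<one>\<^bsub>PA\<^esub> p \<noteq> (0 :: 'k)}"
    by (rule finite_subset) (simp add: finite_verts)
  moreover have "p \<in> paths Q" if p: "\<one>\<^bsub>PA\<^esub> p \<noteq> (0 :: 'k)" for p
  proof -
    obtain x where "x \<in> verts Q" "p = pth x 0" using sub p by blast
    then show ?thesis unfolding paths_iff valid_def by blast
  qed
  ultimately show ?thesis unfolding carrier_path_algebra by blast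
qed

lemma path_algebra_ring: "ring (PA :: (('v, 'v) path \<Rightarrow> 'k::field) ring)"
proof (rule ringI)
  let ?A = "PA :: (('v, 'v) path \<Rightarrow> 'k) ring"
  show "abelian_group ?A"
  proof (rule abelian_groupI)
    fix f assume f: "f \<in> carrier ?A"
    show "\<exists>g\<in>carrier ?A. g \<oplus>\<^bsub>?A\<^esub> f = \<zero>\<^bsub>?A\<^esub>"
      by (rule bexI[of _ "\<lambda>p. (- 1) * f p"]) (use scaled_in[OF f, of "- 1"] in \<open>auto simp: fun_eq_iff path_algebra_add path_algebra_zero\<close>)
  next
    show "\<zero>\<^bsub>?A\<^esub> \<in> carrier ?A" unfolding carrier_path_algebra path_algebra_zero by simp
  qed (auto simp: fun_eq_iff path_algebra_add path_algebra_zero path_algebra_add_closed algebra_simps)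
  show "monoid ?A"
  proof (rule monoidI)
    fix f g h assume f: "f \<in> carrier ?A" and g: "g \<in> carrier ?A" and h: "h \<in> carrier ?A"
    show "f \<otimes>\<^bsub>?A\<^esub> g \<otimes>\<^bsub>?A\<^esub> h = f \<otimes>\<^bsub>?A\<^esub> (g \<otimes>\<^bsub>?A\<^esub> h)"
    proof (rule path_algebra_ext)
      fix x l
      \<comment> \<open>Both products sum over the cuts of a path into three parts; this exchanges
        the order in which the two cuts are chosen.\<close>
      have swap: "(\<Sum>j\<le>k. \<Sum>i\<le>j. F i (j - i) (n - j)) = (\<Sum>j\<le>k. \<Sum>i\<le>k - j. F j i (n - j - i))"
        for F :: "nat \<Rightarrow> nat \<Rightarrow> nat \<Rightarrow> 'k" and k n
        by (induct k) (simp_all add: Suc_diff_le sum.distrib add.assoc)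
      define F where "F k j m = f (pth (st x (k + j)) m) * (g (pth (st x k) j) * h (pth x k))" for k j m
      have "(f \<otimes>\<^bsub>?A\<^esub> g \<otimes>\<^bsub>?A\<^esub> h) (pth x l) = (\<Sum>k\<le>l. \<Sum>j\<le>l - k. F k j (l - k - j))"
        by (simp add: path_algebra_mult sum_distrib_right st_add F_def mult.assoc)
      also have "\<dots> = (\<Sum>k\<le>l. \<Sum>j\<le>k. F j (k - j) (l - k))" by (rule swap[symmetric])
      also have "\<dots> = (f \<otimes>\<^bsub>?A\<^esub> (g \<otimes>\<^bsub>?A\<^esub> h)) (pth x l)"
        by (simp add: path_algebra_mult sum_distrib_left F_def)
      finally show "(f \<otimes>\<^bsub>?A\<^esub> g \<otimes>\<^bsub>?A\<^esub> h) (pth x l) = (f \<otimes>\<^bsub>?A\<^esub> (g \<otimes>\<^bsub>?A\<^esub> h)) (pth x l)" .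
    qed (use f g h path_algebra_mult_closed in blast)+
  next
    fix f assume f: "f \<in> carrier ?A"
    show "\<one>\<^bsub>?A\<^esub> \<otimes>\<^bsub>?A\<^esub> f = f"
    proof (rule path_algebra_ext[OF path_algebra_mult_closed[OF path_algebra_one_closed f] f])
      fix x l assume v: "valid x l"
      have "(\<one>\<^bsub>?A\<^esub> \<otimes>\<^bsub>?A\<^esub> f) (pth x l) = (\<Sum>k\<le>l. if k = l then f (pth x l) else 0)"
        unfolding path_algebra_mult
      proof (rule sum.cong[OF refl])
        fix k assume "k \<in> {..l}"
        then have "valid (st x k) (l - k)" using v valid_split[of x k "l - k"] by simp
        then show "\<one>\<^bsub>?A\<^esub> (pth (st x k) (l - k)) * f (pth x k) = (if k = l then f (pth x l) else 0)"
          using \<open>k \<in> {..l}\<close> by (auto simp: path_algebra_one)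
      qed
      then show "(\<one>\<^bsub>?A\<^esub> \<otimes>\<^bsub>?A\<^esub> f) (pth x l) = f (pth x l)" by simp
    qed
    show "f \<otimes>\<^bsub>?A\<^esub> \<one>\<^bsub>?A\<^esub> = f"
    proof (rule path_algebra_ext[OF path_algebra_mult_closed[OF f path_algebra_one_closed] f])
      fix x l assume v: "valid x l"
      have "(f \<otimes>\<^bsub>?A\<^esub> \<one>\<^bsub>?A\<^esub>) (pth x l) = (\<Sum>k\<le>l. if k = 0 then f (pth x l) else 0)"
        unfolding path_algebra_mult
      proof (rule sum.cong[OF refl])
        fix k assume "k \<in> {..l}"
        then have "valid x k" using v valid_split[of x k "l - k"] by simp
        then show "f (pth (st x k) (l - k)) * \<one>\<^bsub>?A\<^esub> (pth x k) = (if k = 0 then f (pth x l) else 0)"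
          by (simp add: path_algebra_one)
      qed
      then show "(f \<otimes>\<^bsub>?A\<^esub> \<one>\<^bsub>?A\<^esub>) (pth x l) = f (pth x l)" by simp
    qed
  qed (auto intro: path_algebra_mult_closed path_algebra_one_closed)
  fix f g h assume "f \<in> carrier ?A" "g \<in> carrier ?A" "h \<in> carrier ?A"
  then show "(f \<oplus>\<^bsub>?A\<^esub> g) \<otimes>\<^bsub>?A\<^esub> h = f \<otimes>\<^bsub>?A\<^esub> h \<oplus>\<^bsub>?A\<^esub> g \<otimes>\<^bsub>?A\<^esub> h"
    "h \<otimes>\<^bsub>?A\<^esub> (f \<oplus>\<^bsub>?A\<^esub> g) = h \<otimes>\<^bsub>?A\<^esub> f \<oplus>\<^bsub>?A\<^esub> h \<otimes>\<^bsub>?A\<^esub> g"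
    by (auto intro!: path_algebra_ext path_algebra_mult_closed path_algebra_add_closed
      simp: path_algebra_mult path_algebra_add sum.distrib algebra_simps)
qed

section \<open>Products with single paths, and ideals given by supports\<close>

lemma path_elem_mult_left:
  assumes f: "f \<in> carrier (PA)"
  shows "(path_elem (pth y k) \<otimes>\<^bsub>PA\<^esub> f) (pth x l) =
    (if k \<le> l \<and> st x (l - k) = y then f (pth x (l - k)) else 0)"
proof -
  have "(path_elem (pth y k) \<otimes>\<^bsub>PA\<^esub> f) (pth x l) =
      (\<Sum>i\<le>l. if i = l - k then (if k \<le> l \<and> st x (l - k) = y then f (pth x (l - k)) else 0) else 0)"
    unfolding path_algebra_mult by (rule sum.cong) (auto simp: path_elem_pth)
  then show ?thesis by simp
qed

lemma path_elem_mult_right: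
  assumes f: "f \<in> carrier (PA)"
  shows "(f \<otimes>\<^bsub>PA\<^esub> path_elem (pth y k)) (pth x l) =
    (if k \<le> l \<and> x = y then f (pth (st x k) (l - k)) else 0)"
proof -
  have "(f \<otimes>\<^bsub>PA\<^esub> path_elem (pth y k)) (pth x l) =
      (\<Sum>i\<le>l. if i = k then (if k \<le> l \<and> x = y then f (pth (st x k) (l - k)) else 0) else 0)"
    unfolding path_algebra_mult by (rule sum.cong) (auto simp: path_elem_pth)
  then show ?thesis by simp
qed

lemma path_elem_mult:
  assumes "valid x (k + l)"
  shows "path_elem (pth (st x k) l) \<otimes>\<^bsub>PA\<^esub> path_elem (pth x k) =
    (path_elem (pth x (k + l)) :: _ \<Rightarrow> 'k::field)"
proof -
  have v: "valid x k" "valid (st x k) l" using assms by (auto simp: valid_split)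
  note e = path_elem_in[OF v(1), where 'a = 'k] path_elem_in[OF v(2), where 'a = 'k]
    path_elem_in[OF assms, where 'a = 'k]
  show ?thesis
    by (rule path_algebra_ext[OF path_algebra_mult_closed[OF e(2,1)] e(3)])
      (auto simp: path_elem_mult_right[OF e(2)] path_elem_pth)
qed

text \<open>Scaling by c is multiplication by c times the identity; this is why ring ideals of the
  path algebra are subspaces.\<close>

lemma scaled_eq:
  assumes "f \<in> carrier (PA)"
  shows "(\<lambda>p. c * f p) = (\<lambda>p. c * \<one>\<^bsub>PA\<^esub> p) \<otimes>\<^bsub>PA\<^esub> f"
proof (rule path_algebra_ext)
  fix x l assume v: "valid x l"
  have "((\<lambda>p. c * \<one>\<^bsub>PA\<^esub> p) \<otimes>\<^bsub>PA\<^esub> f) (pth x l) =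
      (\<Sum>k\<le>l. c * (\<one>\<^bsub>PA\<^esub> (pth (st x k) (l - k)) * f (pth x k)))"
    by (simp add: path_algebra_mult mult.assoc)
  also have "\<dots> = c * (\<one>\<^bsub>PA\<^esub> \<otimes>\<^bsub>PA\<^esub> f) (pth x l)"
    by (simp add: path_algebra_mult sum_distrib_left)
  also have "\<dots> = c * f (pth x l)"
    using monoid.l_one[OF ring.is_monoid[OF path_algebra_ring] assms] by simp
  finally show "c * f (pth x l) = ((\<lambda>p. c * \<one>\<^bsub>PA\<^esub> p) \<otimes>\<^bsub>PA\<^esub> f) (pth x l)" by simp
qed (auto intro: scaled_in path_algebra_mult_closed path_algebra_one_closed assms)

lemma ideal_scaled:
  assumes "ideal I (PA)" "f \<in> I"
  shows "(\<lambda>p. c * f p) \<in> I"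
proof -
  have f: "f \<in> carrier (PA)" using assms ideal.Icarr by metis
  show ?thesis unfolding scaled_eq[OF f]
    using assms scaled_in[OF path_algebra_one_closed] ideal.I_l_closed by metis
qed

lemma ideal_spanned:
  assumes I: "ideal I (PA)" and f: "f \<in> carrier (PA)"
    and "\<And>p. f p \<noteq> 0 \<Longrightarrow> path_elem p \<in> I"
  shows "f \<in> I"
proof -
  interpret I: ideal I "PA" by (rule I)
  have "f \<in> I" if "finite S" "{p. f p \<noteq> 0} = S" "f \<in> carrier (PA)" "\<forall>p\<in>S. path_elem p \<in> I" for S f
    using that
  proof (induction S arbitrary: f rule: finite_induct)
    case empty
    then have "f = \<zero>\<^bsub>PA\<^esub>" by (auto simp: fun_eq_iff path_algebra_zero)
    then show ?case by simp
  next
    case (insert p S)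
    let ?g = "f(p := 0)"
    have supp: "{q. ?g q \<noteq> 0} = S" using insert.prems(1) insert.hyps(2) by auto
    have "?g \<in> carrier (PA)"
      unfolding carrier_path_algebra supp using insert.hyps(1) path_algebra_supp[OF insert.prems(2)] by simp
    from insert.IH[OF supp this] have g: "?g \<in> I" using insert.prems(3) by blast
    have "f = ?g \<oplus>\<^bsub>PA\<^esub> (\<lambda>q. f p * path_elem p q)"
      by (auto simp: fun_eq_iff path_algebra_add path_elem_def)
    moreover have "?g \<oplus>\<^bsub>PA\<^esub> (\<lambda>q. f p * path_elem p q) \<in> I"
    proof -
      have "path_elem p \<in> I" using insert.prems(3) by blast
      from additive_subgroup.a_closed[OF ideal.axioms(1)[OF I] g ideal_scaled[OF I this]]
      show ?thesis .
    qed
    ultimately show ?case by (simp only:)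
  qed
  then show ?thesis using f assms(3) by (auto simp: carrier_path_algebra)
qed

text \<open>Meant for properties that a path inherits from its subpaths. Such ideals bound a
  generated ideal from above, which is how paths are shown not to lie in it.\<close>

lemma idealI_supp:
  assumes "\<And>x l k. valid x l \<Longrightarrow> P x l \<Longrightarrow> valid x (l + k) \<Longrightarrow> P x (l + k)"
    and "\<And>x l k. valid x (k + l) \<Longrightarrow> P (st x k) l \<Longrightarrow> P x (k + l)"
  shows "ideal {f \<in> carrier (PA). \<forall>x l. valid x l \<longrightarrow> f (pth x l) \<noteq> 0 \<longrightarrow> P x l}
    (PA :: (('v, 'v) path \<Rightarrow> 'k::field) ring)" (is "ideal ?I ?A")
proof -
  interpret ring ?A by (rule path_algebra_ring)
  have inv: "(\<ominus>\<^bsub>?A\<^esub> f) p = - f p" if "f \<in> carrier ?A" for f p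
  proof -
    have "(f \<oplus>\<^bsub>?A\<^esub> \<ominus>\<^bsub>?A\<^esub> f) p = 0" using that by (simp add: r_neg path_algebra_zero)
    then show ?thesis by (simp add: path_algebra_add eq_neg_iff_add_eq_0 add.commute)
  qed
  show ?thesis
  proof (rule idealI[OF ring_axioms])
    show "subgroup ?I (add_monoid ?A)"
    proof (rule subgroup.intro)
      fix f assume "f \<in> ?I"
      then have "\<ominus>\<^bsub>?A\<^esub> f \<in> ?I" using inv[of f] by simp
      then show "inv\<^bsub>add_monoid ?A\<^esub> f \<in> ?I" unfolding a_inv_def .
    next
      fix f g assume "f \<in> ?I" "g \<in> ?I"
      then show "f \<otimes>\<^bsub>add_monoid ?A\<^esub> g \<in> ?I"
        by (auto simp: path_algebra_add) (metis add.right_neutral add_0)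
    qed (auto simp: path_algebra_zero)
    fix f g assume f: "f \<in> ?I" and g: "g \<in> carrier ?A"
    have "P x l" if v: "valid x l" and nz: "(g \<otimes>\<^bsub>?A\<^esub> f) (pth x l) \<noteq> 0" for x l
    proof -
      obtain k where k: "k \<le> l" "f (pth x k) \<noteq> 0"
        using nz unfolding path_algebra_mult by (elim sum.not_neutral_contains_not_neutral) auto
      have "valid x k" using v valid_split[of x k "l - k"] k by simp
      then show ?thesis using assms(1)[of x k "l - k"] f k v by simp
    qed
    then show "g \<otimes>\<^bsub>?A\<^esub> f \<in> ?I" using f g by simp
    have "P x l" if v: "valid x l" and nz: "(f \<otimes>\<^bsub>?A\<^esub> g) (pth x l) \<noteq> 0" for x l
    proof -
      obtain k where k: "k \<le> l" "f (pth (st x k) (l - k)) \<noteq> 0"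
        using nz unfolding path_algebra_mult by (elim sum.not_neutral_contains_not_neutral) auto
      have "valid (st x k) (l - k)" using v valid_split[of x k "l - k"] k by simp
      then show ?thesis using assms(2)[of x k "l - k"] f k v by simp
    qed
    then show "f \<otimes>\<^bsub>?A\<^esub> g \<in> ?I" using f g by simp
  qed
qed

section \<open>The arrow ideal and its powers\<close>

lemma arrow_ideal_is_ideal:
  "ideal (arrow_ideal Q) (PA :: (('v, 'v) path \<Rightarrow> 'k::field) ring)"
  and arrow_ideal_coeff: "f \<in> (arrow_ideal Q :: (('v, 'v) path \<Rightarrow> 'k) set) \<Longrightarrow> valid x 0 \<Longrightarrow> f (pth x 0) = 0"
  and arrow_in_arrow_ideal: "a \<in> arcs Q \<Longrightarrow> path_elem (pth a 1) \<in> (arrow_ideal Q :: (('v, 'v) path \<Rightarrow> 'k) set)"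
proof -
  interpret ring "PA :: (('v, 'v) path \<Rightarrow> 'k) ring" by (rule path_algebra_ring)
  let ?S = "{path_elem (tail Q a, [a]) | a. a \<in> arcs Q} :: (('v, 'v) path \<Rightarrow> 'k) set"
  have S: "?S = (\<lambda>a. path_elem (pth a 1)) ` arcs Q"
    by (auto simp: tail_id pth_def)
  have v: "valid a 1" if "a \<in> arcs Q" for a using that arcs_verts by (simp add: valid_def)
  have sub: "?S \<subseteq> carrier (PA)" unfolding S using path_elem_in[OF v] by blast
  then show "ideal (arrow_ideal Q) (PA :: (('v, 'v) path \<Rightarrow> 'k) ring)"
    unfolding arrow_ideal_def by (rule genideal_ideal)
  show "path_elem (pth a 1) \<in> (arrow_ideal Q :: (('v, 'v) path \<Rightarrow> 'k) set)" if "a \<in> arcs Q"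
    unfolding arrow_ideal_def using genideal_self[OF sub] S that by blast
  let ?K = "{f \<in> carrier (PA). \<forall>x l. valid x l \<longrightarrow> f (pth x l) \<noteq> 0 \<longrightarrow> l \<noteq> 0}
    :: (('v, 'v) path \<Rightarrow> 'k) set"
  have "ideal ?K (PA)" by (rule idealI_supp) auto
  moreover have "?S \<subseteq> ?K" using sub unfolding S by (auto simp: path_elem_pth split: if_splits)
  ultimately have "arrow_ideal Q \<subseteq> ?K" unfolding arrow_ideal_def by (rule genideal_minimal)
  then show "f (pth x 0) = 0" if "f \<in> arrow_ideal Q" "valid x 0" using that by blast
qed

text \<open>For \<open>m = 2\<close> this keeps vertices and arrows nonzero modulo an admissible
  ideal.\<close>

lemma ideal_power_coeff:
  assumes "f \<in> ideal_power (PA :: (('v, 'v) path \<Rightarrow> 'k::field) ring) (arrow_ideal Q) m"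
  shows "f \<in> carrier (PA) \<and> (\<forall>x l. valid x l \<longrightarrow> l < m \<longrightarrow> f (pth x l) = 0)"
  using assms
proof (induction m arbitrary: f)
  case 0
  then show ?case by (simp add: ideal_power_def)
next
  case (Suc m)
  interpret J: ideal "arrow_ideal Q" "PA :: (('v, 'v) path \<Rightarrow> 'k) ring"
    by (rule arrow_ideal_is_ideal)
  have "f \<in> ideal_prod (PA) (arrow_ideal Q) (ideal_power (PA) (arrow_ideal Q) m)"
    using Suc.prems by (simp add: ideal_power_def)
  then show ?case
  proof (induction rule: ideal_prod.induct)
    case (prod i j)
    have j: "j \<in> carrier (PA)" "\<And>x l. valid x l \<Longrightarrow> l < m \<Longrightarrow> j (pth x l) = 0"
      using Suc.IH[OF prod(2)] by auto
    have i: "i \<in> carrier (PA)" using prod(1) by (rule J.Icarr)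
    have "(i \<otimes>\<^bsub>PA\<^esub> j) (pth x l) = 0" if v: "valid x l" and l: "l < Suc m" for x l
      unfolding path_algebra_mult
    proof (rule sum.neutral, intro ballI)
      fix k assume k: "k \<in> {..l}"
      have vk: "valid x k" "valid (st x k) (l - k)" using v valid_split[of x k "l - k"] k by auto
      show "i (pth (st x k) (l - k)) * j (pth x k) = 0"
      proof (cases "k < m")
        case True
        then show ?thesis using j(2)[OF vk(1)] by simp
      next
        case False
        \<comment> \<open>Here \<open>k = l = m\<close>, so the left factor contributes its
          coefficient at a trivial path, which vanishes in the arrow ideal.\<close>
        then have "l - k = 0" using k l by simp
        then show ?thesis using arrow_ideal_coeff[OF prod(1)] vk(2) by simp
      qed
    qed
    then show ?case using path_algebra_mult_closed[OF i j(1)] by blast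
  next
    case (sum f g)
    have "f \<oplus>\<^bsub>PA\<^esub> g \<in> carrier (PA)"
      using sum by (intro path_algebra_add_closed) auto
    then show ?case by (rule conjI) (use sum in \<open>simp add: path_algebra_add\<close>)
  qed
qed

text \<open>Since an admissible ideal contains a power of the arrow ideal, it contains all paths
  with that many arrows, and the lengths \<open>L\<close> are finite.\<close>

lemma path_elem_in_ideal_power:
  "valid x m \<Longrightarrow> path_elem (pth x m) \<in> ideal_power (PA :: (('v, 'v) path \<Rightarrow> 'k::field) ring) (arrow_ideal Q) m"
proof (induction m)
  case 0
  then show ?case by (simp add: ideal_power_def path_elem_in)
next
  case (Suc m)
  have v: "valid x m" "st x m \<in> arcs Q" using Suc.prems by (auto simp: valid_def)
  have "path_elem (pth (st x m) 1) \<otimes>\<^bsub>PA\<^esub> path_elem (pth x m) \<in>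
      ideal_prod (PA :: (('v, 'v) path \<Rightarrow> 'k) ring) (arrow_ideal Q)
        (ideal_power (PA) (arrow_ideal Q) m)"
    by (rule ideal_prod.prod[OF arrow_in_arrow_ideal[OF v(2)] Suc.IH[OF v(1)]])
  then show ?case using path_elem_mult[of x m 1, where ?'k = 'k] Suc.prems by (simp add: ideal_power_def)
qed

end

section \<open>Admissible quotients\<close>

locale succ_quiver_algebra = succ_quiver Q
  for Q :: "('v, 'v) pre_digraph" +
  fixes I :: "(('v, 'v) path \<Rightarrow> 'k::field) set"
  assumes admissible: "admissible_ideal Q I"
begin

abbreviation KQ :: "(('v, 'v) path \<Rightarrow> 'k) ring" where "KQ \<equiv> path_algebra Q"

lemma I_ideal: "ideal I KQ"
  using admissible by (simp add: admissible_ideal_def)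

sublocale I: ideal I KQ by (rule I_ideal)

lemma I_add: "f \<in> I \<Longrightarrow> g \<in> I \<Longrightarrow> f \<oplus>\<^bsub>KQ\<^esub> g \<in> I"
  by (rule additive_subgroup.a_closed[OF ideal.axioms(1)[OF I_ideal]])

definition nz :: "'v \<Rightarrow> nat \<Rightarrow> bool" where
  "nz x l \<longleftrightarrow> valid x l \<and> path_elem (pth x l) \<notin> I"

definition L :: "'v \<Rightarrow> nat" where "L x = (LEAST l. \<not> nz x l)"

lemma nz_prefix:
  assumes "nz x (k + l)"
  shows "nz x k \<and> nz (st x k) l"
proof -
  have v: "valid x (k + l)" "valid x k" "valid (st x k) l"
    using assms by (auto simp: nz_def valid_split)
  have n: "path_elem (pth (st x k) l) \<otimes>\<^bsub>KQ\<^esub> path_elem (pth x k) \<notin> I"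
    unfolding path_elem_mult[OF v(1)] using assms by (simp add: nz_def)
  have "path_elem (pth x k) \<notin> I"
    using n I.I_l_closed[OF _ path_elem_in[OF v(3)]] by blast
  moreover have "path_elem (pth (st x k) l) \<notin> I"
    using n I.I_r_closed[OF _ path_elem_in[OF v(2)]] by blast
  ultimately show ?thesis using v by (simp add: nz_def)
qed

lemma bounded: "\<exists>l. \<not> nz x l"
proof -
  obtain m where "ideal_power KQ (arrow_ideal Q) m \<subseteq> I"
    using admissible by (auto simp: admissible_ideal_def)
  then show ?thesis using path_elem_in_ideal_power[of x m, where ?'k = 'k] by (auto simp: nz_def)
qed

lemma less_L_iff: "l < L x \<longleftrightarrow> nz x l"
proof
  show "nz x l" if "l < L x" using that not_less_Least unfolding L_def by blast
  assume nz: "nz x l"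
  have "\<not> nz x (L x)" unfolding L_def using bounded by (rule LeastI_ex)
  then have "\<not> L x \<le> l" using nz_prefix[of x "L x" "l - L x"] nz by auto
  then show "l < L x" by simp
qed

lemma nz_if_short: "valid x l \<Longrightarrow> l < 2 \<Longrightarrow> nz x l"
proof -
  assume v: "valid x l" "l < 2"
  have "path_elem (pth x l) \<notin> I"
  proof
    assume "path_elem (pth x l) \<in> I"
    then have "(path_elem (pth x l) :: _ \<Rightarrow> 'k) \<in> ideal_power KQ (arrow_ideal Q) 2"
      using admissible by (auto simp: admissible_ideal_def)
    from ideal_power_coeff[OF this] have "(path_elem (pth x l) (pth x l) :: 'k) = 0" using v by blast
    then show False by (simp add: path_elem_pth)
  qed
  then show "nz x l" using v by (simp add: nz_def)
qed

lemma valid_0: "valid x 0 \<longleftrightarrow> x \<in> verts Q"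
  by (simp add: valid_def)

lemma nz_vert: "nz x l \<Longrightarrow> x \<in> verts Q"
  by (simp add: nz_def valid_def)

text \<open>Dropping the first arrow of a nonzero path leaves a nonzero path, which is the
  inequality between \<open>L x\<close> and \<open>L (head Q x)\<close>.\<close>

sublocale K: kupisch "verts Q" "head Q" L
proof
  show "finite (verts Q)" by (rule finite_verts)
  fix x assume x: "x \<in> verts Q"
  then have "0 < L x" using nz_if_short[of x 0] by (simp add: less_L_iff valid_0)
  then show "1 \<le> L x" by simp
  assume L2: "2 \<le> L x"
  then have "nz x (1 + 0)" using less_L_iff[of 1 x] by simp
  from nz_prefix[OF this] have "nz (head Q x) 0" by (simp add: st_Suc)
  then show "head Q x \<in> verts Q" by (rule nz_vert)
  show "L x \<le> L (head Q x) + 1"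
  proof (rule ccontr)
    assume "\<not> L x \<le> L (head Q x) + 1"
    then have "1 + L (head Q x) < L x" by simp
    then have "nz x (1 + L (head Q x))" by (simp only: less_L_iff)
    from nz_prefix[OF this] have "nz (head Q x) (L (head Q x))" by (simp add: st_Suc)
    then show False using less_L_iff by blast
  qed
qed

lemma sh_eq: "K.sh = st"
  by (simp add: fun_eq_iff K.sh_def st_def)

text \<open>
  \<open>I\<close> is spanned by paths: if the shortest path from \<open>y\<close> in an element of \<open>I\<close> is not in \<open>I\<close>, extend it to
  the longest path from \<open>y\<close> that is not in \<open>I\<close>; all other terms are then too long to survive.
\<close>

lemma ideal_coeff_zero:
  assumes h: "h \<in> I" and "nz y l"
  shows "h (pth y l) = 0"
  using assms(2)
proof (induction l rule: less_induct)
  case (less l)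
  have hc: "h \<in> carrier KQ" using h by (rule I.Icarr)
  have y: "y \<in> verts Q" using less.prems by (rule nz_vert)
  have lL: "l < L y" using less.prems less_L_iff by simp
  \<comment> \<open>Chosen such that the path with \<open>l + t\<close> arrows is the longest one
    from y outside \<open>I\<close>.\<close>
  define t where "t = L y - 1 - l"
  have nzL: "nz y (l + t)" unfolding t_def using lL less_L_iff[of "L y - 1" y] by simp
  have v: "valid y 0" "valid (st y l) t" using nz_prefix[OF nzL] y by (auto simp: nz_def valid_0)
  note e = path_elem_in[OF v(1), where ?'a = 'k] path_elem_in[OF v(2), where ?'a = 'k]
  \<comment> \<open>Right multiplication selects the terms starting at y. After the extension by
    \<open>t\<close> arrows, terms longer than \<open>l\<close> fall into \<open>I\<close>; shorter
    ones that stay outside \<open>I\<close> have coefficient zero by induction.\<close>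
  define g where "g = path_elem (pth (st y l) t) \<otimes>\<^bsub>KQ\<^esub> (h \<otimes>\<^bsub>KQ\<^esub> path_elem (pth y 0))"
  have hy: "h \<otimes>\<^bsub>KQ\<^esub> path_elem (pth y 0) \<in> I" using I.I_r_closed[OF h e(1)] .
  have g: "g \<in> I" unfolding g_def by (rule I.I_l_closed[OF hy e(2)])
  have g_pth: "g (pth z k) = (if t \<le> k \<and> st z (k - t) = st y l \<and> z = y then h (pth y (k - t)) else 0)" for z k
    unfolding g_def path_elem_mult_left[OF I.Icarr[OF hy]] path_elem_mult_right[OF hc] by auto
  have pc: "path_elem (pth y (l + t)) \<in> carrier KQ" using nzL by (intro path_elem_in) (simp add: nz_def)
  \<comment> \<open>Cancels the term of \<open>g\<close> at the longest path. All other terms lie in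
    \<open>I\<close>, so the sum of \<open>g\<close> and \<open>d\<close>, and hence
    \<open>d\<close>, is in \<open>I\<close>; this is impossible unless the coefficient is
    zero.\<close>
  define d where "d = (\<lambda>p. (- h (pth y l)) * path_elem (pth y (l + t)) p)"
  have dc: "d \<in> carrier KQ" unfolding d_def by (rule scaled_in[OF pc])
  have "g \<oplus>\<^bsub>KQ\<^esub> d \<in> I"
  proof (rule ideal_spanned[OF I_ideal path_algebra_add_closed[OF I.Icarr[OF g] dc]])
    fix p assume p: "(g \<oplus>\<^bsub>KQ\<^esub> d) p \<noteq> 0"
    then obtain z k where zk: "p = pth z k" "valid z k"
      using path_algebra_supp[OF path_algebra_add_closed[OF I.Icarr[OF g] dc]] unfolding paths_iff by blast
    have gd: "g (pth z k) + d (pth z k) \<noteq> 0" using p unfolding zk path_algebra_add .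
    show "path_elem p \<in> I"
    proof (rule ccontr)
      assume "path_elem p \<notin> I"
      then have nzk: "nz z k" using zk by (simp add: nz_def)
      have "g (pth z k) + d (pth z k) = 0"
      proof (cases "t \<le> k \<and> z = y")
        case True
        then have "k < L y" using nzk less_L_iff by blast
        then have kl: "k - t \<le> l" unfolding t_def using True lL by linarith
        show ?thesis
        proof (cases "k - t = l")
          case eq: True
          then have "k = l + t" using True by linarith
          then show ?thesis using True by (simp add: g_pth d_def path_elem_pth)
        next
          case False
          have "nz y (k - t)" using nz_prefix[of y "k - t" t] nzk True by simp
          then have "h (pth y (k - t)) = 0" using less.IH kl False by simp
          then show ?thesis using True False by (auto simp: g_pth d_def path_elem_pth)
        qed
      next
        case False
        then show ?thesis by (auto simp: g_pth d_def path_elem_pth)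
      qed
      then show False using gd by contradiction
    qed
  qed
  moreover have "(\<lambda>p. (- 1) * g p) \<in> I" by (rule ideal_scaled[OF I_ideal g])
  ultimately have "(\<lambda>p. (- 1) * g p) \<oplus>\<^bsub>KQ\<^esub> (g \<oplus>\<^bsub>KQ\<^esub> d) \<in> I" by (rule I_add[rotated])
  also have "(\<lambda>p. (- 1) * g p) \<oplus>\<^bsub>KQ\<^esub> (g \<oplus>\<^bsub>KQ\<^esub> d) = d"
    by (rule ext) (simp add: path_algebra_add)
  finally have dI: "d \<in> I" .
  show ?case
  proof (rule ccontr)
    assume nz0: "h (pth y l) \<noteq> 0"
    have "(\<lambda>p. inverse (- h (pth y l)) * d p) \<in> I" by (rule ideal_scaled[OF I_ideal dI])
    moreover have "(\<lambda>p. inverse (- h (pth y l)) * d p) = path_elem (pth y (l + t))"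
      using nz0 by (simp add: fun_eq_iff d_def)
    ultimately show False using nzL by (simp add: nz_def)
  qed
qed

lemma ideal_iff:
  "h \<in> I \<longleftrightarrow> h \<in> carrier KQ \<and> (\<forall>x l. nz x l \<longrightarrow> h (pth x l) = 0)"
proof
  assume h: "h \<in> carrier KQ \<and> (\<forall>x l. nz x l \<longrightarrow> h (pth x l) = 0)"
  show "h \<in> I"
  proof (rule ideal_spanned[OF I_ideal])
    fix p assume p: "h p \<noteq> 0"
    then obtain x l where "p = pth x l" "valid x l" using h path_algebra_supp unfolding paths_iff by metis
    then show "path_elem p \<in> I" using h p by (auto simp: nz_def)
  qed (use h in simp)
qed (use ideal_coeff_zero I.Icarr in blast)

section \<open>The path basis of the quotient algebra\<close>

abbreviation A :: "(('v, 'v) path \<Rightarrow> 'k) set ring" where "A \<equiv> quiver_algebra Q I"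

text \<open>Representatives of a coset differ by an element of \<open>I\<close>, which by
  \<open>ideal_coeff_zero\<close> has coefficient zero at paths outside \<open>I\<close>; so the
  choice does not affect the value.\<close>

definition co :: "(('v, 'v) path \<Rightarrow> 'k) set \<Rightarrow> 'v \<Rightarrow> nat \<Rightarrow> 'k" where
  "co a y l = (if nz y l then (SOME f. f \<in> a) (pth y l) else 0)"

lemma carrier_A: "a \<in> carrier A \<longleftrightarrow> (\<exists>f\<in>carrier KQ. a = I +>\<^bsub>KQ\<^esub> f)"
  unfolding quiver_algebra_def FactRing_def A_RCOSETS_def' by auto

lemma co_coset:
  assumes f: "f \<in> carrier KQ" and nz: "nz y l"
  shows "co (I +>\<^bsub>KQ\<^esub> f) y l = f (pth y l)"
proof -
  have "f \<in> I +>\<^bsub>KQ\<^esub> f" using f by (rule I.a_rcos_self)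
  then have "(SOME g. g \<in> I +>\<^bsub>KQ\<^esub> f) \<in> I +>\<^bsub>KQ\<^esub> f"
    by (rule someI[where P = "\<lambda>g. g \<in> I +>\<^bsub>KQ\<^esub> f"])
  then obtain h where "h \<in> I" "(SOME g. g \<in> I +>\<^bsub>KQ\<^esub> f) = h \<oplus>\<^bsub>KQ\<^esub> f"
    unfolding a_r_coset_def' by auto
  then show ?thesis using ideal_coeff_zero[of h y l] nz by (simp add: co_def path_algebra_add)
qed

lemma coset_eqI:
  assumes "f \<in> carrier KQ" "g \<in> carrier KQ" "\<And>y l. nz y l \<Longrightarrow> f (pth y l) = g (pth y l)"
  shows "I +>\<^bsub>KQ\<^esub> f = I +>\<^bsub>KQ\<^esub> g"
proof -
  have "f \<ominus>\<^bsub>KQ\<^esub> g \<in> I"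
    unfolding ideal_iff
  proof (intro conjI allI impI)
    fix x l assume nz: "nz x l"
    have "(f \<ominus>\<^bsub>KQ\<^esub> g) \<oplus>\<^bsub>KQ\<^esub> g = f" using assms by (simp add: I.minus_eq I.a_assoc I.l_neg)
    then have "(f \<ominus>\<^bsub>KQ\<^esub> g) (pth x l) + g (pth x l) = f (pth x l)" by (metis path_algebra_add)
    then show "(f \<ominus>\<^bsub>KQ\<^esub> g) (pth x l) = 0" using assms(3)[OF nz] by simp
  qed (use assms in simp)
  then show ?thesis using I.quotient_eq_iff_same_a_r_cos[OF I_ideal assms(1,2)] by simp
qed

lemma A_add: "f \<in> carrier KQ \<Longrightarrow> g \<in> carrier KQ \<Longrightarrow>
    (I +>\<^bsub>KQ\<^esub> f) \<oplus>\<^bsub>A\<^esub> (I +>\<^bsub>KQ\<^esub> g) = I +>\<^bsub>KQ\<^esub> (f \<oplus>\<^bsub>KQ\<^esub> g)"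
  and A_mult: "f \<in> carrier KQ \<Longrightarrow> g \<in> carrier KQ \<Longrightarrow>
    (I +>\<^bsub>KQ\<^esub> f) \<otimes>\<^bsub>A\<^esub> (I +>\<^bsub>KQ\<^esub> g) = I +>\<^bsub>KQ\<^esub> (f \<otimes>\<^bsub>KQ\<^esub> g)"
  unfolding quiver_algebra_def FactRing_def by (simp_all add: I.a_rcos_sum I.rcoset_mult_add)

sublocale B: path_basis "verts Q" "head Q" L A co
proof (intro path_basis.intro path_basis_axioms.intro K.kupisch_axioms)
  show "ring A" unfolding quiver_algebra_def by (rule I.quotient_is_ring)
next
  fix a y l assume "a \<in> carrier A" "\<not> (y \<in> verts Q \<and> l < L y)"
  then show "co a y l = 0" using nz_vert by (auto simp: co_def less_L_iff)
next
  fix a b assume "a \<in> carrier A" "b \<in> carrier A" and eq: "co a = co b"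
  then obtain f g where fg: "f \<in> carrier KQ" "a = I +>\<^bsub>KQ\<^esub> f" "g \<in> carrier KQ" "b = I +>\<^bsub>KQ\<^esub> g"
    unfolding carrier_A by blast
  show "a = b" unfolding fg(2,4)
  proof (rule coset_eqI[OF fg(1,3)])
    fix y l assume nz: "nz y l"
    show "f (pth y l) = g (pth y l)"
      using eq co_coset[OF fg(1) nz] co_coset[OF fg(3) nz] fg by simp
  qed
next
  fix c :: "'v \<Rightarrow> nat \<Rightarrow> 'k"
  define f where "f p = (if \<exists>y l. p = pth y l \<and> nz y l then c (fst p) (length (snd p)) else 0)" for p
  have f_pth: "f (pth y l) = c y l" if "nz y l" for y l
    using that by (auto simp: f_def) (simp add: pth_def)
  have sub: "{p. f p \<noteq> 0} \<subseteq> (\<lambda>(y, l). pth y l) ` (SIGMA y:verts Q. {..<L y})"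
    using nz_vert by (force simp: f_def less_L_iff split: if_splits)
  have "finite {p. f p \<noteq> 0}"
    by (rule finite_subset[OF sub]) (use finite_verts in auto)
  moreover have "p \<in> paths Q" if "f p \<noteq> 0" for p
    using that unfolding f_def paths_iff nz_def by (auto split: if_splits)
  ultimately have f: "f \<in> carrier KQ" unfolding carrier_path_algebra by blast
  then have "I +>\<^bsub>KQ\<^esub> f \<in> carrier A" unfolding carrier_A by blast
  moreover have "co (I +>\<^bsub>KQ\<^esub> f) y l = c y l" if "l < L y" for y l
    using that co_coset[OF f] f_pth by (simp add: less_L_iff)
  ultimately show "\<exists>a\<in>carrier A. \<forall>y\<in>verts Q. \<forall>l<L y. co a y l = c y l" by blast
next
  fix a b y l assume "a \<in> carrier A" "b \<in> carrier A"
  then obtain f g where fg: "f \<in> carrier KQ" "a = I +>\<^bsub>KQ\<^esub> f" "g \<in> carrier KQ" "b = I +>\<^bsub>KQ\<^esub> g"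
    unfolding carrier_A by blast
  show "co (a \<oplus>\<^bsub>A\<^esub> b) y l = co a y l + co b y l"
  proof (cases "nz y l")
    case True
    then show ?thesis unfolding fg(2,4) A_add[OF fg(1,3)]
      by (simp add: co_coset fg path_algebra_add)
  qed (simp add: co_def)
  assume y: "y \<in> verts Q" and l: "l < L y"
  then have nz: "nz y l" by (simp add: less_L_iff)
  have "co (a \<otimes>\<^bsub>A\<^esub> b) y l = (\<Sum>k\<le>l. f (pth (st y k) (l - k)) * g (pth y k))"
    unfolding fg(2,4) A_mult[OF fg(1,3)] co_coset[OF path_algebra_mult_closed[OF fg(1,3)] nz]
    by (rule path_algebra_mult)
  also have "\<dots> = (\<Sum>i\<le>l. co a (K.sh y i) (l - i) * co b y i)"
  proof (rule sum.cong[OF refl])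
    fix k assume "k \<in> {..l}"
    then have "nz y k" "nz (st y k) (l - k)" using nz_prefix[of y k "l - k"] nz by auto
    then show "f (pth (st y k) (l - k)) * g (pth y k) = co a (K.sh y k) (l - k) * co b y k"
      by (simp add: fg co_coset sh_eq)
  qed
  finally show "co (a \<otimes>\<^bsub>A\<^esub> b) y l = (\<Sum>i\<le>l. co a (K.sh y i) (l - i) * co b y i)" .
qed

lemma vertex_idem_eq:
  assumes x: "x \<in> verts Q"
  shows "vertex_idem Q I x = B.single 1 x 0"
proof -
  have e: "path_elem (pth x 0) \<in> carrier KQ" using x by (intro path_elem_in) (simp add: valid_0)
  have v: "vertex_idem Q I x = I +>\<^bsub>KQ\<^esub> path_elem (pth x 0)" by (simp add: vertex_idem_def pth_def)
  have L0: "0 < L x" using K.L_pos[OF x] by simp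
  have "co (vertex_idem Q I x) y l = co (B.single 1 x 0) y l" for y l
    unfolding B.co_single[OF x L0] using co_coset[OF e, of y l] nz_if_short[of x 0] x
    by (cases "nz y l"; cases "l = 0") (auto simp: v path_elem_pth co_def valid_0)
  moreover have "vertex_idem Q I x \<in> carrier A" unfolding v carrier_A using e by blast
  ultimately show ?thesis by (intro B.co_inj) (auto simp: fun_eq_iff)
qed

lemma proj_at_eq: "x \<in> verts Q \<Longrightarrow> proj_at Q I x = B.proj x"
  by (simp add: proj_at_def B.proj_def vertex_idem_eq)

lemma simple_at_eq: "x \<in> verts Q \<Longrightarrow> simple_at Q I x = B.simp_mod x"
  by (simp add: simple_at_def B.simp_mod_def proj_at_eq)

lemma weyl_module_eq: "x \<in> verts Q \<Longrightarrow> weyl_module Q I r x = B.weyl r x"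
  unfolding weyl_module_def B.weyl_def by (simp add: proj_at_eq simple_at_eq)

lemma scalar_elem:
  "scalar_elem Q I c \<in> carrier A"
  "nz y l \<Longrightarrow> co (scalar_elem Q I c) y l = (if l = 0 then c else 0)"
proof -
  have "(\<lambda>p. c * \<one>\<^bsub>KQ\<^esub> p) \<in> carrier KQ" by (rule scaled_in[OF path_algebra_one_closed])
  then show "scalar_elem Q I c \<in> carrier A"
    "nz y l \<Longrightarrow> co (scalar_elem Q I c) y l = (if l = 0 then c else 0)"
    unfolding scalar_elem_def carrier_A by (auto simp: co_coset path_algebra_one nz_def)
qed

lemma q_ordering_iff: "q_ordering Q I r \<longleftrightarrow> K.q_ord r"
proof (cases "linear_order_on (verts Q) r")
  case True
  have "End_iso_field Q I (weyl_module Q I r x) \<longleftrightarrow> (\<forall>k. 0 < k \<and> k < K.D r x \<longrightarrow> K.sh x k \<noteq> x)"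
    if x: "x \<in> verts Q" for x
  proof -
    obtain \<psi> where "B.coord (weyl_module Q I r x) x (K.D r x) \<psi>"
      using B.coord_weyl[OF x] by (auto simp: weyl_module_eq[OF x])
    from B.coord_End_iff[of "scalar_elem Q I", OF _ _ this K.D_pos[OF True x]]
    show ?thesis unfolding End_iso_field_def by (simp add: scalar_elem less_L_iff)
  qed
  moreover have "good_module Q I r (proj_at Q I x) \<longleftrightarrow> K.reach r x (L x)" if x: "x \<in> verts Q" for x
    unfolding good_module_def proj_at_eq[OF x]
    using B.coord_good_iff[OF True B.coord_proj[OF x] x, of "weyl_module Q I r"] B.coord_weyl
    by (simp add: weyl_module_eq)
  ultimately show ?thesis using True by (simp add: q_ordering_def K.q_ord_def)
qed (simp add: q_ordering_def K.q_ord_def)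

lemma num_q_orderings_eq: "num_q_orderings Q I = card {r. K.q_ord r}"
  by (simp add: num_q_orderings_def q_ordering_iff)

lemma hereditary_iff: "hereditary A \<longleftrightarrow> (\<forall>x. \<not> K.relation_at x)"
  by (rule B.hereditary_iff)

section \<open>Minimal relations and generators of the ideal\<close>

lemma relation_at_valid:
  assumes rel: "K.relation_at x"
  shows "valid x (L x)" "path_elem (pth x (L x)) \<in> I"
proof -
  have x: "x \<in> verts Q" "2 \<le> L x" "L x \<le> L (head Q x)" using rel by (auto simp: K.relation_at_def)
  have "1 < L x" "L x - 1 < L (head Q x)" using x by simp_all
  then have "nz x 1" "nz (head Q x) (L x - 1)" by (simp_all only: less_L_iff)
  then have "valid x 1" "valid (st x 1) (L x - 1)" by (auto simp: nz_def st_Suc)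
  then have "valid x (1 + (L x - 1))" using valid_split by blast
  then show "valid x (L x)" using x by simp
  then show "path_elem (pth x (L x)) \<in> I" using less_L_iff[of "L x" x] by (simp add: nz_def)
qed

text \<open>Minimality of a zero path means that the two longest proper subpaths, without the last
  and without the first arrow, survive.\<close>

lemma relation_atI:
  assumes v: "valid x l" and l: "path_elem (pth x l) \<in> I"
    and min: "nz x (l - 1)" "nz (head Q x) (l - 1)"
  shows "K.relation_at x" "L x = l"
proof -
  have l2: "2 \<le> l"
  proof (rule ccontr)
    assume "\<not> 2 \<le> l"
    then show False using nz_if_short[OF v] l by (simp add: nz_def)
  qed
  have "\<not> nz x l" using l by (simp add: nz_def)
  then show L: "L x = l" using min(1) less_L_iff[of "l - 1" x] less_L_iff[of l x] l2 by simp
  have "l - 1 < L (head Q x)" using min(2) less_L_iff by simp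
  then show "K.relation_at x"
    using L l2 nz_vert[OF min(1)] nz_vert[OF min(2)] by (simp add: K.relation_at_def)
qed

text \<open>Elements supported on paths that run through x with at least two arrows to go form an
  ideal, so every path in \<open>I\<close> does this. If a relation at y did so after its first
  arrow, the subpath from \<open>head Q y\<close>, nonzero because of
  \<open>L y \<le> L (head Q y)\<close>, would contain the generator.\<close>

lemma principal_ideal_relation:
  assumes v: "valid x 2" and I: "I = Idl\<^bsub>KQ\<^esub> {path_elem (pth x 2)}"
  shows "K.relation_at x" "L x = 2" "K.relation_at y \<Longrightarrow> y = x"
proof -
  have pc: "path_elem (pth x 2) \<in> carrier KQ" using v by (rule path_elem_in)
  have "path_elem (pth x 2) \<in> I" unfolding I by (rule I.genideal_self'[OF pc])
  moreover have "nz x 1" "nz (head Q x) 1"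
    using v valid_split[of x 1 1] by (auto intro!: nz_if_short simp: st_Suc numeral_2_eq_2)
  ultimately show rel: "K.relation_at x" "L x = 2" using relation_atI[OF v] by simp_all
  let ?P = "\<lambda>y l. \<exists>i. st y i = x \<and> i + 2 \<le> l"
  have "ideal {f \<in> carrier KQ. \<forall>y l. valid y l \<longrightarrow> f (pth y l) \<noteq> 0 \<longrightarrow> ?P y l} KQ" (is "ideal ?J KQ")
  proof (rule idealI_supp)
    fix y l k assume "?P y l"
    then show "?P y (l + k)" by force
  next
    fix y l k assume "?P (st y k) l"
    then obtain i where "st y (k + i) = x" "i + 2 \<le> l" by (auto simp: st_add)
    then show "?P y (k + l)" by (intro exI[of _ "k + i"]) auto
  qed
  moreover have "{path_elem (pth x 2)} \<subseteq> ?J" using pc by (auto simp: path_elem_pth split: if_splits)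
  ultimately have IJ: "I \<subseteq> ?J" unfolding I by (rule I.genideal_minimal)
  assume "K.relation_at y"
  then have y: "valid y (L y)" "path_elem (pth y (L y)) \<in> I" "2 \<le> L y" "L y \<le> L (head Q y)"
    using relation_at_valid by (auto simp: K.relation_at_def)
  have "(path_elem (pth y (L y)) (pth y (L y)) :: 'k) \<noteq> 0" by (simp add: path_elem_pth)
  then have "?P y (L y)" using IJ y by blast
  then obtain i where i: "st y i = x" "i + 2 \<le> L y" by blast
  show "y = x"
  proof (cases i)
    case (Suc j)
    then have "j + 2 < L (head Q y)" using y(4) i(2) by simp
    then have "nz (head Q y) (j + 2)" by (simp only: less_L_iff)
    then have "nz (head Q y) j \<and> nz (st (head Q y) j) 2" by (rule nz_prefix)
    moreover have "st (head Q y) j = x" using i(1) Suc by (simp add: st_head)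
    ultimately show ?thesis using \<open>path_elem (pth x 2) \<in> I\<close> by (simp add: nz_def)
  qed (use i in simp)
qed

text \<open>Induction on the number of arrows: a zero path from some y other than x remains zero
  without its first arrow, as \<open>L y = L (head Q y) + 1\<close>, while a zero path from x begins
  with the generator.\<close>

lemma unique_relation_principal:
  assumes rel: "K.relation_at x" and L2: "L x = 2" and uniq: "\<And>y. K.relation_at y \<Longrightarrow> y = x"
  shows "I = Idl\<^bsub>KQ\<^esub> {path_elem (pth x 2)}" "valid x 2"
proof -
  show v: "valid x 2" using relation_at_valid(1)[OF rel] L2 by simp
  have pI: "path_elem (pth x 2) \<in> I" using relation_at_valid(2)[OF rel] L2 by simp
  have pc: "path_elem (pth x 2) \<in> carrier KQ" using v by (rule path_elem_in)
  let ?J = "Idl\<^bsub>KQ\<^esub> {path_elem (pth x 2)}"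
  have J: "ideal ?J KQ" using pc by (intro I.genideal_ideal) simp
  interpret J: ideal ?J KQ by (rule J)
  have gen: "path_elem (pth y l) \<in> ?J" if "valid y l" "path_elem (pth y l) \<in> I" for y l
    using that
  proof (induction l arbitrary: y rule: less_induct)
    case (less l)
    have y: "y \<in> verts Q" using less.prems(1) by (simp add: valid_def)
    have nl: "\<not> nz y l" using less.prems by (simp add: nz_def)
    then have "\<not> l < 2" using nz_if_short[OF less.prems(1)] by blast
    moreover have "\<not> l < L y" using nl less_L_iff by blast
    ultimately have l: "L y \<le> l" "2 \<le> l" by simp_all
    have v1: "valid y (1 + (l - 1))" using less.prems(1) l by simp
    then have v1': "valid y 1" "valid (head Q y) (l - 1)" unfolding valid_split by (simp_all add: st_Suc)
    have Ly2: "2 \<le> L y" using nz_if_short[OF v1'(1)] less_L_iff[of 1 y] by simp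
    show ?case
    proof (cases "y = x")
      case True
      have e2: "2 + (l - 2) = l" using l(2) by (rule le_add_diff_inverse)
      have "valid x (2 + (l - 2))" unfolding e2 using less.prems(1) True by simp
      then have "path_elem (pth (st x 2) (l - 2)) \<otimes>\<^bsub>KQ\<^esub> path_elem (pth x 2) = path_elem (pth x (2 + (l - 2)))"
        and "valid (st x 2) (l - 2)"
        using path_elem_mult[of x 2 "l - 2", where ?'k = 'k] valid_split by blast+
      moreover from this have "path_elem (pth (st x 2) (l - 2)) \<otimes>\<^bsub>KQ\<^esub> path_elem (pth x 2) \<in> ?J"
        using I.genideal_self'[OF pc] by (intro J.I_l_closed path_elem_in)
      ultimately show ?thesis using True e2 by (simp only:)
    next
      case False
      then have "L y = L (head Q y) + 1" using uniq K.not_relation_at[OF y Ly2] by blast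
      then have "\<not> l - 1 < L (head Q y)" using l by linarith
      then have "\<not> nz (head Q y) (l - 1)" by (simp only: less_L_iff not_False_eq_True)
      then have "path_elem (pth (head Q y) (l - 1)) \<in> I" using v1'(2) by (simp add: nz_def)
      then have "path_elem (pth (head Q y) (l - 1)) \<in> ?J" using less.IH[of "l - 1"] v1'(2) l by simp
      then have "path_elem (pth (st y 1) (l - 1)) \<otimes>\<^bsub>KQ\<^esub> path_elem (pth y 1) \<in> ?J"
        using path_elem_in[OF v1'(1), where ?'a = 'k] by (intro J.I_r_closed) (simp_all add: st_Suc)
      then show ?thesis using path_elem_mult[OF v1, where ?'k = 'k] l by simp
    qed
  qed
  have "I \<subseteq> ?J"
  proof
    fix f assume f: "f \<in> I"
    show "f \<in> ?J"
    proof (rule ideal_spanned[OF J I.Icarr[OF f]])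
      fix p assume p: "f p \<noteq> 0"
      obtain y l where yl: "p = pth y l" "valid y l"
        using path_algebra_supp[OF I.Icarr[OF f] p] unfolding paths_iff by blast
      then have "path_elem (pth y l) \<in> I" using ideal_coeff_zero[OF f, of y l] p by (auto simp: nz_def)
      then show "path_elem p \<in> ?J" using gen yl by simp
    qed
  qed
  moreover have "?J \<subseteq> I" using pI by (intro I.genideal_minimal I_ideal) simp
  ultimately show "I = ?J" by blast
qed

end

section \<open>The bound and its equality case for Nakayama algebras\<close>

locale nakayama_quiver_algebra = succ_quiver_algebra Q I
  for Q :: "('v, 'v) pre_digraph" and I :: "(('v, 'v) path \<Rightarrow> 'k::field) set" +
  assumes inj_head: "inj_on (head Q) (verts Q)"
    and head_neq: "x \<in> verts Q \<Longrightarrow> head Q x \<noteq> x"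
    and head_head_neq: "3 \<le> card (verts Q) \<Longrightarrow> x \<in> verts Q \<Longrightarrow> head Q (head Q x) \<noteq> x"
begin

sublocale C: kupisch_cycle "verts Q" "head Q" L
  by unfold_locales (rule inj_head, rule head_neq, assumption, rule head_head_neq)

lemma num_q_orderings_hereditary:
  assumes "hereditary A"
  shows "num_q_orderings Q I = fact (card (verts Q))"
proof -
  have "{r. K.q_ord r} = {r. linear_order_on (verts Q) r}"
    using K.q_ord_if_no_relation assms by (auto simp: hereditary_iff K.q_ord_def)
  then show ?thesis
    by (simp add: num_q_orderings_eq card_linear_orders[OF finite_verts])
qed

lemma num_q_orderings_not_hereditary:
  assumes "\<not> hereditary A" "2 \<le> card (verts Q)"
  shows "3 * num_q_orderings Q I \<le> 2 * fact (card (verts Q))"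
proof -
  obtain x where rel: "K.relation_at x" using assms(1) by (auto simp: hereditary_iff)
  show ?thesis
  proof (cases "3 \<le> card (verts Q)")
    case True
    then show ?thesis using C.card_q_ord_le(1)[OF rel] by (simp add: num_q_orderings_eq)
  next
    case False
    then have "card (verts Q) = 2" using assms(2) by simp
    then show ?thesis using C.card_q_ord_le_two[OF rel] by (simp add: num_q_orderings_eq)
  qed
qed

lemma principal_not_hereditary:
  assumes "p \<in> paths Q" "path_length p = 3" "I = Idl\<^bsub>KQ\<^esub> {path_elem p}"
  obtains x where "p = pth x 2" "K.relation_at x" "L x = 2" "\<And>y. K.relation_at y \<Longrightarrow> y = x"
proof -
  obtain x l where xl: "p = pth x l" "valid x l" using assms(1) paths_iff by blast
  have "l = 2" using assms(2) xl(1) by (simp add: path_length_def pth_def)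
  then show ?thesis using that principal_ideal_relation[of x] xl assms(3) by blast
qed

lemma num_q_orderings_eq_iff:
  assumes nh: "\<not> hereditary A" and n2: "2 \<le> card (verts Q)"
  shows "3 * num_q_orderings Q I = 2 * fact (card (verts Q)) \<longleftrightarrow>
    3 \<le> card (verts Q) \<and> (\<exists>p\<in>paths Q. path_length p = 3 \<and> I = Idl\<^bsub>KQ\<^esub> {path_elem p})"
proof
  assume eq: "3 * num_q_orderings Q I = 2 * fact (card (verts Q))"
  have n3: "3 \<le> card (verts Q)"
  proof (rule ccontr)
    assume "\<not> 3 \<le> card (verts Q)"
    then have "card (verts Q) = 2" using n2 by simp
    \<comment> \<open>Impossible, since the left-hand side is a multiple of 3.\<close>
    then have "3 * num_q_orderings Q I = 4" using eq by simp
    then show False by presburger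
  qed
  obtain x where rel: "K.relation_at x" using nh by (auto simp: hereditary_iff)
  note eq' = eq[unfolded num_q_orderings_eq]
  have "L x = 2" using C.card_q_ord_le(2)[OF rel n3 eq'] by blast
  then have I: "I = Idl\<^bsub>KQ\<^esub> {path_elem (pth x 2)}" "valid x 2"
    using unique_relation_principal[OF rel] C.card_q_ord_eq_unique[OF eq' n3 _ rel] by blast+
  then have "pth x 2 \<in> paths Q" "path_length (pth x 2) = 3"
    by (auto simp: paths_iff path_length_def pth_def)
  then show "3 \<le> card (verts Q) \<and> (\<exists>p\<in>paths Q. path_length p = 3 \<and> I = Idl\<^bsub>KQ\<^esub> {path_elem p})"
    using n3 I(1) by blast
next
  assume "3 \<le> card (verts Q) \<and> (\<exists>p\<in>paths Q. path_length p = 3 \<and> I = Idl\<^bsub>KQ\<^esub> {path_elem p})"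
  then obtain p where n3: "3 \<le> card (verts Q)" and p: "p \<in> paths Q" "path_length p = 3" "I = Idl\<^bsub>KQ\<^esub> {path_elem p}"
    by blast
  obtain x where x: "K.relation_at x" "L x = 2" "\<And>y. K.relation_at y \<Longrightarrow> y = x"
    using principal_not_hereditary[OF p] by blast
  have v: "x \<in> verts Q" "head Q x \<in> verts Q" "head Q (head Q x) \<in> verts Q"
    using x(1) C.relation_at_nx_nx[OF x(1)] by (auto simp: K.relation_at_def)
  let ?T = "orders_not_max (verts Q) x (head Q x) (head Q (head Q x))"
  \<comment> \<open>The lower bound that matches the general upper bound.\<close>
  have "?T \<subseteq> {r. K.q_ord r}" using C.orders_not_max_subset_q_ord[OF x] by blast
  then have "card ?T \<le> num_q_orderings Q I"
    unfolding num_q_orderings_eq by (rule card_mono[OF K.finite_q_ord])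
  moreover have "3 * card ?T = 2 * fact (card (verts Q))"
    using v head_neq[OF v(1)] head_neq[OF v(2)] head_head_neq[OF n3 v(1)]
    by (intro card_orders_not_max finite_verts) auto
  ultimately show "3 * num_q_orderings Q I = 2 * fact (card (verts Q))"
    using num_q_orderings_not_hereditary[OF nh n2] by linarith
qed

end

section \<open>The linear and the cyclic quiver\<close>

lemma linear_quiver_nakayama:
  assumes "admissible_ideal (linear_quiver n) I"
  shows "nakayama_quiver_algebra (linear_quiver n) I"
  by unfold_locales (use assms in \<open>auto simp: linear_quiver_def\<close>)

text \<open>On the cycle, \<open>2 \<le> n\<close> excludes loops, and two steps then lead back to
  the start only for \<open>n = 2\<close>.\<close>

lemma cyclic_quiver_nakayama:
  assumes "2 \<le> n" "admissible_ideal (cyclic_quiver n) I"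
  shows "nakayama_quiver_algebra (cyclic_quiver n) I"
  by unfold_locales (use assms in \<open>auto simp: cyclic_quiver_def inj_on_def split: if_splits\<close>)

theorem theorem4p7:
  fixes n :: nat
    and Q :: "(nat, nat) pre_digraph"
    and I :: "((nat, nat) path \<Rightarrow> 'k::alg_closed_field) set"
  assumes "n \<ge> 2"
    and "Q = linear_quiver n \<or> Q = cyclic_quiver n"
    and "admissible_ideal Q I"
  shows "(\<not> hereditary (quiver_algebra Q I) \<longrightarrow>
            real (num_q_orderings Q I) \<le> 2 / 3 * fact n) \<and>
         (real (num_q_orderings Q I) = 2 / 3 * fact n \<longleftrightarrow>
            n \<ge> 3 \<and> (\<exists>p\<in>paths Q. path_length p = 3 \<and> I = Idl\<^bsub>path_algebra Q\<^esub> {path_elem p})) \<and>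
         (real (num_q_orderings Q I) > 2 / 3 * fact n \<longleftrightarrow> num_q_orderings Q I = fact n) \<and>
         (num_q_orderings Q I = fact n \<longleftrightarrow> hereditary (quiver_algebra Q I))"
proof -
  interpret nakayama_quiver_algebra Q I
    using assms linear_quiver_nakayama cyclic_quiver_nakayama by blast
  have card: "card (verts Q) = n"
    using assms(2) by (auto simp: linear_quiver_def cyclic_quiver_def)
  let ?q = "num_q_orderings Q I"
  have pos: "0 < (fact n :: nat)" by simp
  have le: "real ?q \<le> 2 / 3 * fact n \<longleftrightarrow> 3 * ?q \<le> 2 * fact n"
  proof -
    have "3 * ?q \<le> 2 * fact n \<longleftrightarrow> real (3 * ?q) \<le> real (2 * fact n)" by (simp only: of_nat_le_iff)
    then show ?thesis by (simp add: field_simps)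
  qed
  have eq: "real ?q = 2 / 3 * fact n \<longleftrightarrow> 3 * ?q = 2 * fact n"
  proof -
    have "3 * ?q = 2 * fact n \<longleftrightarrow> real (3 * ?q) = real (2 * fact n)" by (simp only: of_nat_eq_iff)
    then show ?thesis by auto
  qed
  show ?thesis
  proof (cases "hereditary A")
    case True
    have q: "?q = fact n" using num_q_orderings_hereditary[OF True] card by simp
    \<comment> \<open>A generator of length 3 would itself be a minimal relation, which a hereditary
      algebra does not have.\<close>
    have "\<not> (\<exists>p\<in>paths Q. path_length p = 3 \<and> I = Idl\<^bsub>KQ\<^esub> {path_elem p})"
      using principal_not_hereditary True hereditary_iff by metis
    moreover have "\<not> 3 * ?q \<le> 2 * fact n" using q pos by simp
    ultimately show ?thesis using True q le eq by (metis less_le_not_le linorder_not_le order_refl)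
  next
    case False
    have q: "3 * ?q \<le> 2 * fact n" using num_q_orderings_not_hereditary[OF False] card assms(1) by simp
    then have "?q \<noteq> fact n" using pos by auto
    moreover have "3 * ?q = 2 * fact n \<longleftrightarrow>
        3 \<le> n \<and> (\<exists>p\<in>paths Q. path_length p = 3 \<and> I = Idl\<^bsub>KQ\<^esub> {path_elem p})"
      using num_q_orderings_eq_iff[OF False] card assms(1) by simp
    ultimately show ?thesis using False q le eq by (metis linorder_not_le)
  qed
qed

end
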